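(* Let $(\mathcal{A},E,\mathcal{B})$ be an operator-valued $C^*$-probability space and $B_0,B_1\in\mathcal{A}$ centered $\mathcal{B}$-valued Bernoulli elements with variance maps $\eta_0,\eta_1:\mathcal{B}\to\mathcal{B}$. Then for every $k\in\mathbb{N}$ and $\mathfrak b\in\mathbb{H}^+(M_k(\mathcal{B}))$, $$\big\|\mathcal G^{M_k(\mathcal{B})}_{1_k\otimes B_1}(\mathfrak b)-\mathcal G^{M_k(\mathcal{B})}_{1_k\otimes B_0}(\mathfrak b)\big\|\le k\|(\operatorname{Im}\mathfrak b)^{-1}\|^3\|\eta_1-\eta_0\|.$$ If moreover $\mathcal{A}$ is a von Neumann algebra with faithful normal state $\varphi$ with $\varphi=\varphi\circ E$, then for every $\epsilon>0$, $$\frac1\pi\int_{\mathbb{R}}|\mathcal G_{B_1}(t+i\epsilon)-\mathcal G_{B_0}(t+i\epsilon)|\,dt\le\frac{1}{\epsilon^2}\|\eta_1-\eta_0\|,$$ and $L(\mu_{B_1},\mu_{B_0})\le c\|\eta_1-\eta_0\|^{1/5}$ with $c=5(1/(4\pi))^{2/5}$.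
   Context: $(\mathcal{A},E,\mathcal{B})$: unital $C^*$-algebra, unital $C^*$-subalgebra $\mathcal{B}$, completely positive conditional expectation $E$. A centered $\mathcal{B}$-valued Bernoulli element with variance $\eta$ is $s=s^*\in\mathcal{A}$ with $E[b_0sb_1s\cdots sb_k]=b_0\eta(b_1)b_2\eta(b_3)\cdots\eta(b_{k-1})b_k$ for $k$ even and $0$ for $k$ odd ($\eta(b)=E[sbs]$). For $k\in\mathbb{N}$ and $\mathfrak b\in M_k(\mathcal{B})$ with $\frac1{2i}(\mathfrak b-\mathfrak b^* )$ positive invertible (i.e. $\mathfrak b\in\mathbb{H}^+(M_k(\mathcal{B}))$), $\mathcal G^{M_k(\mathcal{B})}_{1_k\otimes s}(\mathfrak b)=(\mathrm{id}_k\otimes E)[(\mathfrak b-1_k\otimes s)^{-1}]$. $\|\eta\|$ is the operator norm of $\eta:\mathcal{B}\to\mathcal{B}$. $\mathcal G_s(z)=\varphi[(z-s)^{-1}]$, $\mu_s$ is the distribution of $s$ w.r.t. $\varphi$, and $L$ the Lévy distance $L(\mu,\nu)=\inf\{\epsilon>0:\mathcal F_\mu(t-\epsilon)-\epsilon\le\mathcal F_\nu(t)\le\mathcal F_\mu(t+\epsilon)+\epsilon\ \forall t\}$. *)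

theory Defs
  imports "HOL-Probability.Probability"
begin

text \<open>A unital complex Banach *-algebra satisfying the C*-identity. The complex
scalar multiplication is an explicit operation, since the distribution has no
class of complex vector spaces.\<close>

class cstar_algebra = real_normed_algebra_1 + banach +
  fixes adj :: "'a \<Rightarrow> 'a"
    and cscale :: "complex \<Rightarrow> 'a \<Rightarrow> 'a"
  assumes adj_adj: "adj (adj x) = x"
    and adj_add: "adj (x + y) = adj x + adj y"
    and adj_mult: "adj (x * y) = adj y * adj x"
    and adj_cscale: "adj (cscale c x) = cscale (cnj c) (adj x)"
    and cscale_of_real: "cscale (complex_of_real r) x = r *\<^sub>R x"
    and cscale_add_left: "cscale (a + b) x = cscale a x + cscale b x"
    and cscale_add_right: "cscale a (x + y) = cscale a x + cscale a y"
    and cscale_cscale: "cscale a (cscale b x) = cscale (a * b) x"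
    and cscale_left_mult: "cscale a x * y = cscale a (x * y)"
    and cscale_right_mult: "x * cscale a y = cscale a (x * y)"
    and norm_cscale: "norm (cscale a x) = cmod a * norm x"
    and cstar_identity: "norm (adj x * x) = (norm x)\<^sup>2"

definition clinear :: "('a::cstar_algebra \<Rightarrow> 'b::cstar_algebra) \<Rightarrow> bool" where
  "clinear f \<longleftrightarrow> (\<forall>x y. f (x + y) = f x + f y) \<and> (\<forall>c x. f (cscale c x) = cscale c (f x))"

definition cfunctional :: "('a::cstar_algebra \<Rightarrow> complex) \<Rightarrow> bool" where
  "cfunctional f \<longleftrightarrow> (\<forall>x y. f (x + y) = f x + f y) \<and> (\<forall>c x. f (cscale c x) = c * f x)"

definition invertible_el :: "'a::cstar_algebra \<Rightarrow> bool" where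
  "invertible_el a \<longleftrightarrow> (\<exists>y. a * y = 1 \<and> y * a = 1)"

definition inverse_el :: "'a::cstar_algebra \<Rightarrow> 'a" where
  "inverse_el a = (THE y. a * y = 1 \<and> y * a = 1)"

definition spectrum_el :: "'a::cstar_algebra \<Rightarrow> complex set" where
  "spectrum_el a = {c. \<not> invertible_el (a - cscale c 1)}"

definition positive_el :: "'a::cstar_algebra \<Rightarrow> bool" where
  "positive_el a \<longleftrightarrow> adj a = a \<and> spectrum_el a \<subseteq> complex_of_real ` {0..}"

definition le_el :: "'a::cstar_algebra \<Rightarrow> 'a \<Rightarrow> bool" where
  "le_el a b \<longleftrightarrow> positive_el (b - a)"

definition cstar_subalgebra :: "'a::cstar_algebra set \<Rightarrow> bool" where
  "cstar_subalgebra B \<longleftrightarrow> 1 \<in> B \<and> (\<forall>x\<in>B. \<forall>y\<in>B. x + y \<in> B \<and> x * y \<in> B)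
     \<and> (\<forall>c. \<forall>x\<in>B. cscale c x \<in> B) \<and> (\<forall>x\<in>B. adj x \<in> B) \<and> closed B"

definition is_mat :: "nat \<Rightarrow> (nat \<Rightarrow> nat \<Rightarrow> 'a::cstar_algebra) \<Rightarrow> bool" where
  "is_mat k X \<longleftrightarrow> (\<forall>i j. (k \<le> i \<or> k \<le> j) \<longrightarrow> X i j = 0)"

definition mat_in :: "nat \<Rightarrow> 'a::cstar_algebra set \<Rightarrow> (nat \<Rightarrow> nat \<Rightarrow> 'a) \<Rightarrow> bool" where
  "mat_in k B X \<longleftrightarrow> is_mat k X \<and> (\<forall>i<k. \<forall>j<k. X i j \<in> B)"

definition mat_one :: "nat \<Rightarrow> nat \<Rightarrow> nat \<Rightarrow> 'a::cstar_algebra" where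
  "mat_one k = (\<lambda>i j. if i = j \<and> i < k then 1 else 0)"

definition mat_diag :: "nat \<Rightarrow> 'a::cstar_algebra \<Rightarrow> nat \<Rightarrow> nat \<Rightarrow> 'a" where
  "mat_diag k s = (\<lambda>i j. if i = j \<and> i < k then s else 0)"

definition mat_mult :: "nat \<Rightarrow> (nat \<Rightarrow> nat \<Rightarrow> 'a::cstar_algebra) \<Rightarrow> (nat \<Rightarrow> nat \<Rightarrow> 'a) \<Rightarrow> nat \<Rightarrow> nat \<Rightarrow> 'a" where
  "mat_mult k X Y = (\<lambda>i j. \<Sum>l<k. X i l * Y l j)"

definition mat_add :: "(nat \<Rightarrow> nat \<Rightarrow> 'a::cstar_algebra) \<Rightarrow> (nat \<Rightarrow> nat \<Rightarrow> 'a) \<Rightarrow> nat \<Rightarrow> nat \<Rightarrow> 'a" where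
  "mat_add X Y = (\<lambda>i j. X i j + Y i j)"

definition mat_diff :: "(nat \<Rightarrow> nat \<Rightarrow> 'a::cstar_algebra) \<Rightarrow> (nat \<Rightarrow> nat \<Rightarrow> 'a) \<Rightarrow> nat \<Rightarrow> nat \<Rightarrow> 'a" where
  "mat_diff X Y = (\<lambda>i j. X i j - Y i j)"

definition mat_scale :: "complex \<Rightarrow> (nat \<Rightarrow> nat \<Rightarrow> 'a::cstar_algebra) \<Rightarrow> nat \<Rightarrow> nat \<Rightarrow> 'a" where
  "mat_scale c X = (\<lambda>i j. cscale c (X i j))"

definition mat_adj :: "(nat \<Rightarrow> nat \<Rightarrow> 'a::cstar_algebra) \<Rightarrow> nat \<Rightarrow> nat \<Rightarrow> 'a" where
  "mat_adj X = (\<lambda>i j. adj (X j i))"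

definition mat_map :: "('a::cstar_algebra \<Rightarrow> 'a) \<Rightarrow> (nat \<Rightarrow> nat \<Rightarrow> 'a) \<Rightarrow> nat \<Rightarrow> nat \<Rightarrow> 'a" where
  "mat_map f X = (\<lambda>i j. f (X i j))"

definition mat_invertible :: "nat \<Rightarrow> (nat \<Rightarrow> nat \<Rightarrow> 'a::cstar_algebra) \<Rightarrow> bool" where
  "mat_invertible k X \<longleftrightarrow>
     (\<exists>Y. is_mat k Y \<and> mat_mult k X Y = mat_one k \<and> mat_mult k Y X = mat_one k)"

definition mat_inverse :: "nat \<Rightarrow> (nat \<Rightarrow> nat \<Rightarrow> 'a::cstar_algebra) \<Rightarrow> nat \<Rightarrow> nat \<Rightarrow> 'a" where
  "mat_inverse k X =
     (THE Y. is_mat k Y \<and> mat_mult k X Y = mat_one k \<and> mat_mult k Y X = mat_one k)"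

definition mat_spectrum :: "nat \<Rightarrow> (nat \<Rightarrow> nat \<Rightarrow> 'a::cstar_algebra) \<Rightarrow> complex set" where
  "mat_spectrum k X = {c. \<not> mat_invertible k (mat_diff X (mat_scale c (mat_one k)))}"

definition mat_positive :: "nat \<Rightarrow> (nat \<Rightarrow> nat \<Rightarrow> 'a::cstar_algebra) \<Rightarrow> bool" where
  "mat_positive k X \<longleftrightarrow> is_mat k X \<and> mat_adj X = X \<and> mat_spectrum k X \<subseteq> complex_of_real ` {0..}"

text \<open>The (unique) C*-norm on M_k(A): ||X||^2 = spectral radius of X^* X.\<close>
definition mat_norm :: "nat \<Rightarrow> (nat \<Rightarrow> nat \<Rightarrow> 'a::cstar_algebra) \<Rightarrow> real" where
  "mat_norm k X = sqrt (Sup (cmod ` mat_spectrum k (mat_mult k (mat_adj X) X)))"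

definition mat_Im :: "(nat \<Rightarrow> nat \<Rightarrow> 'a::cstar_algebra) \<Rightarrow> nat \<Rightarrow> nat \<Rightarrow> 'a" where
  "mat_Im X = mat_scale (1 / (2 * \<i>)) (mat_diff X (mat_adj X))"

definition mat_upper_half :: "nat \<Rightarrow> 'a::cstar_algebra set \<Rightarrow> (nat \<Rightarrow> nat \<Rightarrow> 'a) \<Rightarrow> bool" where
  "mat_upper_half k B X \<longleftrightarrow> mat_in k B X \<and> mat_positive k (mat_Im X) \<and> mat_invertible k (mat_Im X)"

definition cauchy_mat :: "('a::cstar_algebra \<Rightarrow> 'a) \<Rightarrow> nat \<Rightarrow> 'a \<Rightarrow> (nat \<Rightarrow> nat \<Rightarrow> 'a) \<Rightarrow> nat \<Rightarrow> nat \<Rightarrow> 'a" where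
  "cauchy_mat E k s b = mat_map E (mat_inverse k (mat_diff b (mat_diag k s)))"

definition completely_positive :: "('a::cstar_algebra \<Rightarrow> 'a) \<Rightarrow> bool" where
  "completely_positive E \<longleftrightarrow> (\<forall>k X. mat_positive k X \<longrightarrow> mat_positive k (mat_map E X))"

definition opval_cstar_prob_space :: "('a::cstar_algebra \<Rightarrow> 'a) \<Rightarrow> 'a set \<Rightarrow> bool" where
  "opval_cstar_prob_space E B \<longleftrightarrow> cstar_subalgebra B \<and> clinear E \<and> range E \<subseteq> B
     \<and> (\<forall>b\<in>B. E b = b) \<and> (\<forall>b1\<in>B. \<forall>b2\<in>B. \<forall>x. E (b1 * x * b2) = b1 * E x * b2)
     \<and> completely_positive E"

fun sword :: "'a::cstar_algebra \<Rightarrow> 'a list \<Rightarrow> 'a" where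
  "sword s [] = 1"
| "sword s [b] = b"
| "sword s (b # bs) = b * s * sword s bs"

fun alt_prod :: "('a::cstar_algebra \<Rightarrow> 'a) \<Rightarrow> 'a list \<Rightarrow> 'a" where
  "alt_prod \<eta> [] = 1"
| "alt_prod \<eta> [b] = b"
| "alt_prod \<eta> (b0 # b1 # bs) = b0 * \<eta> b1 * alt_prod \<eta> bs"

definition variance :: "('a::cstar_algebra \<Rightarrow> 'a) \<Rightarrow> 'a \<Rightarrow> 'a \<Rightarrow> 'a" where
  "variance E s = (\<lambda>b. E (s * b * s))"

definition bernoulli :: "('a::cstar_algebra \<Rightarrow> 'a) \<Rightarrow> 'a set \<Rightarrow> 'a \<Rightarrow> bool" where
  "bernoulli E B s \<longleftrightarrow> adj s = s \<and>
     (\<forall>bs. bs \<noteq> [] \<and> set bs \<subseteq> B \<longrightarrow>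
        E (sword s bs) = (if even (length bs - 1) then alt_prod (variance E s) bs else 0))"

definition op_norm_on :: "'a::cstar_algebra set \<Rightarrow> ('a \<Rightarrow> 'a) \<Rightarrow> real" where
  "op_norm_on B f = Sup ((\<lambda>b. norm (f b)) ` {b \<in> B. norm b \<le> 1})"

definition state :: "('a::cstar_algebra \<Rightarrow> complex) \<Rightarrow> bool" where
  "state \<phi> \<longleftrightarrow> cfunctional \<phi> \<and> \<phi> 1 = 1
     \<and> (\<forall>a. positive_el a \<longrightarrow> \<phi> a \<in> complex_of_real ` {0..})"

definition faithful :: "('a::cstar_algebra \<Rightarrow> complex) \<Rightarrow> bool" where
  "faithful \<phi> \<longleftrightarrow> (\<forall>a. positive_el a \<and> \<phi> a = 0 \<longrightarrow> a = 0)"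

definition bdd_directed :: "'a::cstar_algebra set \<Rightarrow> bool" where
  "bdd_directed D \<longleftrightarrow> D \<noteq> {} \<and> (\<forall>x\<in>D. adj x = x) \<and> bounded D
     \<and> (\<forall>x\<in>D. \<forall>y\<in>D. \<exists>z\<in>D. le_el x z \<and> le_el y z)"

definition is_lub_el :: "'a::cstar_algebra set \<Rightarrow> 'a \<Rightarrow> bool" where
  "is_lub_el D a \<longleftrightarrow> adj a = a \<and> (\<forall>x\<in>D. le_el x a)
     \<and> (\<forall>c. adj c = c \<and> (\<forall>x\<in>D. le_el x c) \<longrightarrow> le_el a c)"

definition normal_state :: "('a::cstar_algebra \<Rightarrow> complex) \<Rightarrow> bool" where
  "normal_state \<phi> \<longleftrightarrow> state \<phi> \<and>
     (\<forall>D a. bdd_directed D \<and> is_lub_el D a \<longrightarrow> Re (\<phi> a) = (SUP x\<in>D. Re (\<phi> x)))"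

text \<open>Abstract (Kadison) characterisation of von Neumann (W*-) algebras:
monotone complete C*-algebra with a separating family of normal states.\<close>
definition von_neumann_algebra :: "'a::cstar_algebra itself \<Rightarrow> bool" where
  "von_neumann_algebra _ \<longleftrightarrow>
     (\<forall>D::'a set. bdd_directed D \<longrightarrow> (\<exists>a. is_lub_el D a))
     \<and> (\<forall>a::'a. positive_el a \<and> a \<noteq> 0 \<longrightarrow> (\<exists>\<psi>. normal_state \<psi> \<and> \<psi> a \<noteq> 0))"

definition cauchy_scalar :: "('a::cstar_algebra \<Rightarrow> complex) \<Rightarrow> 'a \<Rightarrow> complex \<Rightarrow> complex" where
  "cauchy_scalar \<phi> s z = \<phi> (inverse_el (cscale z 1 - s))"

definition distribution :: "('a::cstar_algebra \<Rightarrow> complex) \<Rightarrow> 'a \<Rightarrow> real measure" where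
  "distribution \<phi> s = (THE M. prob_space M \<and> sets M = sets borel
      \<and> (\<exists>C. emeasure M (- {-C..C}) = 0)
      \<and> (\<forall>n. complex_of_real (\<integral>x. x ^ n \<partial>M) = \<phi> (s ^ n)))"

definition cdf_of :: "real measure \<Rightarrow> real \<Rightarrow> real" where
  "cdf_of \<mu> t = measure \<mu> {..t}"

definition levy_dist :: "real measure \<Rightarrow> real measure \<Rightarrow> real" where
  "levy_dist \<mu> \<nu> = Inf {\<epsilon>. \<epsilon> > 0 \<and> (\<forall>t. cdf_of \<mu> (t - \<epsilon>) - \<epsilon> \<le> cdf_of \<nu> t
                                     \<and> cdf_of \<nu> t \<le> cdf_of \<mu> (t + \<epsilon>) + \<epsilon>)}"

end

theory Submission
  imports Defs "HOL-Real_Asymp.Real_Asymp"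
begin

text \<open>For a Bernoulli element \<open>s\<close> the relation \<open>E[s b s w] = \<eta>(b) E[w]\<close> extends by continuity from words
to the closed linear span of words in \<open>B\<close> and \<open>s\<close>. Since \<open>b - s\<close> has strictly positive imaginary
part, \<open>R = (b - s)\<^sup>-\<^sup>1\<close> is a Neumann series and lies in this span, and applying \<open>E\<close> to
\<open>R = b\<^sup>-\<^sup>1 + b\<^sup>-\<^sup>1 s b\<^sup>-\<^sup>1 + b\<^sup>-\<^sup>1 s b\<^sup>-\<^sup>1 s R\<close> gives \<open>(b - \<eta>(b\<^sup>-\<^sup>1)) E[R] = 1\<close>. With \<open>G\<^sub>i = E[(b - B\<^sub>i)\<^sup>-\<^sup>1]\<close>
this means \<open>G\<^sub>1 - G\<^sub>0 = G\<^sub>1 (\<eta>\<^sub>1 - \<eta>\<^sub>0)(b\<^sup>-\<^sup>1) G\<^sub>0\<close>, from which the first bound is read off.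
For \<open>b = z 1\<close> the Cauchy-Schwarz inequality for \<open>\<phi>\<close> bounds \<open>|\<phi>(G\<^sub>1 - G\<^sub>0)|\<close> by \<open>\<parallel>\<eta>\<^sub>1 - \<eta>\<^sub>0\<parallel> / (2 \<epsilon>)\<close> times the
sum of the two \<open>\<phi>((z - B\<^sub>i)\<^sup>-\<^sup>1\<^sup>* (z - B\<^sub>i)\<^sup>-\<^sup>1)\<close>, which are Poisson integrals of the distributions and
integrate to \<open>\<pi>/\<epsilon>\<close> each. Smoothing with the Poisson kernel moves a distribution function by at
most \<open>\<surd>(\<epsilon>/\<pi>)\<close> in the Levy distance, and optimising \<open>\<epsilon>\<close> gives the last bound.\<close>

section \<open>Inverses and spectra in C*-algebras\<close>

text \<open>The analysis rests on \<open>norm_in_spectrum_sa\<close>: a selfadjoint element attains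
  its norm, up to sign, in its spectrum. Order and norm inequalities can then be exchanged, and
  square roots of strictly positive elements replace a functional calculus, with an \<open>e\<close>
  sent to 0 where strictness fails.

  The Bernoulli relation peels letters off the left end of a word, so it yields an equation with
  \<open>E[R]\<close> as the right factor only. The formula for \<open>G1 - G0\<close> also needs
  one with \<open>G1\<close> on the left; it comes from the adjoint resolvent. In this way
  \<open>b - eta(b^-1)\<close> is never inverted. The three powers in the first bound are those of
  \<open>G1\<close>, \<open>b^-1\<close> and \<open>G0\<close>; the factor \<open>k\<close> arises
  because the norm of \<open>eta1 - eta0\<close> controls single entries, and a matrix with entries
  of norm at most \<open>c\<close> has norm at most \<open>k c\<close>.

  Both \<open>mat_norm\<close>, a spectral radius, and \<open>distribution\<close>, a definite
  description, are given indirectly. The former is identified with the norm of a concrete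
  C*-algebra. The latter requires exactly one compactly supported measure with given moments:
  existence by Bernstein weights, uniqueness by characteristic functions.\<close>

lemma cscale_one [simp]: "cscale 1 (x::'a::cstar_algebra) = x"
  using cscale_of_real[of 1 x] by simp

lemma cscale_zero_left [simp]: "cscale 0 (x::'a::cstar_algebra) = 0"
  using cscale_of_real[of 0 x] by simp

lemma cscale_zero_right [simp]: "cscale c (0::'a::cstar_algebra) = 0"
  using cscale_add_right[of c 0 0] by simp

lemma cscale_minus_left: "cscale (- c) (x::'a::cstar_algebra) = - cscale c x"
  using cscale_add_left[of c "-c" x] by (simp add: eq_neg_iff_add_eq_0 add.commute)

lemma cscale_minus_right: "cscale c (- x::'a::cstar_algebra) = - cscale c x"
  using cscale_add_right[of c x "-x"] by (simp add: eq_neg_iff_add_eq_0 add.commute)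

lemma cscale_diff_left: "cscale (a - b) (x::'a::cstar_algebra) = cscale a x - cscale b x"
  using cscale_add_left[of a "-b" x] by (simp add: cscale_minus_left)

lemma cscale_diff_right: "cscale a (x - y::'a::cstar_algebra) = cscale a x - cscale a y"
  using cscale_add_right[of a x "-y"] by (simp add: cscale_minus_right)

lemma cscale_of_real_one: "cscale (complex_of_real r) 1 = (of_real r :: 'a::cstar_algebra)"
  by (simp add: cscale_of_real scaleR_conv_of_real)

lemma cscale_sum_right: "cscale c (\<Sum>i\<in>I. f i) = (\<Sum>i\<in>I. cscale c (f i :: 'a::cstar_algebra))"
  by (induction I rule: infinite_finite_induct) (auto simp: cscale_add_right)

lemma cscale_1_mult: "cscale c 1 * x = cscale c (x::'a::cstar_algebra)"
  by (simp add: cscale_left_mult)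

lemma adj_eq_iff: "adj x = adj y \<longleftrightarrow> x = (y::'a::cstar_algebra)"
  by (metis adj_adj)

lemma adj_zero [simp]: "adj (0::'a::cstar_algebra) = 0"
  using adj_add[of 0 0] by simp

lemma adj_one [simp]: "adj (1::'a::cstar_algebra) = 1"
  using adj_mult[of "adj 1" 1] by (simp add: adj_adj)

lemma adj_minus: "adj (- x) = - adj (x::'a::cstar_algebra)"
  using adj_add[of x "-x"] by (simp add: eq_neg_iff_add_eq_0 add.commute)

lemma adj_diff: "adj (x - y) = adj x - adj (y::'a::cstar_algebra)"
  using adj_add[of x "-y"] by (simp add: adj_minus)

lemma adj_scaleR: "adj (r *\<^sub>R x) = r *\<^sub>R adj (x::'a::cstar_algebra)"
  by (simp flip: cscale_of_real add: adj_cscale)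

lemma adj_of_real [simp]: "adj (of_real r) = (of_real r :: 'a::cstar_algebra)"
  by (simp add: of_real_def adj_scaleR)

lemma adj_sum: "adj (\<Sum>i\<in>I. f i) = (\<Sum>i\<in>I. adj (f i :: 'a::cstar_algebra))"
  by (induction I rule: infinite_finite_induct) (auto simp: adj_add)

lemma adj_power: "adj (x ^ n) = adj (x::'a::cstar_algebra) ^ n"
  by (induction n) (auto simp: adj_mult power_commutes)

lemma norm_adj [simp]: "norm (adj x) = norm (x::'a::cstar_algebra)"
proof -
  have *: "norm x \<le> norm (adj x)" for x :: 'a
  proof (cases "x = 0")
    case False
    have "norm x * norm x \<le> norm (adj x) * norm x"
      using norm_mult_ineq[of "adj x" x] by (simp add: cstar_identity power2_eq_square)
    then show ?thesis using False by simp
  qed auto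
  show ?thesis using *[of x] *[of "adj x"] by (simp add: adj_adj)
qed

lemma bounded_linear_adj: "bounded_linear (adj :: 'a::cstar_algebra \<Rightarrow> 'a)"
  by (rule bounded_linear_intro[where K=1]) (auto simp: adj_add adj_scaleR)

lemma continuous_cscale_left: "continuous_on UNIV (\<lambda>c. cscale c (x::'a::cstar_algebra))"
proof -
  have "cscale (r *\<^sub>R c) x = r *\<^sub>R cscale c x" for r c
    using cscale_cscale[of "of_real r" c x] by (simp add: cscale_of_real scaleR_conv_of_real)
  then have "bounded_linear (\<lambda>c. cscale c x)"
    by (intro bounded_linear_intro[where K="norm x"]) (auto simp: cscale_add_left norm_cscale)
  then show ?thesis by (rule linear_continuous_on)
qed

lemma norm_sa_square: "adj a = a \<Longrightarrow> norm (a * a) = (norm (a::'a::cstar_algebra))\<^sup>2"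
  using cstar_identity[of a] by simp

text \<open>The C*-identity computes norms of squares, which is why the spectral radius argument
  runs along exponents \<open>2 ^ m\<close>.\<close>

lemma norm_sa_power2: "adj a = a \<Longrightarrow> norm (a ^ (2 ^ m)) = norm (a::'a::cstar_algebra) ^ (2 ^ m)"
proof (induction m)
  case (Suc m)
  have "a ^ 2 ^ Suc m = a ^ 2 ^ m * a ^ 2 ^ m" by (simp add: mult_2 power_add)
  moreover have "adj (a ^ 2 ^ m) = a ^ 2 ^ m" using Suc by (simp add: adj_power)
  ultimately show ?case using Suc
    by (simp add: norm_sa_square flip: power_mult) (simp add: mult.commute)
qed auto

section \<open>Inverses, the Neumann series and perturbation\<close>

lemma inverse_el_unique: "(a::'a::cstar_algebra) * y = 1 \<Longrightarrow> z * a = 1 \<Longrightarrow> y = z"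
  by (metis mult.assoc mult.left_neutral mult.right_neutral)

lemma inverse_elI:
  assumes "(a::'a::cstar_algebra) * y = 1" "y * a = 1"
  shows "invertible_el a" "inverse_el a = y"
proof -
  show "invertible_el a" using assms by (auto simp: invertible_el_def)
  show "inverse_el a = y" unfolding inverse_el_def
    using assms inverse_el_unique by (intro the_equality) blast+
qed

lemma inverse_el:
  assumes "invertible_el (a::'a::cstar_algebra)"
  shows "a * inverse_el a = 1" "inverse_el a * a = 1"
proof -
  obtain y where "a * y = 1" "y * a = 1" using assms by (auto simp: invertible_el_def)
  then show "a * inverse_el a = 1" "inverse_el a * a = 1" using inverse_elI(2)[of a y] by auto
qed

lemma invertible_lr: "(a::'a::cstar_algebra) * y = 1 \<Longrightarrow> z * a = 1 \<Longrightarrow> invertible_el a"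
  using inverse_el_unique by (auto simp: invertible_el_def)

lemma invertible_el_mult:
  assumes "invertible_el (a::'a::cstar_algebra)" "invertible_el b"
  shows "invertible_el (a * b)"
proof (rule invertible_lr)
  show "a * b * (inverse_el b * inverse_el a) = 1" "inverse_el b * inverse_el a * (a * b) = 1"
    using inverse_el[OF assms(1)] inverse_el[OF assms(2)] by (metis mult.assoc mult.right_neutral)+
qed

lemma invertible_el_cscale_iff:
  "c \<noteq> 0 \<Longrightarrow> invertible_el (cscale c (a::'a::cstar_algebra)) \<longleftrightarrow> invertible_el a"
proof -
  have *: "invertible_el a \<Longrightarrow> c \<noteq> 0 \<Longrightarrow> invertible_el (cscale c a)" for c and a :: 'a
    using inverse_el[of a]
    by (intro invertible_lr[of _ "cscale (1/c) (inverse_el a)" "cscale (1/c) (inverse_el a)"])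
       (auto simp: cscale_left_mult cscale_right_mult cscale_cscale)
  assume "c \<noteq> 0"
  then show ?thesis using *[of a c] *[of "cscale c a" "1/c"] by (auto simp: cscale_cscale)
qed

lemma invertible_el_minus_iff: "invertible_el (- a::'a::cstar_algebra) \<longleftrightarrow> invertible_el a"
  using invertible_el_cscale_iff[of "-1" a] by (simp add: cscale_minus_left)

lemma invertible_el_of_cscale_one: "c \<noteq> 0 \<Longrightarrow> invertible_el (cscale c (1::'a::cstar_algebra))"
  by (simp add: invertible_el_cscale_iff) (simp add: invertible_el_def)

lemma not_invertible_zero: "\<not> invertible_el (0::'a::cstar_algebra)"
  by (simp add: invertible_el_def)

lemma inverse_el_adj:
  assumes a: "invertible_el (a::'a::cstar_algebra)"
  shows "inverse_el (adj a) = adj (inverse_el a)"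
  by (rule inverse_elI(2)) (use inverse_el[OF a] in \<open>simp_all flip: adj_mult\<close>)

lemma inverse_el_commute:
  assumes "invertible_el (a::'a::cstar_algebra)" "a * b = b * a"
  shows "inverse_el a * b = b * inverse_el a"
proof -
  have "inverse_el a * b = inverse_el a * (b * a) * inverse_el a"
    using inverse_el[OF assms(1)] by (simp add: mult.assoc)
  also have "\<dots> = inverse_el a * a * b * inverse_el a" using assms(2) by (simp add: mult.assoc)
  finally show ?thesis using inverse_el[OF assms(1)] by simp
qed

lemma neumann_series:
  fixes a :: "'a::cstar_algebra"
  assumes "norm (1 - a) < 1"
  shows "invertible_el a" "norm (inverse_el a) \<le> 1 / (1 - norm (1 - a))"
    and "(\<lambda>n. (1 - a) ^ n) sums inverse_el a"
proof -
  define x where "x = 1 - a"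
  have s: "summable (\<lambda>n. x ^ n)" using assms unfolding x_def
    by (rule complete_algebra_summable_geometric)
  define y where "y = (\<Sum>n. x ^ n)"
  have sy: "(\<lambda>n. x ^ n) sums y" using s unfolding y_def by (rule summable_sums)
  have s1: "(\<lambda>n. x ^ Suc n) sums (y - 1)" using sy by (subst sums_Suc_iff) simp
  have "(\<lambda>n. x * x ^ n) sums (x * y)" by (rule sums_mult[OF sy])
  with s1 have e1: "x * y = y - 1" by (simp add: sums_unique2)
  have "(\<lambda>n. x ^ n * x) sums (y * x)" by (rule sums_mult2[OF sy])
  with s1 have e2: "y * x = y - 1" by (simp add: sums_unique2 power_Suc2 del: power_Suc)
  have ax: "a = 1 - x" by (simp add: x_def)
  have "a * y = 1" "y * a = 1" using e1 e2 by (simp_all add: ax algebra_simps)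
  note iy = inverse_elI[OF this]
  show "invertible_el a" by (rule iy)
  show "(\<lambda>n. (1 - a) ^ n) sums inverse_el a" using sy iy(2) by (simp add: x_def)
  \<comment> \<open>Solving this relation for \<open>norm y\<close> yields the geometric bound
    without summing norms.\<close>
  have "y = 1 + x * y" using e1 by simp
  then have "norm y \<le> 1 + norm x * norm y"
    by (metis norm_triangle_ineq norm_mult_ineq norm_one add_left_mono order_trans)
  then show "norm (inverse_el a) \<le> 1 / (1 - norm (1 - a))"
    using assms by (simp add: iy(2) x_def[symmetric] field_simps)
qed

text \<open>Each power of \<open>1 - a\<close> arises from the previous one by subtracting its
  \<open>a\<close>-multiple, so stability of \<open>V\<close> under left multiplication by
  \<open>a\<close> keeps the partial sums in \<open>V\<close>. This will place resolvents in the
  closed span of words.\<close>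

lemma inverse_el_in_closed_subspace:
  fixes a :: "'a::cstar_algebra"
  assumes "norm (1 - a) < 1" "subspace V" "closed V" "1 \<in> V" "\<And>v. v \<in> V \<Longrightarrow> a * v \<in> V"
  shows "inverse_el a \<in> V"
proof -
  have p: "(1 - a) ^ n \<in> V" for n
    by (induction n) (use assms in \<open>auto simp: left_diff_distrib intro: subspace_diff\<close>)
  have lim: "(\<lambda>n. \<Sum>i<n. (1 - a) ^ i) \<longlonglongrightarrow> inverse_el a"
    using neumann_series(3)[OF assms(1)] by (simp add: sums_def)
  have "(\<Sum>i<n. (1 - a) ^ i) \<in> V" for n
    using p assms(2) by (intro subspace_sum) auto
  then show ?thesis using closed_sequentially[OF assms(3) _ lim] by simp
qed

text \<open>The element \<open>c = inverse_el a * b\<close> has distance less than 1 from the unit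
  and \<open>b = a * c\<close>; the Neumann bound for \<open>c\<close> becomes the bound for
  \<open>b\<close>.\<close>

lemma invertible_el_perturb:
  fixes a b :: "'a::cstar_algebra"
  assumes a: "invertible_el a" and ab: "norm (b - a) * norm (inverse_el a) < 1"
  shows "invertible_el b"
    and "norm (inverse_el b) \<le> norm (inverse_el a) / (1 - norm (b - a) * norm (inverse_el a))"
proof -
  define c where "c = inverse_el a * b"
  have "1 - c = inverse_el a * (a - b)" using inverse_el[OF a] by (simp add: c_def right_diff_distrib)
  then have c1: "norm (1 - c) \<le> norm (b - a) * norm (inverse_el a)"
    by (metis norm_mult_ineq mult.commute norm_minus_commute)
  with ab have "norm (1 - c) < 1" by simp
  note n = neumann_series[OF this]
  have bc: "b = a * c" using inverse_el[OF a] by (simp add: c_def flip: mult.assoc)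
  then show ib: "invertible_el b" using invertible_el_mult a n by blast
  have "b * (inverse_el c * inverse_el a) = 1" unfolding bc
    using inverse_el[OF a] inverse_el[OF n(1)] by (metis mult.assoc mult.right_neutral)
  then have "inverse_el b = inverse_el c * inverse_el a"
    using inverse_el_unique inverse_el(2)[OF ib] by metis
  then have "norm (inverse_el b) \<le> norm (inverse_el c) * norm (inverse_el a)"
    by (simp add: norm_mult_ineq)
  also have "norm (inverse_el c) \<le> 1 / (1 - norm (b - a) * norm (inverse_el a))"
    using n(2) c1 ab by (smt (verit) frac_le)
  finally show "norm (inverse_el b) \<le> norm (inverse_el a) / (1 - norm (b - a) * norm (inverse_el a))"
    by (simp add: mult_right_mono)
qed

lemma inverse_el_diff:
  assumes "invertible_el (a::'a::cstar_algebra)" "invertible_el b"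
  shows "inverse_el b - inverse_el a = inverse_el b * (a - b) * inverse_el a"
  using inverse_el[OF assms(1)] inverse_el[OF assms(2)]
  by (simp add: left_diff_distrib right_diff_distrib mult.assoc)

lemma isCont_inverse_el:
  assumes a: "invertible_el (a::'a::cstar_algebra)"
  shows "isCont inverse_el a"
proof -
  define K where "K = norm (inverse_el a)"
  have K: "K > 0" using inverse_el[OF a] by (auto simp: K_def)
  have ev: "\<forall>\<^sub>F b in at a. norm (inverse_el b - inverse_el a) \<le> 2 * K * K * norm (b - a)"
    unfolding eventually_at
  \<comment> \<open>Within this radius the inverses stay below \<open>2 * K\<close>, so the
    resolvent identity gives a Lipschitz estimate.\<close>
  proof (intro exI[of _ "1/(2*K)"] conjI ballI impI)
    show "0 < 1 / (2*K)" using K by simp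
    fix b assume "b \<noteq> a \<and> dist b a < 1 / (2 * K)"
    then have d: "norm (b - a) * K < 1/2" using K by (simp add: dist_norm field_simps)
    note p = invertible_el_perturb[OF a, of b]
    have ib: "invertible_el b" using p d by (simp add: K_def)
    have "norm (inverse_el b) \<le> K / (1 - norm (b - a) * K)" using p d by (simp add: K_def)
    also have "\<dots> \<le> K / (1/2)" using d K by (intro divide_left_mono) auto
    finally have nb: "norm (inverse_el b) \<le> 2 * K" by simp
    have "norm (inverse_el b - inverse_el a) \<le> norm (inverse_el b) * norm (a - b) * K"
      unfolding inverse_el_diff[OF a ib] K_def
      by (meson norm_mult_ineq mult_right_mono norm_ge_zero order_trans)
    also have "\<dots> \<le> 2 * K * norm (a - b) * K" using nb K by (intro mult_right_mono) auto
    finally show "norm (inverse_el b - inverse_el a) \<le> 2 * K * K * norm (b - a)"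
      by (simp add: norm_minus_commute mult_ac)
  qed
  have "((\<lambda>b. 2 * K * K * norm (b - a)) \<longlongrightarrow> 2 * K * K * norm (a - a)) (at a)"
    by (intro tendsto_intros)
  then have "((\<lambda>b. inverse_el b - inverse_el a) \<longlongrightarrow> 0) (at a)"
    by (intro Lim_null_comparison[OF ev]) simp
  then show ?thesis unfolding isCont_def by (simp add: LIM_zero_iff)
qed

lemma open_invertible: "open {a::'a::cstar_algebra. invertible_el a}"
  unfolding open_dist
proof (intro ballI)
  fix a :: 'a assume "a \<in> {a. invertible_el a}"
  then have a: "invertible_el a" by simp
  have K: "norm (inverse_el a) > 0" using inverse_el[OF a] by auto
  show "\<exists>e>0. \<forall>y. dist y a < e \<longrightarrow> y \<in> {a. invertible_el a}"
  proof (intro exI[of _ "1 / norm (inverse_el a)"] conjI allI impI)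
    show "0 < 1 / norm (inverse_el a)" using K by simp
    fix y assume "dist y a < 1 / norm (inverse_el a)"
    then have "norm (y - a) * norm (inverse_el a) < 1" using K by (simp add: dist_norm field_simps)
    then show "y \<in> {a. invertible_el a}" using invertible_el_perturb[OF a] by simp
  qed
qed

section \<open>The spectrum, and the norm of a selfadjoint element\<close>

lemma spectrum_el_norm: "c \<in> spectrum_el (a::'a::cstar_algebra) \<Longrightarrow> cmod c \<le> norm a"
proof (rule ccontr)
  assume c: "c \<in> spectrum_el a" "\<not> cmod c \<le> norm a"
  then have c0: "c \<noteq> 0" by auto
  have "norm (1 - (1 - cscale (1/c) a)) < 1" using c c0 by (simp add: norm_cscale norm_divide field_simps)
  then have "invertible_el (1 - cscale (1/c) a)" by (rule neumann_series)
  then have "invertible_el (cscale (-c) (1 - cscale (1/c) a))" using c0 by (simp add: invertible_el_cscale_iff)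
  also have "cscale (-c) (1 - cscale (1/c) a) = a - cscale c 1"
    using c0 by (simp add: cscale_diff_right cscale_cscale cscale_minus_left)
  finally show False using c by (simp add: spectrum_el_def)
qed

lemma spectrum_el_shift:
  "c \<in> spectrum_el (a + cscale d 1) \<longleftrightarrow> c - d \<in> spectrum_el (a::'a::cstar_algebra)"
  by (simp add: spectrum_el_def cscale_diff_left algebra_simps)

lemma spectrum_el_cscale:
  "d \<noteq> 0 \<Longrightarrow> c \<in> spectrum_el (cscale d (a::'a::cstar_algebra)) \<longleftrightarrow> c / d \<in> spectrum_el a"
  using invertible_el_cscale_iff[of d "a - cscale (c/d) 1"]
  by (simp add: spectrum_el_def cscale_diff_right cscale_cscale)

lemma zero_in_spectrum_iff: "0 \<in> spectrum_el a \<longleftrightarrow> \<not> invertible_el (a::'a::cstar_algebra)"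
  by (simp add: spectrum_el_def)

text \<open>Adding \<open>i t\<close> moves a spectral value by \<open>t\<close> in the imaginary
  direction, so its squared modulus grows by \<open>2 beta t + t^2\<close>, whereas the C*-identity
  lets the squared norm grow by at most \<open>t^2\<close>. A term linear in \<open>t\<close> cannot
  stay bounded.\<close>

lemma spectrum_sa_real:
  assumes sa: "adj a = (a::'a::cstar_algebra)" and c: "c \<in> spectrum_el a"
  shows "Im c = 0"
proof (rule ccontr)
  assume b: "Im c \<noteq> 0"
  define \<beta> where "\<beta> = Im c"
  have "\<beta>\<^sup>2 + 2 * \<beta> * t \<le> (norm a)\<^sup>2" for t :: real
  proof -
    define y where "y = a + cscale (\<i> * t) 1"
    have "c + \<i> * t \<in> spectrum_el y" using c by (simp add: y_def spectrum_el_shift)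
    then have "(cmod (c + \<i> * t))\<^sup>2 \<le> (norm y)\<^sup>2" using spectrum_el_norm power_mono by (metis norm_ge_zero)
    also have "(norm y)\<^sup>2 = norm (adj y * y)" by (simp add: cstar_identity)
    also have "adj y * y = a * a + cscale (of_real (t\<^sup>2)) 1"
      by (simp add: y_def adj_add adj_cscale sa algebra_simps cscale_left_mult cscale_right_mult
            cscale_add_right cscale_diff_right cscale_cscale cscale_minus_left power2_eq_square)
    also have "norm (a * a + cscale (of_real (t\<^sup>2)) 1) \<le> (norm a)\<^sup>2 + t\<^sup>2"
      using norm_triangle_ineq[of "a*a" "cscale (of_real (t\<^sup>2)) 1"]
      by (simp add: norm_sa_square[OF sa] norm_cscale norm_power del: of_real_power)
    finally have "(Re c)\<^sup>2 + (\<beta> + t)\<^sup>2 \<le> (norm a)\<^sup>2 + t\<^sup>2" by (simp add: cmod_power2 \<beta>_def)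
    then have "(\<beta> + t)\<^sup>2 \<le> (norm a)\<^sup>2 + t\<^sup>2" using zero_le_power2[of "Re c"] by linarith
    then show ?thesis by (simp add: power2_sum)
  qed
  \<comment> \<open>This \<open>t\<close> makes \<open>2 * beta * t\<close> equal to the squared
    norm of \<open>a\<close>.\<close>
  from this[of "(norm a)\<^sup>2 / (2 * \<beta>)"] b have "\<beta>\<^sup>2 \<le> 0" by (simp add: \<beta>_def)
  then show False using b by (simp add: \<beta>_def)
qed

text \<open>Rickart's elementary argument: averaging the resolvent over roots of unity replaces
the analyticity of the resolvent in the spectral radius formula.\<close>

lemma resolvent_doubling:
  fixes x :: "'a::cstar_algebra"
  assumes "invertible_el (1 - x)" "invertible_el (1 + x)"
  shows "invertible_el (1 - x * x)"
    and "inverse_el (1 - x * x) = (1/2) *\<^sub>R (inverse_el (1 - x) + inverse_el (1 + x))"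
proof -
  let ?p = "inverse_el (1 - x)" and ?q = "inverse_el (1 + x)"
  note p = inverse_el[OF assms(1)] and q = inverse_el[OF assms(2)]
  have f1: "1 - x * x = (1 + x) * (1 - x)" and f2: "1 - x * x = (1 - x) * (1 + x)"
    by (simp_all add: algebra_simps)
  have "(1 - x * x) * (?p + ?q) = (1 + x) * ((1 - x) * ?p) + (1 - x) * ((1 + x) * ?q)"
    using f1 f2 by (metis distrib_left mult.assoc)
  also have "\<dots> = 2" using p q by simp
  finally have 1: "(1 - x * x) * ((1/2) *\<^sub>R (?p + ?q)) = 1"
    by (metis mult_scaleR_right mult_scaleR_left scaleR_half_double one_add_one)
  have "(?p + ?q) * (1 - x * x) = (?p * (1 - x)) * (1 + x) + (?q * (1 + x)) * (1 - x)"
    using f1 f2 by (metis distrib_right mult.assoc)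
  also have "\<dots> = 2" using p q by simp
  finally have 2: "((1/2) *\<^sub>R (?p + ?q)) * (1 - x * x) = 1"
    by (metis mult_scaleR_right mult_scaleR_left scaleR_half_double one_add_one)
  show "invertible_el (1 - x * x)" "inverse_el (1 - x * x) = (1/2) *\<^sub>R (?p + ?q)"
    using inverse_elI[OF 1 2] by auto
qed

text \<open>Suppose that neither sign occurs for the normalised \<open>h\<close>. Then
  \<open>1 - w h\<close> is invertible on a disc of radius \<open>r > 1\<close>. By averaging, the
  inverses of \<open>1 - (w h)^(2^m)\<close> at radii \<open>rho < 1 < mu\<close> stay as close as
  the original resolvents, uniformly in \<open>m\<close>. At \<open>rho\<close> they tend to 1, but
  \<open>norm ((mu h)^(2^m)) = mu^(2^m)\<close> is unbounded.\<close>

lemma norm_in_spectrum_sa: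
  assumes sa: "adj a = (a::'a::cstar_algebra)"
  shows "complex_of_real (norm a) \<in> spectrum_el a \<or> complex_of_real (- norm a) \<in> spectrum_el a"
proof (cases "a = 0")
  case True
  then show ?thesis by (simp add: spectrum_el_def not_invertible_zero)
next
  case False
  define h where "h = (1 / norm a) *\<^sub>R a"
  have h: "norm h = 1" "adj h = h" using False sa by (auto simp: h_def adj_scaleR)
  have ah: "a = cscale (of_real (norm a)) h" using False by (simp add: h_def cscale_of_real)
  have sp: "complex_of_real (norm a * s) \<in> spectrum_el a \<longleftrightarrow> complex_of_real s \<in> spectrum_el h" for s
    using False by (subst (2) ah, subst spectrum_el_cscale) auto
  show ?thesis
  proof (rule ccontr)
    assume "\<not> ?thesis"
    then have n1: "1 \<notin> spectrum_el h" "-1 \<notin> spectrum_el h" using sp[of 1] sp[of "-1"] by auto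
    define g where "g w = 1 - cscale w h" for w
    have contg: "continuous_on S g" for S unfolding g_def
      by (intro continuous_intros continuous_on_subset[OF continuous_cscale_left]) auto
    define U where "U = {w. invertible_el (g w)}"
    have "U = g -` {a. invertible_el a}" by (auto simp: U_def)
    then have openU: "open U"
      using open_vimage[OF open_invertible contg] by simp
    have spU: "w \<in> U" if "w = 0 \<or> 1/w \<notin> spectrum_el h" for w
    proof (cases "w = 0")
      case True then show ?thesis by (simp add: U_def g_def) (simp add: invertible_el_def)
    next
      case False
      then have "invertible_el (cscale (-w) (h - cscale (1/w) 1))"
        using that by (simp add: spectrum_el_def invertible_el_cscale_iff)
      also have "cscale (-w) (h - cscale (1/w) 1) = g w"
        using False by (simp add: g_def cscale_diff_right cscale_cscale cscale_minus_left)
      finally show ?thesis by (simp add: U_def)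
    qed
    have "cball 0 1 \<subseteq> U"
    proof
      fix w :: complex assume "w \<in> cball 0 1"
      then have w: "cmod w \<le> 1" by simp
      show "w \<in> U"
      proof (rule spU, rule ccontr)
        assume c: "\<not> (w = 0 \<or> 1/w \<notin> spectrum_el h)"
        then have "cmod (1/w) \<le> 1" using spectrum_el_norm h(1) by metis
        then have cw: "cmod w = 1" using c w by (simp add: norm_divide field_simps)
        \<comment> \<open>The spectrum of \<open>h\<close> is real, so on the unit circle only the
          two excluded points 1 and -1 remain.\<close>
        have "Im (1/w) = 0" using c h(2) spectrum_sa_real by blast
        then have "Im w = 0" using c by (auto simp: Im_divide sum_power2_eq_zero_iff)
        with cw have "w = 1 \<or> w = -1"
          by (simp add: complex_eq_iff cmod_def abs_if split: if_splits) 
        then show False using c n1 by auto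
      qed
    qed
    \<comment> \<open>Compactness of the closed disc turns openness of \<open>U\<close> into a
      margin \<open>e\<close> beyond radius 1.\<close>
    then obtain e where e: "e > 0" "(\<Union>x\<in>cball 0 1. cball x e) \<subseteq> U"
      using compact_subset_open_imp_cball_epsilon_subset[of "cball (0::complex) 1" U] openU by auto
    define r where "r = 1 + e"
    have rU: "cball 0 r \<subseteq> U"
    proof
      fix w :: complex assume w: "w \<in> cball 0 r"
      show "w \<in> U"
      proof (cases "cmod w \<le> 1")
        case True then show ?thesis using \<open>cball 0 1 \<subseteq> U\<close> by auto
      next
        case False
        define u where "u = w / of_real (cmod w)"
        have "cmod u = 1" using False by (auto simp: u_def norm_divide)
        moreover have "dist u w \<le> e"
        proof -
          have "w \<noteq> 0" using False by auto
          then have "w - u = of_real (cmod w - 1) * u" by (simp add: u_def field_simps)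
          then have "cmod (w - u) = cmod w - 1" using False \<open>cmod u = 1\<close> by (simp add: norm_mult del: of_real_diff)
          then show ?thesis using w by (simp add: dist_norm norm_minus_commute r_def)
        qed
        ultimately show ?thesis using e(2) by fastforce
      qed
    qed
    have contR: "continuous_on (cball 0 r) (\<lambda>w. inverse_el (g w))"
      unfolding continuous_on_eq_continuous_within
    proof
      fix w :: complex assume "w \<in> cball 0 r"
      then have "invertible_el (g w)" using rU by (auto simp: U_def)
      then have "isCont inverse_el (g w)" by (rule isCont_inverse_el)
      moreover have "continuous (at w within cball 0 r) g"
        using contg[of UNIV] by (simp add: continuous_on_eq_continuous_within continuous_at_imp_continuous_at_within)
      ultimately show "continuous (at w within cball 0 r) (\<lambda>w. inverse_el (g w))"
        using continuous_within_compose3 by blast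
    qed
    have "uniformly_continuous_on (cball 0 r) (\<lambda>w. inverse_el (g w))"
      using compact_uniformly_continuous[OF contR] by simp
    then obtain d where d: "d > 0"
      "\<And>w w'. w \<in> cball 0 r \<Longrightarrow> w' \<in> cball 0 r \<Longrightarrow> dist w' w < d \<Longrightarrow> dist (inverse_el (g w')) (inverse_el (g w)) < 1/3"
      unfolding uniformly_continuous_on_def by (metis zero_less_divide_1_iff zero_less_numeral)
    \<comment> \<open>The radii \<open>1 - t\<close> and \<open>1 + t\<close> are positive, do not
      exceed \<open>1 + e\<close>, and differ by less than the modulus \<open>d\<close> of uniform
      continuity.\<close>
    define t where "t = min (min (d/3) e) (1/2)"
    have t: "t > 0" "t < 1" "2 * t < d" "t \<le> e" using d(1) e(1) by (auto simp: t_def)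
    define \<rho> where "\<rho> = 1 - t"
    define \<mu> where "\<mu> = 1 + t"
    have \<rho>: "0 < \<rho>" "\<rho> < 1" and \<mu>: "1 < \<mu>" "\<mu> \<le> r" "\<mu> - \<rho> < d"
      using t by (auto simp: \<rho>_def \<mu>_def r_def)
    define G where "G m w = 1 - cscale w h ^ (2 ^ m)" for m w
    have dbl: "G (Suc m) w = 1 - cscale w h ^ (2 ^ m) * cscale w h ^ (2 ^ m)" for m w
      by (simp add: G_def mult_2 power_add)
    have cpow: "cscale w h ^ n = cscale (w ^ n) (h ^ n)" for w n
      by (induction n) (auto simp: cscale_left_mult cscale_right_mult cscale_cscale mult_ac)
    \<comment> \<open>Multiplying \<open>w\<close> by such a root changes the sign of
      \<open>(w h)^(2^m)\<close>, so the factor \<open>1 + x\<close> of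
      \<open>resolvent_doubling\<close> is again a value of \<open>G m\<close>.\<close>
    have "\<exists>z. cmod z = 1 \<and> z ^ (2 ^ m) = -1" for m
    proof -
      have "cis (pi / 2 ^ m) ^ (2 ^ m) = cis pi" by (simp add: Complex.DeMoivre)
      then show ?thesis by (intro exI[of _ "cis (pi / 2 ^ m)"]) simp
    qed
    then obtain \<omega> where \<omega>: "\<And>m. cmod (\<omega> m) = 1" "\<And>m. \<omega> m ^ (2 ^ m) = -1" by metis
    have Gplus: "1 + cscale w h ^ (2 ^ m) = G m (\<omega> m * w)" for m w
      using \<omega>(2)[of m] by (simp add: G_def cpow power_mult_distrib cscale_minus_left)
    have inv: "invertible_el (G m w)" if "cmod w \<le> r" for m w
      using that
    proof (induction m arbitrary: w)
      case 0
      then have "w \<in> U" using rU by auto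
      then show ?case by (simp add: G_def U_def g_def)
    next
      case (Suc m)
      have "invertible_el (1 - cscale w h ^ (2 ^ m))" using Suc.IH[OF Suc.prems] by (simp add: G_def)
      moreover have "invertible_el (1 + cscale w h ^ (2 ^ m))"
        unfolding Gplus using Suc.prems \<omega> by (intro Suc.IH) (simp add: norm_mult)
      ultimately show ?case unfolding dbl by (rule resolvent_doubling(1))
    qed
    have dblinv: "inverse_el (G (Suc m) w) = (1/2) *\<^sub>R (inverse_el (G m w) + inverse_el (G m (\<omega> m * w)))"
      if "cmod w \<le> r" for m w
    proof -
      have "invertible_el (1 - cscale w h ^ (2 ^ m))" using inv[OF that, of m] by (simp add: G_def)
      moreover have "invertible_el (1 + cscale w h ^ (2 ^ m))"
        unfolding Gplus using that \<omega> by (intro inv) (simp add: norm_mult)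
      ultimately show ?thesis unfolding dbl by (subst resolvent_doubling(2)) (simp_all only: Gplus, simp only: G_def)
    qed
    \<comment> \<open>Each doubling replaces a difference by the mean of two earlier ones, so the
      bound 1/3 survives for all \<open>m\<close>.\<close>
    have close: "norm (inverse_el (G m (of_real \<mu> * w)) - inverse_el (G m (of_real \<rho> * w))) \<le> 1/3"
      if "cmod w = 1" for m w
      using that
    proof (induction m arbitrary: w)
      case 0
      have "of_real \<mu> * w - of_real \<rho> * w = of_real (\<mu> - \<rho>) * w" by (simp add: algebra_simps)
      then have "dist (of_real \<mu> * w) (of_real \<rho> * w) < d"
        using \<mu> \<rho> 0 by (simp add: dist_norm norm_mult del: of_real_diff)
      moreover have "of_real \<mu> * w \<in> cball 0 r" "of_real \<rho> * w \<in> cball 0 r"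
        using \<mu> \<rho> 0 by (auto simp: norm_mult)
      ultimately have "dist (inverse_el (g (of_real \<mu> * w))) (inverse_el (g (of_real \<rho> * w))) < 1/3"
        using d(2) by blast
      then show ?case by (simp add: G_def g_def dist_norm)
    next
      case (Suc m)
      let ?D = "\<lambda>w. inverse_el (G m (of_real \<mu> * w)) - inverse_el (G m (of_real \<rho> * w))"
      have m: "cmod (of_real \<mu> * w) \<le> r" "cmod (of_real \<rho> * w) \<le> r"
        using \<mu> \<rho> Suc.prems by (auto simp: norm_mult)
      have "inverse_el (G (Suc m) (of_real \<mu> * w)) - inverse_el (G (Suc m) (of_real \<rho> * w))
            = (1/2) *\<^sub>R (?D w + ?D (\<omega> m * w))"
        unfolding dblinv[OF m(1)] dblinv[OF m(2)]
        by (simp add: scaleR_diff_right scaleR_add_right mult.left_commute)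
      also have "norm \<dots> \<le> (1/2) * (norm (?D w) + norm (?D (\<omega> m * w)))"
        using norm_triangle_ineq[of "?D w" "?D (\<omega> m * w)"] by simp
      also have "norm (?D w) \<le> 1/3" using Suc by blast
      also have "norm (?D (\<omega> m * w)) \<le> 1/3" using Suc \<omega> by (intro Suc.IH) (simp add: norm_mult)
      finally show ?case by simp
    qed
    have normpow: "norm (cscale (complex_of_real s) h ^ (2 ^ m)) = s ^ (2 ^ m)" if "s \<ge> 0" for s m
      using that by (simp add: cpow norm_cscale norm_sa_power2 h norm_power)
    have "strict_mono (\<lambda>m. (2::nat) ^ m)" by (rule strict_monoI) simp
    from LIMSEQ_subseq_LIMSEQ[OF LIMSEQ_realpow_zero this, of \<rho>] \<rho>
    have lim2: "(\<lambda>m. \<rho> ^ (2 ^ m)) \<longlonglongrightarrow> 0" by (simp add: o_def)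
    \<comment> \<open>The constants fit together as follows: with 1/10 the inverse at
      \<open>rho\<close> is within 1/9 of 1, the one at \<open>mu\<close> therefore within 1/9 + 1/3
      < 1/2, so \<open>G m mu\<close> has norm at most 2 and \<open>mu ^ (2 ^ m)\<close> would be at
      most 3.\<close>
    obtain M where "\<mu> ^ M > 3" using \<mu>(1) real_arch_pow by blast
    moreover have "\<forall>\<^sub>F m in sequentially. \<rho> ^ (2 ^ m) < 1/10"
      using lim2 by (rule order_tendstoD) simp
    ultimately obtain m where m: "m \<ge> M" "\<rho> ^ (2 ^ m) < 1/10"
      by (metis (mono_tags, lifting) eventually_sequentially nle_le)
    have "M \<le> 2 ^ m" using m(1) less_exp[of m] by linarith
    then have "\<mu> ^ M \<le> \<mu> ^ (2 ^ m)" using \<mu> by (intro power_increasing) auto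
    with \<open>\<mu> ^ M > 3\<close> have big: "\<mu> ^ (2 ^ m) > 3" by linarith
    let ?R = "inverse_el (G m (of_real \<rho>))" and ?S = "inverse_el (G m (of_real \<mu>))"
    have iR: "invertible_el (G m (of_real \<rho>))" and iS: "invertible_el (G m (of_real \<mu>))"
      using \<rho> \<mu> by (auto intro!: inv)
    have nR: "norm (1 - G m (of_real \<rho>)) < 1/10" using m(2) \<rho> by (simp add: G_def normpow)
    then have "norm ?R \<le> 1 / (1 - norm (1 - G m (of_real \<rho>)))"
      by (intro neumann_series) simp
    also have "\<dots> \<le> 1 / (1 - 1/10)" using nR by (intro divide_left_mono) auto
    finally have nR2: "norm ?R \<le> 10/9" by simp
    have "1 - ?R = - ((1 - G m (of_real \<rho>)) * ?R)"
      using inverse_el[OF iR] by (simp add: algebra_simps)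
    then have "norm (1 - ?R) \<le> norm (1 - G m (of_real \<rho>)) * norm ?R"
      by (metis norm_minus_cancel norm_mult_ineq)
    also have "\<dots> \<le> (1/10) * (10/9)" using nR nR2 by (intro mult_mono) auto
    finally have "norm (1 - ?R) \<le> 1/9" by simp
    moreover have "norm (?S - ?R) \<le> 1/3" using close[of 1 m] by simp
    ultimately have nS: "norm (1 - ?S) < 1/2"
      using norm_triangle_ineq4[of "1 - ?R" "?S - ?R"] by simp
    have "inverse_el ?S = G m (of_real \<mu>)" using inverse_el[OF iS] by (intro inverse_elI)
    then have "norm (G m (of_real \<mu>)) \<le> 1 / (1 - norm (1 - ?S))"
      using neumann_series(2)[of ?S] nS by simp
    also have "\<dots> \<le> 1 / (1 - 1/2)" using nS by (intro divide_left_mono) auto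
    finally have "norm (G m (of_real \<mu>)) \<le> 2" by simp
    moreover have "\<mu> ^ (2 ^ m) = norm (1 - G m (of_real \<mu>))" using \<mu> by (simp add: G_def normpow)
    moreover have "norm (1 - G m (of_real \<mu>)) \<le> 1 + norm (G m (of_real \<mu>))"
      using norm_triangle_ineq4[of 1 "G m (of_real \<mu>)"] by simp
    ultimately show False using big by linarith
  qed
qed

section \<open>Positive elements\<close>

lemma positive_el_sa: "positive_el a \<Longrightarrow> adj a = a"
  by (simp add: positive_el_def)

lemma positive_elI:
  assumes "adj a = (a::'a::cstar_algebra)" "\<And>r. complex_of_real r \<in> spectrum_el a \<Longrightarrow> r \<ge> 0"
  shows "positive_el a"
  unfolding positive_el_def
proof (intro conjI subsetI assms)
  fix c assume c: "c \<in> spectrum_el a"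
  then have "c = of_real (Re c)" using spectrum_sa_real[OF assms(1)] by (simp add: complex_eq_iff)
  then show "c \<in> complex_of_real ` {0..}" using assms(2) c by (metis atLeast_iff imageI)
qed

lemma positive_elD: "positive_el a \<Longrightarrow> complex_of_real r \<in> spectrum_el a \<Longrightarrow> r \<ge> 0"
  by (force simp: positive_el_def)

lemma spectrum_el_of_real_diff:
  "complex_of_real r \<in> spectrum_el (of_real t - a) \<longleftrightarrow> complex_of_real (t - r) \<in> spectrum_el (a::'a::cstar_algebra)"
proof -
  have "of_real t - a - cscale (of_real r) 1 = - (a - cscale (of_real (t - r)) 1)"
    by (simp add: cscale_diff_left cscale_of_real_one)
  then show ?thesis by (simp only: spectrum_el_def mem_Collect_eq invertible_el_minus_iff)
qed

lemma spectrum_el_add_of_real: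
  "complex_of_real r \<in> spectrum_el (a + of_real t) \<longleftrightarrow> complex_of_real (r - t) \<in> spectrum_el (a::'a::cstar_algebra)"
  using spectrum_el_shift[of "of_real r" a "of_real t"] by (simp add: cscale_of_real_one)

text \<open>The norm of \<open>t - a\<close> is attained, up to sign, on its spectrum, so the norm
  condition excludes negative spectral values of \<open>a\<close>. In this form positivity is stable
  under sums by the triangle inequality.\<close>

lemma positive_el_iff_norm:
  assumes sa: "adj a = (a::'a::cstar_algebra)" and t: "norm a \<le> t"
  shows "positive_el a \<longleftrightarrow> norm (of_real t - a) \<le> t"
proof
  assume p: "positive_el a"
  have "adj (of_real t - a) = of_real t - a" by (simp add: adj_diff sa)
  from norm_in_spectrum_sa[OF this]
  show "norm (of_real t - a) \<le> t"
  proof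
    assume "complex_of_real (norm (of_real t - a)) \<in> spectrum_el (of_real t - a)"
    then show ?thesis using positive_elD[OF p] by (force simp: spectrum_el_of_real_diff simp del: of_real_diff)
  next
    assume "complex_of_real (- norm (of_real t - a)) \<in> spectrum_el (of_real t - a)"
    then have "complex_of_real (t + norm (of_real t - a)) \<in> spectrum_el a"
      by (simp only: spectrum_el_of_real_diff diff_minus_eq_add)
    then have "cmod (complex_of_real (t + norm (of_real t - a))) \<le> norm a" by (rule spectrum_el_norm)
    then have "t + norm (of_real t - a) \<le> t" using t by (simp only: norm_of_real)
    then show ?thesis using t by (smt (verit) norm_ge_zero)
  qed
next
  assume n: "norm (of_real t - a) \<le> t"
  show "positive_el a"
  proof (rule positive_elI[OF sa])
    fix r assume "complex_of_real r \<in> spectrum_el a"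
    then have "complex_of_real (t - r) \<in> spectrum_el (of_real t - a)"
      by (simp only: spectrum_el_of_real_diff) simp
    then have "cmod (complex_of_real (t - r)) \<le> t" using spectrum_el_norm n by (metis order_trans)
    then show "r \<ge> 0" by (simp only: norm_of_real)
  qed
qed

lemma positive_el_add:
  assumes "positive_el a" "positive_el (b::'a::cstar_algebra)"
  shows "positive_el (a + b)"
proof (rule positive_el_iff_norm[THEN iffD2])
  show "adj (a + b) = a + b" using assms by (simp add: adj_add positive_el_sa)
  show "norm (a + b) \<le> norm a + norm b" by (rule norm_triangle_ineq)
  have "norm (of_real (norm a) - a) \<le> norm a" "norm (of_real (norm b) - b) \<le> norm b"
    using assms positive_el_iff_norm[OF positive_el_sa order_refl] by blast+
  then have "norm ((of_real (norm a) - a) + (of_real (norm b) - b)) \<le> norm a + norm b"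
    by (rule norm_triangle_mono)
  moreover have "(of_real (norm a) - a) + (of_real (norm b) - b) = of_real (norm a + norm b) - (a + b)"
    by (simp add: of_real_def scaleR_left_distrib)
  ultimately show "norm (of_real (norm a + norm b) - (a + b)) \<le> norm a + norm b"
    by (simp only:)
qed

lemma positive_el_of_real_iff: "positive_el (of_real r :: 'a::cstar_algebra) \<longleftrightarrow> r \<ge> 0"
proof -
  have e: "(of_real r :: 'a) - cscale c 1 = cscale (of_real r - c) 1" for c
    by (simp add: cscale_diff_left cscale_of_real_one)
  have "c \<in> spectrum_el (of_real r :: 'a) \<longleftrightarrow> c = of_real r" for c
    unfolding spectrum_el_def e using invertible_el_of_cscale_one[of "of_real r - c"] not_invertible_zero
    by (cases "c = of_real r") auto
  then have "spectrum_el (of_real r :: 'a) = {of_real r}" by blast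
  then show ?thesis by (auto simp: positive_el_def)
qed

lemma positive_el_zero [simp]: "positive_el (0::'a::cstar_algebra)"
  using positive_el_of_real_iff[of 0] by simp

lemma positive_el_scaleR:
  assumes "positive_el (a::'a::cstar_algebra)" "r \<ge> 0"
  shows "positive_el (r *\<^sub>R a)"
proof (rule positive_el_iff_norm[where t = "r * norm a", THEN iffD2])
  show "adj (r *\<^sub>R a) = r *\<^sub>R a" using assms by (simp add: adj_scaleR positive_el_sa)
  show "norm (r *\<^sub>R a) \<le> r * norm a" using assms by simp
  have "of_real (r * norm a) - r *\<^sub>R a = r *\<^sub>R (of_real (norm a) - a)"
    by (simp add: scaleR_diff_right of_real_def)
  then show "norm (of_real (r * norm a) - r *\<^sub>R a) \<le> r * norm a"
    using assms positive_el_iff_norm[of a "norm a"] by (simp add: positive_el_sa mult_left_mono)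
qed

lemma positive_el_sum: "(\<And>i. i \<in> I \<Longrightarrow> positive_el (f i :: 'a::cstar_algebra)) \<Longrightarrow> positive_el (\<Sum>i\<in>I. f i)"
  by (induction I rule: infinite_finite_induct) (auto intro: positive_el_add)

text \<open>With \<open>positive_el_norm_diff\<close> and \<open>positive_el_norm_add\<close> this
  is the dictionary between \<open>- t <= a <= t\<close> and \<open>norm a <= t\<close>.\<close>

lemma norm_le_of_positive:
  assumes sa: "adj a = (a::'a::cstar_algebra)" and "positive_el (of_real t - a)" "positive_el (of_real t + a)"
  shows "norm a \<le> t"
  using norm_in_spectrum_sa[OF sa]
proof
  assume "complex_of_real (norm a) \<in> spectrum_el a"
  then have "complex_of_real (t - norm a) \<in> spectrum_el (of_real t - a)"
    by (simp only: spectrum_el_of_real_diff) simp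
  then show ?thesis using positive_elD[OF assms(2)] by fastforce
next
  assume "complex_of_real (- norm a) \<in> spectrum_el a"
  then have "complex_of_real (t - norm a) \<in> spectrum_el (a + of_real t)"
    by (simp only: spectrum_el_add_of_real) simp
  then have "complex_of_real (t - norm a) \<in> spectrum_el (of_real t + a)"
    by (simp only: add.commute)
  from positive_elD[OF assms(3) this] show ?thesis by simp
qed

lemma positive_el_norm_diff:
  assumes sa: "adj a = (a::'a::cstar_algebra)" and t: "norm a \<le> t"
  shows "positive_el (of_real t - a)"
proof (rule positive_elI)
  fix r assume "complex_of_real r \<in> spectrum_el (of_real t - a)"
  then have "complex_of_real (t - r) \<in> spectrum_el a" by (simp only: spectrum_el_of_real_diff)
  from spectrum_el_norm[OF this] show "r \<ge> 0" using t by (simp only: norm_of_real)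
qed (simp add: adj_diff sa)

lemma positive_el_norm_add:
  assumes sa: "adj a = (a::'a::cstar_algebra)" and t: "norm a \<le> t"
  shows "positive_el (of_real t + a)"
  using positive_el_norm_diff[of "-a" t] assms by (simp add: adj_minus)

lemma norm_mono_positive:
  assumes "positive_el a" "positive_el (b - a :: 'a::cstar_algebra)"
  shows "norm a \<le> norm b"
proof (rule norm_le_of_positive)
  have b: "positive_el b" using positive_el_add[OF assms] by simp
  show "adj a = a" using assms positive_el_sa by blast
  have "positive_el (of_real (norm b) - b)" by (rule positive_el_norm_diff) (use b positive_el_sa in auto)
  from positive_el_add[OF this assms(2)] show "positive_el (of_real (norm b) - a)" by simp
  show "positive_el (of_real (norm b) + a)"
    using assms(1) by (intro positive_el_add) (simp_all add: positive_el_of_real_iff)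
qed

text \<open>For \<open>r = - s^2\<close> the element \<open>h h - r\<close> factors as
  \<open>(h - i s) (h + i s)\<close>, and both factors are invertible because the spectrum of
  \<open>h\<close> is real.\<close>

lemma positive_el_square:
  assumes sa: "adj h = (h::'a::cstar_algebra)"
  shows "positive_el (h * h)"
proof (rule positive_elI)
  show sa2: "adj (h * h) = h * h" by (simp add: adj_mult sa)
  fix r assume r: "complex_of_real r \<in> spectrum_el (h * h)"
  show "r \<ge> 0"
  proof (rule ccontr)
    assume n: "\<not> r \<ge> 0"
    define s where "s = sqrt (-r)"
    have s: "s > 0" "s * s = - r" using n by (auto simp: s_def)
    have i: "invertible_el (h - cscale (\<i> * of_real u) 1)" if "u \<noteq> 0" for u
      using spectrum_sa_real[OF sa, of "\<i> * of_real u"] that by (auto simp: spectrum_el_def)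
    have "invertible_el ((h - cscale (\<i> * of_real s) 1) * (h - cscale (\<i> * of_real (- s)) 1))"
      using s by (intro invertible_el_mult i) auto
    also have "(h - cscale (\<i> * of_real s) 1) * (h - cscale (\<i> * of_real (- s)) 1)
       = h * h - cscale ((\<i> * of_real s) * (\<i> * of_real s)) 1"
      by (simp add: algebra_simps cscale_minus_left cscale_left_mult cscale_right_mult cscale_cscale
            cscale_add_right cscale_diff_right)
    also have "(\<i> * complex_of_real s) * (\<i> * complex_of_real s) = of_real r"
      using s(2) by (metis (no_types, lifting) complex_i_mult_minus minus_equation_iff mult.assoc mult.commute mult_minus_right of_real_minus of_real_mult)
    finally show False using r by (simp add: spectrum_el_def)
  qed
qed

lemma spectrum_el_mult_commute:
  assumes "c \<noteq> 0" "c \<in> spectrum_el (x * y :: 'a::cstar_algebra)"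
  shows "c \<in> spectrum_el (y * x)"
proof (rule ccontr)
  assume "c \<notin> spectrum_el (y * x)"
  then have i: "invertible_el (y * x - cscale c 1)" by (simp add: spectrum_el_def)
  define w where "w = inverse_el (y * x - cscale c 1)"
  have w: "y * x * w = 1 + cscale c w" "w * y * x = 1 + cscale c w"
    using inverse_el[OF i] by (simp_all add: w_def algebra_simps cscale_left_mult cscale_right_mult)
  \<comment> \<open>Expanding the inverse of \<open>c - x y\<close> as a formal geometric series and
    pulling out \<open>x\<close> on the left and \<open>y\<close> on the right suggests this
    expression in \<open>w\<close>.\<close>
  let ?v = "cscale (1 / c) (x * w * y - 1)"
  have "(x * y - cscale c 1) * (x * w * y - 1) = x * (y * x * w) * y - x * y - cscale c (x * w * y) + cscale c 1"
    by (simp add: algebra_simps cscale_left_mult cscale_right_mult cscale_diff_right)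
  also have "\<dots> = cscale c 1" unfolding w by (simp add: algebra_simps cscale_left_mult cscale_right_mult cscale_diff_right)
  finally have 1: "(x * y - cscale c 1) * ?v = 1" using assms(1) by (simp add: cscale_right_mult cscale_cscale)
  have "(x * w * y - 1) * (x * y - cscale c 1) = x * (w * y * x) * y - x * y - cscale c (x * w * y) + cscale c 1"
    by (simp add: algebra_simps cscale_left_mult cscale_right_mult cscale_diff_right)
  also have "\<dots> = cscale c 1" unfolding w by (simp add: algebra_simps cscale_left_mult cscale_right_mult cscale_diff_right)
  finally have 2: "?v * (x * y - cscale c 1) = 1" using assms(1) by (simp add: cscale_left_mult cscale_cscale)
  show False using invertible_lr[OF 1 2] assms(2) by (simp add: spectrum_el_def)
qed

lemma cartesian_decomposition:
  fixes x :: "'a::cstar_algebra"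
  obtains h k where "adj h = h" "adj k = k" "x = h + cscale \<i> k" "norm h \<le> norm x" "norm k \<le> norm x"
proof -
  define h where "h = (1/2) *\<^sub>R (x + adj x)"
  define k where "k = cscale (- \<i> / 2) (x - adj x)"
  have "adj h = h" by (simp add: h_def adj_scaleR adj_add adj_adj add.commute)
  moreover have "adj k = k"
    by (simp add: k_def adj_cscale adj_diff adj_adj cscale_diff_right cscale_minus_left)
  moreover have "x = h + cscale \<i> k"
  proof -
    have "cscale \<i> k = (1/2) *\<^sub>R (x - adj x)"
      using cscale_of_real[of "1/2" "x - adj x"] by (simp add: k_def cscale_cscale)
    then show ?thesis by (simp add: h_def flip: scaleR_add_right)
  qed
  moreover have "norm h \<le> norm x" using norm_triangle_ineq[of x "adj x"] by (simp add: h_def)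
  moreover have "norm k \<le> norm x" using norm_triangle_ineq4[of x "adj x"] by (simp add: k_def norm_cscale norm_divide)
  ultimately show ?thesis by (rule that)
qed

text \<open>If \<open>x\<^sup>* x\<close> had a negative spectral value, \<open>x\<^sup>* x + c\<close> would fail to be invertible for a
maximal \<open>c > 0\<close>. For larger \<open>c\<close>, however, \<open>y = x (x\<^sup>* x + c)\<^sup>-\<^sup>1\<close> satisfies \<open>y\<^sup>* y \<le> 1/(4c)\<close>, hence also
\<open>y y\<^sup>* \<le> 1/(4c)\<close>, and since \<open>y\<^sup>* y + y y\<^sup>*\<close> is a sum of two squares, the resolvent stays bounded.\<close>

lemma adj_mult_resolvent_bound:
  fixes x :: "'a::cstar_algebra"
  defines "a \<equiv> adj x * x"
  assumes c: "c > 0" and inv: "invertible_el (a + of_real c)"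
  shows "norm (a * inverse_el (a + of_real c) * inverse_el (a + of_real c)) \<le> 1 / (4 * c)"
proof -
  define p where "p = inverse_el (a + of_real c)"
  define y where "y = x * p"
  have saa: "adj a = a" by (simp add: a_def adj_mult adj_adj)
  have ainv: "(a + of_real c) * p = 1" "p * (a + of_real c) = 1" using inverse_el[OF inv] by (auto simp: p_def)
  have sap: "adj p = p" using inverse_el_adj[OF inv] by (simp add: p_def adj_add saa)
  have comm: "a * p = p * a"
    using inverse_el_commute[OF inv, of a] by (simp add: p_def of_real_def algebra_simps)
  have comm': "p * (a * z) = a * (p * z)" for z by (metis comm mult.assoc)
  define d where "d = 1 / (4 * c)"
  have "adj y * y = p * a * p" by (simp add: y_def adj_mult sap a_def mult.assoc)
  then have yy: "adj y * y = a * p * p" by (simp add: comm)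
  \<comment> \<open>From \<open>(a + c)^2 - (a - c)^2 = 4 c a\<close> follows
    \<open>q q = 1 - 4 c a p p\<close>; positivity of this square is the upper bound on
    \<open>adj y * y\<close>.\<close>
  define q where "q = (a - of_real c) * p"
  have saq: "adj q = q" by (simp add: q_def adj_mult adj_diff sap saa algebra_simps comm of_real_def adj_scaleR)
  have sq: "(a + t *\<^sub>R 1) * p * ((a + t *\<^sub>R 1) * p)
      = a * (a * (p * p)) + (2 * t) *\<^sub>R (a * (p * p)) + (t * t) *\<^sub>R (p * p)" for t
  proof -
    have "(a + t *\<^sub>R 1) * p * ((a + t *\<^sub>R 1) * p) = (a + t *\<^sub>R 1) * ((a + t *\<^sub>R 1) * (p * p))"
      by (simp add: algebra_simps comm[symmetric] comm')
    also have "\<dots> = a * (a * (p * p)) + (2 * t) *\<^sub>R (a * (p * p)) + (t * t) *\<^sub>R (p * p)"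
      by (simp add: algebra_simps scaleR_2 flip: scaleR_scaleR)
    finally show ?thesis .
  qed
  define X where "X = a * (p * p)"
  have "(a + c *\<^sub>R 1) * p * ((a + c *\<^sub>R 1) * p) = 1"
    using ainv(1) by (simp add: of_real_def)
  then have A: "a * X + (2 * c) *\<^sub>R X + (c * c) *\<^sub>R (p * p) = 1" unfolding sq X_def .
  have "q = (a + (- c) *\<^sub>R 1) * p" by (simp add: q_def of_real_def)
  then have "q * q = a * X + (2 * - c) *\<^sub>R X + (- c * - c) *\<^sub>R (p * p)" unfolding X_def by (simp only: sq)
  also have "\<dots> = (a * X + (2 * c) *\<^sub>R X + (c * c) *\<^sub>R (p * p)) - (2 * c + 2 * c) *\<^sub>R X"
    by (simp only: scaleR_left_distrib) (simp add: algebra_simps)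
  also have "\<dots> = 1 - (4 * c) *\<^sub>R (a * p * p)" unfolding A by (simp add: X_def mult.assoc)
  finally have "q * q = 1 - (4 * c) *\<^sub>R (a * p * p)" .
  then have "d *\<^sub>R (q * q) = of_real d - adj y * y"
    using c by (simp add: yy d_def scaleR_diff_right of_real_def)
  then have up: "positive_el (of_real d - adj y * y)"
    using positive_el_scaleR[OF positive_el_square[OF saq], of d] c by (simp add: d_def)
  have up': "positive_el (of_real d - y * adj y)"
  proof (rule positive_elI)
    fix r assume "complex_of_real r \<in> spectrum_el (of_real d - y * adj y)"
    then have r: "complex_of_real (d - r) \<in> spectrum_el (y * adj y)" by (simp only: spectrum_el_of_real_diff)
    show "r \<ge> 0"
    proof (cases "d = r")
      case False
      then have "complex_of_real (d - r) \<in> spectrum_el (adj y * y)"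
        using spectrum_el_mult_commute[OF _ r] by simp
      then have "complex_of_real r \<in> spectrum_el (of_real d - adj y * y)"
        by (simp only: spectrum_el_of_real_diff)
      then show ?thesis using positive_elD[OF up] by blast
    qed (use c in \<open>auto simp: d_def\<close>)
  qed (simp add: adj_diff adj_mult adj_adj)
  obtain h k where hk: "adj h = h" "adj k = k" "y = h + cscale \<i> k" by (rule cartesian_decomposition)
  have ay: "adj y = h - cscale \<i> k" using hk by (simp add: adj_add adj_cscale cscale_minus_left)
  have "adj y * y + y * adj y = 2 *\<^sub>R (h * h) + 2 *\<^sub>R (k * k)"
    unfolding ay unfolding hk(3) by (simp add: algebra_simps cscale_left_mult cscale_right_mult cscale_cscale cscale_minus_left
        cscale_add_right cscale_diff_right scaleR_2)
  then have "positive_el (adj y * y + y * adj y)"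
    using hk by (simp add: positive_el_add positive_el_scaleR positive_el_square)
  from positive_el_add[OF this up'] have lo: "positive_el (of_real d + adj y * y)" by (simp add: algebra_simps)
  have "norm (adj y * y) \<le> d" by (rule norm_le_of_positive[OF _ up lo]) (simp add: adj_mult adj_adj)
  then show ?thesis by (simp add: yy p_def d_def)
qed

lemma positive_el_adj_mult: "positive_el (adj x * x)" for x :: "'a::cstar_algebra"
proof (rule positive_elI)
  define a where "a = adj x * x"
  have saa: "adj a = a" by (simp add: a_def adj_mult adj_adj)
  then show "adj (adj x * x) = adj x * x" by (simp add: a_def)
  fix r assume "complex_of_real r \<in> spectrum_el (adj x * x)"
  then have r: "complex_of_real r \<in> spectrum_el a" by (simp add: a_def)
  define f where "f c = a + of_real c" for c
  have contf: "continuous_on S f" for S unfolding f_def by (intro continuous_intros)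
  have inspec: "complex_of_real (- c) \<in> spectrum_el a \<longleftrightarrow> \<not> invertible_el (f c)" for c
    by (simp add: spectrum_el_def f_def cscale_minus_left cscale_of_real_one)
  show "r \<ge> 0"
  proof (rule ccontr)
    assume "\<not> r \<ge> 0"
    define S where "S = {c. \<not> invertible_el (f c)}"
    have "S = - (f -` {b. invertible_el b})" by (auto simp: S_def)
    then have clS: "closed S" using open_vimage[OF open_invertible contf] by (simp add: closed_def)
    have bdd: "bdd_above S"
    proof (rule bdd_aboveI)
      fix c assume "c \<in> S"
      then have "complex_of_real (- c) \<in> spectrum_el a" by (simp only: inspec S_def mem_Collect_eq not_False_eq_True)
      from spectrum_el_norm[OF this] show "c \<le> norm a" by (simp only: norm_of_real)
    qed
    have rS: "- r \<in> S" using r inspec[of "-r"] by (simp add: S_def)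
    \<comment> \<open>The largest shift at which invertibility fails, attained because the
      non-invertible elements form a closed set.\<close>
    define l where "l = Sup S"
    have lS: "l \<in> S" unfolding l_def using closed_contains_Sup[OF _ bdd clS] rS by blast
    have upper: "c \<le> l" if "c \<in> S" for c unfolding l_def using cSup_upper[OF that bdd] .
    have lpos: "l > 0" using upper[OF rS] \<open>\<not> r \<ge> 0\<close> by simp
    \<comment> \<open>At distance \<open>l\<close> from the non-invertible \<open>f l\<close> the
      inverse \<open>p\<close> has norm at least \<open>1 / l\<close>, so
      \<open>u = c * norm p\<close> is at least 2. The resolvent bound gives
      \<open>u * u <= u + 1/4\<close>, which no such \<open>u\<close> satisfies.\<close>
    define c where "c = 2 * l"
    have ic: "invertible_el (f c)" using upper[of c] lpos by (auto simp: S_def c_def)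
    define p where "p = inverse_el (f c)"
    have p: "f c * p = 1" "p * f c = 1" using inverse_el[OF ic] by (auto simp: p_def)
    have sap: "adj p = p" using inverse_el_adj[OF ic] by (simp add: p_def f_def adj_add saa)
    have nb: "norm (a * p * p) \<le> 1 / (4 * c)"
      using adj_mult_resolvent_bound[of c x] ic lpos by (simp add: p_def f_def a_def c_def)
    have ninv: "\<not> invertible_el (f l)" using lS by (simp add: S_def)
    have fl: "f l = f c - of_real l" by (simp only: f_def c_def mult_2 of_real_add add_diff_cancel flip: add.assoc)
    have "l * norm p \<ge> 1"
    proof (rule ccontr)
      assume "\<not> l * norm p \<ge> 1"
      then have "norm (f l - f c) * norm (inverse_el (f c)) < 1"
        using lpos by (simp add: fl p_def)
      then show False using invertible_el_perturb(1)[OF ic] ninv by blast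
    qed
    then have np: "norm p \<ge> 1 / l" using lpos by (simp add: field_simps)
    have "a * p = 1 - of_real c * p" using p(1) by (simp add: f_def algebra_simps)
    then have "a * p * p = p - of_real c * (p * p)"
      by (simp only:) (simp add: left_diff_distrib mult.assoc)
    then have "of_real c * (p * p) = p - a * p * p" by simp
    then have "norm (of_real c * (p * p)) = norm (p - a * p * p)" by (simp only:)
    then have "norm (of_real c * (p * p)) \<le> norm p + 1 / (4 * c)"
      using norm_triangle_ineq4[of p "a * p * p"] nb by linarith
    moreover have "norm (of_real c * (p * p)) = c * (norm p * norm p)"
    proof -
      have "norm (of_real c * (p * p)) = norm (c *\<^sub>R (p * p))" by (simp only: scaleR_conv_of_real)
      then show ?thesis using lpos by (simp add: norm_sa_square[OF sap] c_def power2_eq_square)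
    qed
    ultimately have ineq: "c * (norm p * norm p) \<le> norm p + 1 / (4 * c)" by simp
    define u where "u = c * norm p"
    have "u * u \<le> u + 1/4"
    proof -
      have "c * (c * (norm p * norm p)) \<le> c * (norm p + 1 / (4 * c))"
        using ineq lpos by (intro mult_left_mono) (auto simp: c_def)
      then show ?thesis using lpos by (simp add: u_def c_def algebra_simps)
    qed
    moreover have "u \<ge> 2"
    proof -
      have "u \<ge> c * (1 / l)" unfolding u_def using np lpos by (intro mult_left_mono) (auto simp: c_def)
      moreover have "c * (1 / l) \<ge> 2" using lpos by (simp add: c_def field_simps)
      ultimately show ?thesis by linarith
    qed
    ultimately have "u * u \<le> u + 1/4" "u * u \<ge> 2 * u" by (auto intro: mult_right_mono)
    with \<open>u \<ge> 2\<close> show False by linarith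
  qed
qed

section \<open>Square roots and elements with positive imaginary part\<close>

text \<open>With \<open>p = 1 - x\<close> and the root written as \<open>1 - y\<close>, the equation
  becomes \<open>y = (x + y y) / 2\<close>, a fixed-point problem. It is solved in the closed set
  \<open>S\<close> of selfadjoint elements commuting with everything that commutes with
  \<open>x\<close>, so the fixed point has these properties as well.\<close>

lemma square_root_near_one:
  fixes p :: "'a::cstar_algebra"
  assumes sa: "adj p = p" and p: "norm (1 - p) < 1"
  obtains q where "adj q = q" "q * q = p" "\<And>z. z * p = p * z \<Longrightarrow> z * q = q * z"
proof -
  define x where "x = 1 - p"
  define s where "s = sqrt (1 - norm x)"
  have s: "0 < s" "s \<le> 1" "s * s = 1 - norm x" using p by (auto simp: s_def x_def)
  \<comment> \<open>The smaller root of \<open>r^2 - 2 r + norm x = 0\<close>: it makes the ball of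
    radius \<open>r\<close> invariant under \<open>F\<close>, and it is also the contraction
    factor.\<close>
  define r where "r = 1 - s"
  have r: "0 \<le> r" "r < 1" and rx: "norm x + r * r = 2 * r" using s by (auto simp: r_def algebra_simps)
  define F where "F y = (1/2) *\<^sub>R (x + y * y)" for y
  define S where "S = cball 0 r \<inter> {y. adj y = y} \<inter> (\<Inter>z\<in>{z. z * x = x * z}. {y. z * y = y * z})"
  have "closed {y::'a. adj y = y}"
    by (intro closed_Collect_eq linear_continuous_on[OF bounded_linear_adj] continuous_on_id)
  moreover have "closed {y. z * y = y * z}" for z :: 'a
    by (intro closed_Collect_eq continuous_intros)
  ultimately have "closed S" unfolding S_def by (intro closed_Int closed_INT) auto
  then have "uniform_space_class.complete S" by (simp add: complete_eq_closed)
  moreover have "0 \<in> S" using r by (simp add: S_def)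
  then have "S \<noteq> {}" by blast
  moreover have "F ` S \<subseteq> S"
  proof (intro image_subsetI)
    fix y assume "y \<in> S"
    then have y: "norm y \<le> r" "adj y = y" "\<And>z. z * x = x * z \<Longrightarrow> z * y = y * z"
      by (auto simp: S_def)
    have "norm (F y) \<le> (1/2) * (norm x + norm y * norm y)"
      using norm_triangle_ineq[of x "y * y"] norm_mult_ineq[of y y] by (simp add: F_def)
    also have "\<dots> \<le> (1/2) * (norm x + r * r)" using y(1) r by (auto intro!: mult_mono)
    finally have "norm (F y) \<le> r" using rx by simp
    moreover have "adj (F y) = F y"
      using y(2) sa by (simp add: F_def x_def adj_scaleR adj_add adj_diff adj_mult)
    moreover have "z * F y = F y * z" if "z * x = x * z" for z
    proof -
      have "z * y = y * z" using y(3) that .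
      then have "z * (y * y) = y * y * z" by (metis mult.assoc)
      then show ?thesis using that by (simp add: F_def distrib_left distrib_right)
    qed
    ultimately show "F y \<in> S" by (auto simp: S_def)
  qed
  moreover have "dist (F y) (F y') \<le> r * dist y y'" if "y \<in> S" "y' \<in> S" for y y'
  proof -
    have "F y - F y' = (1/2) *\<^sub>R (y * (y - y') + (y - y') * y')" by (simp add: F_def algebra_simps)
    then have "dist (F y) (F y') \<le> (1/2) * (norm y * norm (y - y') + norm (y - y') * norm y')"
      using norm_triangle_ineq[of "y * (y - y')" "(y - y') * y'"] norm_mult_ineq[of y "y - y'"]
        norm_mult_ineq[of "y - y'" y'] by (simp add: dist_norm)
    also have "\<dots> \<le> (1/2) * (r * norm (y - y') + norm (y - y') * r)"
      using that r by (intro mult_left_mono add_mono mult_mono) (auto simp: S_def)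
    finally show ?thesis by (simp add: dist_norm mult.commute)
  qed
  ultimately have "\<exists>!y\<in>S. F y = y" using r by (intro Banach_fix) auto
  then obtain y where y: "y \<in> S" "F y = y" by blast
  then have y': "adj y = y" "\<And>z. z * x = x * z \<Longrightarrow> z * y = y * z" by (auto simp: S_def)
  have "2 *\<^sub>R F y = x + y * y" by (simp add: F_def)
  then have yy: "x + y * y = 2 *\<^sub>R y" using y(2) by simp
  show ?thesis
  proof (rule that[of "1 - y"])
    show "adj (1 - y) = 1 - y" using y'(1) by (simp add: adj_diff)
    have "(1 - y) * (1 - y) = 1 - 2 *\<^sub>R y + y * y" by (simp add: algebra_simps scaleR_2)
    also have "\<dots> = 1 - x" by (simp flip: yy)
    finally show "(1 - y) * (1 - y) = p" by (simp add: x_def)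
    fix z assume "z * p = p * z"
    then have "z * x = x * z" by (simp add: x_def algebra_simps)
    then have "z * y = y * z" by (rule y'(2))
    then show "z * (1 - y) = (1 - y) * z" by (simp add: algebra_simps)
  qed
qed

text \<open>Rescaling by \<open>t = norm p + e\<close> brings \<open>p\<close> within distance less
  than 1 of the unit; the gap \<open>e\<close> above 0 makes the inequality strict.\<close>

lemma square_root_strictly_positive:
  fixes p :: "'a::cstar_algebra"
  assumes pos: "positive_el (p - of_real e)" and e: "e > 0"
  obtains q where "adj q = q" "q * q = p" "\<And>z. z * p = p * z \<Longrightarrow> z * q = q * z"
proof -
  define t where "t = norm p + e"
  have t: "t > 0" using e by (simp add: t_def add_nonneg_pos)
  have "adj (p - of_real e) = p - of_real e" using pos positive_el_sa by blast
  then have sap: "adj p = p" by (simp add: adj_diff)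
  define p' where "p' = (1/t) *\<^sub>R p"
  have "norm (of_real t - (p - of_real e + of_real e)) \<le> t - e"
  proof (rule norm_le_of_positive)
    show "adj (of_real t - (p - of_real e + of_real e)) = of_real t - (p - of_real e + of_real e)"
      by (simp add: adj_diff sap)
    show "positive_el (of_real (t - e) - (of_real t - (p - of_real e + of_real e)))"
      using pos by (simp add: algebra_simps)
    have "(of_real (t - e) + of_real t :: 'a) = of_real (2*t - e)"
      by (simp only: of_real_add[symmetric]) (rule arg_cong[where f=of_real], simp)
    then have "of_real (t - e) + (of_real t - (p - of_real e + of_real e)) = of_real (2*t - e) - p"
      by (simp only: diff_add_cancel add_diff_eq)
    moreover have "positive_el (of_real (2*t - e) - p)"
      by (rule positive_el_norm_diff[OF sap]) (use e in \<open>simp add: t_def\<close>)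
    ultimately show "positive_el (of_real (t - e) + (of_real t - (p - of_real e + of_real e)))"
      by (simp only:)
  qed
  then have n: "norm (of_real t - p) \<le> t - e" by simp
  have "1 - p' = (1/t) *\<^sub>R (of_real t - p)" using t by (simp add: p'_def of_real_def scaleR_diff_right)
  then have "norm (1 - p') < 1" using n t e by (simp add: divide_less_eq)
  moreover have "adj p' = p'" by (simp add: p'_def adj_scaleR sap)
  ultimately obtain q where q: "adj q = q" "q * q = p'" "\<And>z. z * p' = p' * z \<Longrightarrow> z * q = q * z"
    using square_root_near_one by blast
  show ?thesis
  proof (rule that[of "sqrt t *\<^sub>R q"])
    show "adj (sqrt t *\<^sub>R q) = sqrt t *\<^sub>R q" by (simp add: adj_scaleR q)
    show "sqrt t *\<^sub>R q * sqrt t *\<^sub>R q = p" using t q(2) by (simp add: p'_def)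
    fix z assume "z * p = p * z"
    then have "z * p' = p' * z" by (simp add: p'_def)
    then show "z * sqrt t *\<^sub>R q = sqrt t *\<^sub>R q * z" using q(3)[of z] by simp
  qed
qed

lemma positive_el_of_eps:
  assumes "\<And>e. e > 0 \<Longrightarrow> positive_el (a + of_real e :: 'a::cstar_algebra)"
  shows "positive_el a"
proof (rule positive_elI)
  have "adj (a + of_real 1) = a + of_real 1" using assms[of 1] positive_el_sa by force
  then show "adj a = a" by (simp add: adj_add)
  fix r assume r: "complex_of_real r \<in> spectrum_el a"
  show "r \<ge> 0"
  proof (rule field_le_epsilon)
    fix e :: real assume e: "e > 0"
    have "complex_of_real (r + e) \<in> spectrum_el (a + of_real e)"
      using r by (simp only: spectrum_el_add_of_real) simp
    from positive_elD[OF assms[OF e] this] show "0 \<le> r + e" .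
  qed
qed

text \<open>Since \<open>p\<close> may fail to be strictly positive, \<open>p + d\<close> takes its
  place: if \<open>q\<close> is its root, then
  \<open>adj x * (p + d) * x = adj (q * x) * (q * x)\<close>, and \<open>d\<close> is so small that
  the error \<open>d *\<^sub>R (adj x * x)\<close> is at most \<open>e\<close>.\<close>

lemma positive_el_conjugate:
  assumes p: "positive_el (p::'a::cstar_algebra)"
  shows "positive_el (adj x * p * x)"
proof (rule positive_el_of_eps)
  fix e :: real assume e: "e > 0"
  define d where "d = e / ((norm x)\<^sup>2 + 1)"
  have "0 < 1 + (norm x)\<^sup>2" by (simp add: add_pos_nonneg)
  then have d: "d > 0" "d * (norm x)\<^sup>2 \<le> e" using e
    by (auto simp: d_def field_simps)
  have "positive_el (p + of_real d - of_real d)" using p by simp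
  then obtain q where q: "adj q = q" "q * q = p + of_real d"
    using square_root_strictly_positive d(1) by blast
  have "positive_el (adj (q * x) * (q * x))" by (rule positive_el_adj_mult)
  also have "adj (q * x) * (q * x) = adj x * (p + of_real d) * x"
    by (simp add: adj_mult q mult.assoc flip: q(2))
  finally have 1: "positive_el (adj x * p * x + d *\<^sub>R (adj x * x))"
    by (simp add: algebra_simps of_real_def)
  have "positive_el (of_real e - d *\<^sub>R (adj x * x))"
    using d by (intro positive_el_norm_diff) (auto simp: adj_scaleR adj_mult adj_adj cstar_identity)
  from positive_el_add[OF 1 this] show "positive_el (adj x * p * x + of_real e)" by simp
qed

lemma adj_mult_le:
  "positive_el ((norm x)\<^sup>2 *\<^sub>R (adj y * y) - adj y * (adj x * x) * (y::'a::cstar_algebra))"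
proof -
  have "positive_el (of_real ((norm x)\<^sup>2) - adj x * x)"
    by (rule positive_el_norm_diff) (auto simp: adj_mult adj_adj cstar_identity)
  from positive_el_conjugate[OF this, of y] show ?thesis
    by (simp add: algebra_simps of_real_def)
qed

section \<open>Elements with strictly positive imaginary part\<close>

definition im_el :: "'a::cstar_algebra \<Rightarrow> 'a" where
  "im_el x = cscale (1 / (2 * \<i>)) (x - adj x)"

lemma im_el_sa: "adj (im_el x) = im_el x"
  by (simp add: im_el_def adj_cscale adj_diff adj_adj cscale_diff_right cscale_minus_left)

text \<open>Since \<open>S = -i T\<close> satisfies \<open>S + S\<^sup>* = 2 Im T \<ge> 2 c\<close>, the element \<open>1 - t S\<close> has norm
\<open>1 - t c + O(t\<^sup>2)\<close> for small \<open>t > 0\<close>, so \<open>T\<^sup>-\<^sup>1\<close> is given by a Neumann series.\<close>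

lemma im_el_bound_norm:
  fixes T :: "'a::cstar_algebra"
  assumes pos: "positive_el (im_el T - of_real c)" and c: "c > 0" and t: "t > 0" "2 * t * norm T \<le> 1" "t * c \<le> 1"
  shows "norm (1 - cscale (- \<i> * of_real t) T) \<le> 1 - t * c + t\<^sup>2 * (norm T)\<^sup>2"
proof -
  define H where "H = im_el T"
  define M where "M = norm T"
  have saH: "adj H = H" by (simp add: H_def im_el_sa)
  have nH: "norm H \<le> M"
    using norm_triangle_ineq4[of T "adj T"] by (simp add: H_def im_el_def norm_cscale norm_divide norm_mult M_def)
  have "of_real c - H = - (H - of_real c)" by simp
  have cM: "c \<le> M"
  proof -
    have "norm (of_real c :: 'a) \<le> norm H"
      using pos c by (intro norm_mono_positive) (simp_all add: positive_el_of_real_iff H_def)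
    then show ?thesis using nH c by simp
  qed
  define S where "S = cscale (- \<i>) T"
  have adjS: "adj S = cscale \<i> (adj T)" by (simp add: S_def adj_cscale)
  have SS: "S + adj S = 2 *\<^sub>R H"
  proof -
    have "2 *\<^sub>R H = cscale (2 * (1 / (2 * \<i>))) (T - adj T)"
      using cscale_of_real[of 2 H] by (simp add: H_def im_el_def cscale_cscale)
    also have "2 * (1 / (2 * \<i>)) = - \<i>" by simp
    finally show ?thesis by (simp add: S_def adj_cscale cscale_diff_right cscale_minus_left adj_minus)
  qed
  have nS: "norm S = M" by (simp add: S_def norm_cscale M_def)
  have eq: "1 - cscale (- \<i> * of_real t) T = 1 - t *\<^sub>R S"
    by (simp add: S_def cscale_cscale mult.commute flip: cscale_of_real)
  have "norm (1 - (2 * t) *\<^sub>R H) \<le> 1 - 2 * t * c"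
  proof (rule norm_le_of_positive)
    show "adj (1 - (2 * t) *\<^sub>R H) = 1 - (2 * t) *\<^sub>R H" by (simp add: adj_diff adj_scaleR saH)
    have "of_real (1 - 2 * t * c) - (1 - (2 * t) *\<^sub>R H) = (2 * t) *\<^sub>R (H - of_real c)"
      by (simp add: of_real_def scaleR_diff_right scaleR_diff_left)
    then show "positive_el (of_real (1 - 2 * t * c) - (1 - (2 * t) *\<^sub>R H))"
      using positive_el_scaleR[OF pos, of "2 * t"] t by (simp add: H_def)
    have "norm ((2 * t) *\<^sub>R H) \<le> 2 * t * M" using nH t by simp
    then have 1: "positive_el (of_real (2 * t * M) - (2 * t) *\<^sub>R H)"
      by (intro positive_el_norm_diff) (simp add: adj_scaleR saH)
    have "t * c \<le> t * M" using cM t by simp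
    then have "2 * t * M \<le> 2 - 2 * t * c" using t(2) by (simp add: M_def)
    then have "positive_el (of_real (2 - 2 * t * c - 2 * t * M) :: 'a)" by (simp only: positive_el_of_real_iff)
    from positive_el_add[OF this 1]
    show "positive_el (of_real (1 - 2 * t * c) + (1 - (2 * t) *\<^sub>R H))"
      by (simp add: algebra_simps)
  qed
  note e1 = this
  have e2: "adj (1 - t *\<^sub>R S) * (1 - t *\<^sub>R S) = (1 - (2 * t) *\<^sub>R H) + (t * t) *\<^sub>R (adj S * S)"
  proof -
    have "(2 * t) *\<^sub>R H = t *\<^sub>R (S + adj S)" by (simp add: SS mult.commute)
    then show ?thesis by (simp add: adj_diff adj_scaleR algebra_simps)
  qed
  have e3: "norm ((t * t) *\<^sub>R (adj S * S)) = t * t * M\<^sup>2" by (simp add: cstar_identity nS)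
  have "(norm (1 - t *\<^sub>R S))\<^sup>2 = norm (1 - (2 * t) *\<^sub>R H + (t * t) *\<^sub>R (adj S * S))"
    by (simp only: cstar_identity[symmetric] e2)
  also have "\<dots> \<le> norm (1 - (2 * t) *\<^sub>R H) + norm ((t * t) *\<^sub>R (adj S * S))"
    by (rule norm_triangle_ineq)
  also have "\<dots> \<le> 1 - 2 * t * c + t * t * M\<^sup>2" unfolding e3 using e1 by simp
  \<comment> \<open>The bound on the squared norm lies below a perfect square; the surplus is
    nonnegative because \<open>c <= M\<close>.\<close>
  also have "\<dots> \<le> (1 - t * c + t\<^sup>2 * M\<^sup>2)\<^sup>2"
  proof -
    have "(1 - t * c + t\<^sup>2 * M\<^sup>2)\<^sup>2 = (1 - 2 * t * c + t * t * M\<^sup>2) + (t * c)\<^sup>2 + t\<^sup>2 * M\<^sup>2 * (1 - 2 * (t * c) + t\<^sup>2 * M\<^sup>2)"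
      by algebra
    moreover have "1 - 2 * (t * c) + t\<^sup>2 * M\<^sup>2 = (1 - t * c)\<^sup>2 + t\<^sup>2 * (M\<^sup>2 - c\<^sup>2)" by algebra
    moreover have "c\<^sup>2 \<le> M\<^sup>2" using cM c by (simp add: power_mono)
    ultimately show ?thesis by (simp add: zero_le_mult_iff)
  qed
  finally show ?thesis unfolding eq M_def[symmetric]
    by (rule power2_le_imp_le) (use t in simp)
qed

text \<open>A fixed \<open>t\<close> only yields the bound \<open>1 / (c - t M^2)\<close>; letting
  \<open>t\<close> tend to 0 gives the exact \<open>1 / c\<close>, on which the constants of the
  theorem rest. The third part will locate resolvents in closed subspaces, and the fourth keeps the
  Neumann estimate for use under a state.\<close>

lemma invertible_of_im_el:
  fixes T :: "'a::cstar_algebra"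
  assumes pos: "positive_el (im_el T - of_real c)" and c: "c > 0"
  shows "invertible_el T" and "norm (inverse_el T) \<le> 1 / c"
    and "\<lbrakk>subspace V; \<And>z v. v \<in> V \<Longrightarrow> cscale z v \<in> V; closed V; 1 \<in> V; \<And>v. v \<in> V \<Longrightarrow> T * v \<in> V\<rbrakk>
      \<Longrightarrow> inverse_el T \<in> V"
    and "\<exists>t0>0. \<forall>t. 0 < t \<and> t \<le> t0 \<longrightarrow> norm (1 - cscale (- \<i> * of_real t) T) \<le> 1 - t * c / 2"
proof -
  define M where "M = norm T"
  define g where "g t = - \<i> * complex_of_real t" for t
  define t1 where "t1 = min (1 / (2 * M + 1)) (1 / c)"
  have M0: "M \<ge> 0" by (simp add: M_def)
  have t1: "t1 > 0" using c M0 by (simp add: t1_def add_nonneg_pos)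
  have b: "norm (1 - cscale (g t) T) \<le> 1 - t * c + t\<^sup>2 * M\<^sup>2" if "0 < t" "t \<le> t1" for t
  proof -
    have "t \<le> 1 / (2 * M + 1)" "t \<le> 1 / c" using that by (auto simp: t1_def)
    then have "t * (2 * M + 1) \<le> 1" "t * c \<le> 1" using c M0 by (simp_all add: field_simps)
    then show ?thesis using im_el_bound_norm[OF pos c, of t] that by (simp add: g_def M_def algebra_simps)
  qed
  define t0 where "t0 = min t1 (c / (2 * M\<^sup>2 + 1))"
  have t0: "t0 > 0" using t1 c by (simp add: t0_def add_nonneg_pos)
  have lt: "t * M\<^sup>2 \<le> c / 2" if "0 < t" "t \<le> t0" for t
  proof -
    have "0 < 1 + 2 * M\<^sup>2" by (simp add: add_pos_nonneg)
    moreover have "t \<le> c / (2 * M\<^sup>2 + 1)" using that by (simp add: t0_def)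
    ultimately have "t * (2 * M\<^sup>2 + 1) \<le> c" by (simp add: field_simps)
    then show ?thesis using that by (simp add: algebra_simps)
  qed
  have b2: "norm (1 - cscale (g t) T) \<le> 1 - t * c / 2" if "0 < t" "t \<le> t0" for t
  proof -
    have "t * (t * M\<^sup>2) \<le> t * (c / 2)" using lt[OF that] that by (intro mult_left_mono) auto
    moreover have "t * (t * M\<^sup>2) = t\<^sup>2 * M\<^sup>2" "t * (c / 2) = t * c / 2" by (simp_all add: power2_eq_square)
    moreover have "norm (1 - cscale (g t) T) \<le> 1 - t * c + t\<^sup>2 * M\<^sup>2" using that by (intro b) (simp_all add: t0_def)
    ultimately show ?thesis by linarith
  qed
  then show "\<exists>t0>0. \<forall>t. 0 < t \<and> t \<le> t0 \<longrightarrow> norm (1 - cscale (- \<i> * of_real t) T) \<le> 1 - t * c / 2"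
    using t0 by (auto simp: g_def)
  have lt1: "norm (1 - cscale (g t) T) < 1" if "0 < t" "t \<le> t0" for t
    using b2[OF that] that c by (smt (verit) divide_pos_pos mult_pos_pos)
  have g0: "g t \<noteq> 0" if "0 < t" for t using that by (simp add: g_def)
  have "invertible_el (cscale (g t0) T)" using neumann_series(1)[OF lt1[of t0]] t0 by simp
  then show iT: "invertible_el T" using g0[OF t0] by (simp add: invertible_el_cscale_iff)
  have inv_g: "inverse_el T = cscale (g t) (inverse_el (cscale (g t) T))" if "0 < t" for t
  proof -
    have i: "invertible_el (cscale (g t) T)" using iT g0[OF that] by (simp add: invertible_el_cscale_iff)
    show ?thesis
      by (rule inverse_elI) (use inverse_el[OF i] in \<open>simp_all add: cscale_left_mult cscale_right_mult\<close>)
  qed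
  have "norm (inverse_el T) * (c - t * M\<^sup>2) \<le> 1" if t: "0 < t" "t \<le> t0" for t
  proof -
    let ?n = "norm (1 - cscale (g t) T)"
    have n1: "1 - ?n \<ge> t * (c - t * M\<^sup>2)" using b[of t] t by (simp add: t0_def algebra_simps power2_eq_square)
    have pos': "c - t * M\<^sup>2 > 0" using lt[OF t] c by linarith
    have "norm (inverse_el T) = t * norm (inverse_el (cscale (g t) T))"
      by (subst inv_g[OF t(1)]) (use t in \<open>simp add: norm_cscale g_def norm_mult\<close>)
    also have "\<dots> \<le> t * (1 / (1 - ?n))"
      using neumann_series(2)[OF lt1[OF t]] t by (intro mult_left_mono) auto
    also have "\<dots> \<le> t * (1 / (t * (c - t * M\<^sup>2)))"
      using n1 t pos' by (intro mult_left_mono divide_left_mono) (auto intro!: mult_pos_pos simp: lt1)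
    also have "\<dots> = 1 / (c - t * M\<^sup>2)" using t by simp
    finally show ?thesis using pos' by (simp add: field_simps)
  qed
  then have "\<forall>\<^sub>F t in at_right 0. norm (inverse_el T) * (c - t * M\<^sup>2) \<le> 1"
    unfolding eventually_at_right_field using t0 by (intro exI[of _ t0]) auto
  moreover have "((\<lambda>t. norm (inverse_el T) * (c - t * M\<^sup>2)) \<longlongrightarrow> norm (inverse_el T) * (c - 0 * M\<^sup>2)) (at_right 0)"
    by (intro tendsto_intros)
  ultimately have "norm (inverse_el T) * (c - 0 * M\<^sup>2) \<le> 1"
    by (intro tendsto_upperbound[of _ _ "at_right 0"]) auto
  then show "norm (inverse_el T) \<le> 1 / c" using c by (simp add: field_simps)
  assume V: "subspace V" "\<And>z v. v \<in> V \<Longrightarrow> cscale z v \<in> V" "closed V" "1 \<in> V" "\<And>v. v \<in> V \<Longrightarrow> T * v \<in> V"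
  have "inverse_el (cscale (g t0) T) \<in> V"
    using lt1[of t0] t0 V by (intro inverse_el_in_closed_subspace) (auto simp: cscale_left_mult)
  then show "inverse_el T \<in> V" using inv_g[OF t0] V(2) by simp
qed

text \<open>Spectral values of \<open>H\<close> are reciprocals of spectral values of its inverse,
  hence at least \<open>1 / norm (inverse_el H)\<close>. This turns the norm of the inverse
  imaginary part into the constant \<open>c\<close> of \<open>invertible_of_im_el\<close>.\<close>

lemma inverse_el_lower_bound:
  assumes pos: "positive_el (H::'a::cstar_algebra)" and inv: "invertible_el H"
  shows "positive_el (H - of_real (1 / norm (inverse_el H)))"
proof (rule positive_elI)
  show "adj (H - of_real (1 / norm (inverse_el H))) = H - of_real (1 / norm (inverse_el H))"
    using positive_el_sa[OF pos] by (simp add: adj_diff)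
  fix r assume "complex_of_real r \<in> spectrum_el (H - of_real (1 / norm (inverse_el H)))"
  then have "complex_of_real (r + 1 / norm (inverse_el H)) \<in> spectrum_el H"
    using spectrum_el_add_of_real[of r H "- (1 / norm (inverse_el H))"] by (simp add: algebra_simps)
  define l where "l = r + 1 / norm (inverse_el H)"
  have l: "complex_of_real l \<in> spectrum_el H" using \<open>complex_of_real (r + _) \<in> _\<close> by (simp only: l_def)
  then have "l \<noteq> 0" using inv by (auto simp: zero_in_spectrum_iff)
  moreover have "l \<ge> 0" using positive_elD[OF pos l] .
  ultimately have lp: "l > 0" by simp
  have "complex_of_real (1/l) \<in> spectrum_el (inverse_el H)"
  proof (rule ccontr)
    assume "\<not> ?thesis"
    then have "invertible_el (H * (cscale (- of_real l) (inverse_el H - cscale (of_real (1/l)) 1)))"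
      using inv lp by (intro invertible_el_mult) (auto simp: spectrum_el_def invertible_el_cscale_iff)
    also have "H * (cscale (- of_real l) (inverse_el H - cscale (of_real (1/l)) 1)) = H - cscale (of_real l) 1"
      using lp inverse_el[OF inv]
      by (simp add: right_diff_distrib cscale_diff_right cscale_right_mult cscale_minus_left cscale_cscale)
    finally show False using l by (simp add: spectrum_el_def)
  qed
  from spectrum_el_norm[OF this] have "1 / l \<le> norm (inverse_el H)" using lp by (simp only: norm_of_real)
  then have "1 / norm (inverse_el H) \<le> l" using lp by (smt (verit) divide_le_eq le_divide_eq mult.commute zero_less_divide_1_iff)
  then show "r \<ge> 0" by (simp add: l_def)
qed

section \<open>The Hilbert module norm of a matrix\<close>

text \<open>The algebra-valued inner product of the standard Hilbert module of columns of length
  \<open>k\<close>. Matrices act on it as adjointable operators, and the operator norm of this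
  action is the C*-norm.\<close>

definition vip :: "nat \<Rightarrow> (nat \<Rightarrow> 'a::cstar_algebra) \<Rightarrow> (nat \<Rightarrow> 'a) \<Rightarrow> 'a" where
  "vip k v w = (\<Sum>i<k. adj (v i) * w i)"

definition vnorm :: "nat \<Rightarrow> (nat \<Rightarrow> 'a::cstar_algebra) \<Rightarrow> real" where
  "vnorm k v = sqrt (norm (vip k v v))"

definition act :: "nat \<Rightarrow> (nat \<Rightarrow> nat \<Rightarrow> 'a::cstar_algebra) \<Rightarrow> (nat \<Rightarrow> 'a) \<Rightarrow> nat \<Rightarrow> 'a" where
  "act k X v = (\<lambda>i. \<Sum>j<k. X i j * v j)"

lemma vip_adj: "adj (vip k v w) = vip k w v"
  by (simp add: vip_def adj_sum adj_mult adj_adj)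

lemma positive_vip: "positive_el (vip k v v)"
  unfolding vip_def by (intro positive_el_sum positive_el_adj_mult)

lemma vip_add_right: "vip k v (\<lambda>i. w i + u i) = vip k v w + vip k v u"
  by (simp add: vip_def distrib_left sum.distrib)

lemma vip_add_left: "vip k (\<lambda>i. w i + u i) v = vip k w v + vip k u v"
  by (simp add: vip_def distrib_right adj_add sum.distrib)

lemma vip_cscale: "vip k (\<lambda>i. cscale c (v i)) (\<lambda>i. cscale c (v i)) = (cmod c)\<^sup>2 *\<^sub>R vip k v v"
proof -
  have "c * cnj c = complex_of_real ((cmod c)\<^sup>2)" using complex_norm_square[of c] by simp
  then have "cscale (c * cnj c) y = (cmod c)\<^sup>2 *\<^sub>R y" for y :: 'a by (simp only: cscale_of_real)
  then have "adj (cscale c y) * cscale c y = (cmod c)\<^sup>2 *\<^sub>R (adj y * y)" for y :: 'a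
    by (simp add: adj_cscale cscale_left_mult cscale_right_mult cscale_cscale mult.commute)
  then show ?thesis by (simp add: vip_def scaleR_sum_right)
qed

lemma vip_act_left: "vip k (act k X v) w = vip k v (act k (mat_adj X) w)"
proof -
  have "vip k (act k X v) w = (\<Sum>i<k. \<Sum>j<k. adj (v j) * adj (X i j) * w i)"
    by (simp add: vip_def act_def adj_sum adj_mult sum_distrib_right)
  also have "\<dots> = (\<Sum>j<k. \<Sum>i<k. adj (v j) * adj (X i j) * w i)" by (rule sum.swap)
  also have "\<dots> = vip k v (act k (mat_adj X) w)"
    by (simp add: vip_def act_def mat_adj_def sum_distrib_left mult.assoc)
  finally show ?thesis .
qed

lemma vnorm_nonneg [simp]: "vnorm k v \<ge> 0"
  by (simp add: vnorm_def)

lemma vnorm_square: "(vnorm k v)\<^sup>2 = norm (vip k v v)"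
  by (simp add: vnorm_def)

lemma vnorm_cong: "(\<And>i. i < k \<Longrightarrow> v i = w i) \<Longrightarrow> vnorm k v = vnorm k w"
  by (simp add: vnorm_def vip_def)

lemma vnorm_zero [simp]: "vnorm k (\<lambda>_. 0) = 0"
  by (simp add: vnorm_def vip_def)

lemma vnorm_cscale: "vnorm k (\<lambda>i. cscale c (v i)) = cmod c * vnorm k v"
  by (simp add: vnorm_def vip_cscale real_sqrt_mult)

lemma norm_le_vnorm:
  assumes i: "i < k" shows "norm (v i) \<le> vnorm k v"
proof -
  have "vip k v v - adj (v i) * v i = (\<Sum>j\<in>{..<k} - {i}. adj (v j) * v j)"
    using i by (simp add: vip_def sum_diff1)
  then have "positive_el (vip k v v - adj (v i) * v i)"
    by (simp only:) (intro positive_el_sum positive_el_adj_mult)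
  from norm_mono_positive[OF positive_el_adj_mult this]
  have "(norm (v i))\<^sup>2 \<le> (vnorm k v)\<^sup>2" by (simp add: cstar_identity vnorm_square)
  then show ?thesis by (rule power2_le_imp_le) simp
qed

lemma vip_cauchy_schwarz: "norm (vip k v w) \<le> vnorm k v * vnorm k w"
proof (cases "vnorm k v = 0")
  case True
  then have "v i = 0" if "i < k" for i using norm_le_vnorm[OF that, of v] by simp
  then have "vip k v w = 0" by (simp add: vip_def)
  then show ?thesis by simp
next
  case False
  define t where "t = norm (vip k v v)"
  define a where "a = vip k v w"
  have t: "t > 0" using False by (simp add: t_def vnorm_def)
  \<comment> \<open>Up to sign and scaling, \<open>w\<close> without its component along
    \<open>v\<close>. Positivity of \<open>vip k u u\<close> together with
    \<open>adj a * vip k v v * a <= t adj a * a\<close> leaves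
    \<open>adj a * a <= t vip k w w\<close>.\<close>
  define u where "u = (\<lambda>i. v i * a - t *\<^sub>R w i)"
  have aw: "vip k w v = adj a" by (simp add: a_def vip_adj)
  have "vip k u u = adj a * vip k v v * a - t *\<^sub>R (adj a * vip k v w) - t *\<^sub>R (vip k w v * a) + (t * t) *\<^sub>R vip k w w"
    by (simp add: u_def vip_def sum_distrib_left sum_distrib_right scaleR_sum_right adj_diff adj_mult adj_scaleR
        algebra_simps sum.distrib sum_subtractf)
  then have eq: "vip k u u = adj a * vip k v v * a - (2 * t) *\<^sub>R (adj a * a) + (t * t) *\<^sub>R vip k w w"
    by (simp add: aw a_def[symmetric] algebra_simps scaleR_2 flip: scaleR_scaleR)
  have 1: "positive_el (adj a * vip k v v * a - (2 * t) *\<^sub>R (adj a * a) + (t * t) *\<^sub>R vip k w w)"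
    using positive_vip[of k u] unfolding eq .
  have "positive_el (of_real t - vip k v v)"
    by (rule positive_el_norm_diff) (simp_all add: vip_adj t_def)
  from positive_el_conjugate[OF this, of a]
  have 2: "positive_el (t *\<^sub>R (adj a * a) - adj a * vip k v v * a)"
    by (simp add: algebra_simps of_real_def)
  have "(adj a * vip k v v * a - (2 * t) *\<^sub>R (adj a * a) + (t * t) *\<^sub>R vip k w w)
      + (t *\<^sub>R (adj a * a) - adj a * vip k v v * a) = t *\<^sub>R (t *\<^sub>R vip k w w - adj a * a)"
    by (simp add: algebra_simps scaleR_2 flip: scaleR_scaleR)
  then have "positive_el (t *\<^sub>R (t *\<^sub>R vip k w w - adj a * a))" using positive_el_add[OF 1 2] by simp
  from positive_el_scaleR[OF this, of "1/t"] t have "positive_el (t *\<^sub>R vip k w w - adj a * a)" by simp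
  from norm_mono_positive[OF positive_el_adj_mult this]
  have "(norm a)\<^sup>2 \<le> t * norm (vip k w w)" using t by (simp add: cstar_identity)
  also have "\<dots> = (vnorm k v * vnorm k w)\<^sup>2" by (simp add: t_def power_mult_distrib vnorm_square)
  finally show ?thesis unfolding a_def by (rule power2_le_imp_le) simp
qed

lemma vnorm_triangle: "vnorm k (\<lambda>i. v i + w i) \<le> vnorm k v + vnorm k w"
proof (rule power2_le_imp_le)
  have "(vnorm k (\<lambda>i. v i + w i))\<^sup>2 = norm (vip k v v + vip k w v + (vip k v w + vip k w w))"
    by (simp add: vnorm_square vip_add_left vip_add_right algebra_simps)
  also have "\<dots> \<le> norm (vip k v v) + norm (vip k w v) + (norm (vip k v w) + norm (vip k w w))"
    by (intro norm_triangle_mono order_refl)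
  also have "\<dots> \<le> (vnorm k v)\<^sup>2 + vnorm k w * vnorm k v + (vnorm k v * vnorm k w + (vnorm k w)\<^sup>2)"
    by (simp only: vnorm_square) (intro add_mono vip_cauchy_schwarz order_refl)
  also have "\<dots> = (vnorm k v + vnorm k w)\<^sup>2" by (simp add: power2_eq_square algebra_simps)
  finally show "(vnorm k (\<lambda>i. v i + w i))\<^sup>2 \<le> (vnorm k v + vnorm k w)\<^sup>2" .
qed simp

lemma vnorm_sum: "finite I \<Longrightarrow> vnorm k (\<lambda>i. \<Sum>d\<in>I. u d i) \<le> (\<Sum>d\<in>I. vnorm k (u d))"
proof (induction I rule: finite_induct)
  case (insert x F)
  then show ?case using vnorm_triangle[of k "u x" "\<lambda>i. \<Sum>d\<in>F. u d i"] by simp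
qed simp

lemma act_mat_mult: "act k (mat_mult k X Y) v = act k X (act k Y v)"
proof
  fix i
  have "act k (mat_mult k X Y) v i = (\<Sum>j<k. \<Sum>l<k. X i l * Y l j * v j)"
    by (simp add: act_def mat_mult_def sum_distrib_right)
  also have "\<dots> = (\<Sum>l<k. \<Sum>j<k. X i l * Y l j * v j)" by (rule sum.swap)
  also have "\<dots> = act k X (act k Y v) i" by (simp add: act_def sum_distrib_left mult.assoc)
  finally show "act k (mat_mult k X Y) v i = act k X (act k Y v) i" .
qed

text \<open>The matrix is split into its \<open>k\<close> cyclic diagonals, each of which acts with norm at most \<open>c\<close>.\<close>

lemma vnorm_act_le_entries:
  assumes c: "\<And>i j. i < k \<Longrightarrow> j < k \<Longrightarrow> norm (X i j) \<le> c" and c0: "c \<ge> 0"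
  shows "vnorm k (act k X v) \<le> real k * c * vnorm k v"
proof -
  define \<sigma> where "\<sigma> d i = (i + d) mod k" for d i
  have \<sigma>k: "\<sigma> d i < k" if "i < k" for d i using that by (simp add: \<sigma>_def)
  have le: "y = x" if "x \<le> y" "y < k" "\<sigma> d x = \<sigma> d y" for d x y
  proof -
    have "(y + d) mod k = (x + d) mod k" using that by (simp add: \<sigma>_def)
    then have "k dvd (y + d) - (x + d)" using that by (subst (asm) mod_eq_dvd_iff_nat) auto
    then have "k dvd y - x" by simp
    moreover have "y - x < k" using that by simp
    ultimately show ?thesis using that(1) by (metis dvd_imp_le le_antisym not_less zero_less_diff le_neq_implies_less)
  qed
  have inj: "inj_on (\<sigma> d) {..<k}" for d
    by (rule inj_onI) (metis le lessThan_iff nle_le)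
  have bij: "bij_betw (\<sigma> d) {..<k} {..<k}" for d
    using inj[of d] \<sigma>k endo_inj_surj[of "{..<k}" "\<sigma> d"] by (auto simp: bij_betw_def)
  \<comment> \<open>By the symmetry of \<open>i + d\<close> in its two arguments, each row meets
    every column in exactly one of the diagonals.\<close>
  have bij2: "bij_betw (\<lambda>d. \<sigma> d i) {..<k} {..<k}" for i
    by (rule bij_betw_cong[THEN iffD1, OF _ bij[of i]]) (simp add: \<sigma>_def add.commute)
  define u where "u d i = X i (\<sigma> d i) * v (\<sigma> d i)" for d i
  have "act k X v i = (\<Sum>d<k. u d i)" for i
    unfolding act_def u_def using sum.reindex_bij_betw[OF bij2[of i], of "\<lambda>j. X i j * v j"] by simp
  then have "vnorm k (act k X v) = vnorm k (\<lambda>i. \<Sum>d<k. u d i)" by (intro vnorm_cong)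
  also have "\<dots> \<le> (\<Sum>d<k. vnorm k (u d))" by (rule vnorm_sum) simp
  also have "\<dots> \<le> (\<Sum>d<k. c * vnorm k v)"
  proof (rule sum_mono)
    fix d
    have "vip k (\<lambda>i. v (\<sigma> d i)) (\<lambda>i. v (\<sigma> d i)) = vip k v v"
      unfolding vip_def using sum.reindex_bij_betw[OF bij[of d], of "\<lambda>j. adj (v j) * v j"] by simp
    then have eq: "c\<^sup>2 *\<^sub>R vip k v v - vip k (u d) (u d)
        = (\<Sum>i<k. c\<^sup>2 *\<^sub>R (adj (v (\<sigma> d i)) * v (\<sigma> d i)) - adj (u d i) * u d i)"
      by (simp add: vip_def sum_subtractf flip: scaleR_sum_right)
    have "positive_el (c\<^sup>2 *\<^sub>R vip k v v - vip k (u d) (u d))" unfolding eq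
    proof (rule positive_el_sum)
      fix i assume i: "i \<in> {..<k}"
      let ?x = "X i (\<sigma> d i)" and ?v = "v (\<sigma> d i)"
      have "(norm ?x)\<^sup>2 \<le> c\<^sup>2" using c i \<sigma>k by (simp add: power_mono)
      then have "positive_el ((c\<^sup>2 - (norm ?x)\<^sup>2) *\<^sub>R (adj ?v * ?v))"
        by (intro positive_el_scaleR positive_el_adj_mult) simp
      from positive_el_add[OF this adj_mult_le[of ?x ?v]]
      show "positive_el (c\<^sup>2 *\<^sub>R (adj ?v * ?v) - adj (u d i) * u d i)"
        by (simp add: u_def adj_mult mult.assoc scaleR_diff_left)
    qed
    from norm_mono_positive[OF positive_vip this]
    have "(vnorm k (u d))\<^sup>2 \<le> (c * vnorm k v)\<^sup>2" by (simp add: vnorm_square power_mult_distrib)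
    then show "vnorm k (u d) \<le> c * vnorm k v" by (rule power2_le_imp_le) (simp add: c0)
  qed
  finally show ?thesis by simp
qed

text \<open>One \<open>c\<close> for all sizes: the membership condition of the bounded direct
  sum.\<close>

definition cmat_bounded :: "real \<Rightarrow> (nat \<Rightarrow> nat \<Rightarrow> nat \<Rightarrow> 'a::cstar_algebra) \<Rightarrow> bool" where
  "cmat_bounded c F \<longleftrightarrow> c \<ge> 0 \<and> (\<forall>k v. vnorm k (act k (F k) v) \<le> c * vnorm k v)"

lemma cmat_boundedD: "cmat_bounded c F \<Longrightarrow> vnorm k (act k (F k) v) \<le> c * vnorm k v"
  by (simp add: cmat_bounded_def)

lemma cmat_bounded_zero: "cmat_bounded 0 (\<lambda>k i j. 0)"
  by (simp add: cmat_bounded_def act_def)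

lemma cmat_bounded_add:
  assumes "cmat_bounded c F" "cmat_bounded d G"
  shows "cmat_bounded (c + d) (\<lambda>k. mat_add (F k) (G k))"
  unfolding cmat_bounded_def
proof (intro conjI allI)
  fix k v
  have "act k (mat_add (F k) (G k)) v = (\<lambda>i. act k (F k) v i + act k (G k) v i)"
    by (simp add: act_def mat_add_def distrib_right sum.distrib)
  then have "vnorm k (act k (mat_add (F k) (G k)) v) \<le> vnorm k (act k (F k) v) + vnorm k (act k (G k) v)"
    by (simp only: vnorm_triangle)
  also have "\<dots> \<le> c * vnorm k v + d * vnorm k v" using assms by (intro add_mono cmat_boundedD)
  finally show "vnorm k (act k (mat_add (F k) (G k)) v) \<le> (c + d) * vnorm k v" by (simp add: distrib_right)
qed (use assms in \<open>simp add: cmat_bounded_def\<close>)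

lemma cmat_bounded_scale:
  assumes "cmat_bounded c F"
  shows "cmat_bounded (cmod z * c) (\<lambda>k. mat_scale z (F k))"
  unfolding cmat_bounded_def
proof (intro conjI allI)
  fix k v
  have "act k (mat_scale z (F k)) v = (\<lambda>i. cscale z (act k (F k) v i))"
    by (simp add: act_def mat_scale_def cscale_left_mult cscale_sum_right)
  then have "vnorm k (act k (mat_scale z (F k)) v) = cmod z * vnorm k (act k (F k) v)"
    by (simp only: vnorm_cscale)
  also have "\<dots> \<le> cmod z * (c * vnorm k v)" using assms by (intro mult_left_mono cmat_boundedD) auto
  finally show "vnorm k (act k (mat_scale z (F k)) v) \<le> cmod z * c * vnorm k v" by (simp add: mult.assoc)
qed (use assms in \<open>simp add: cmat_bounded_def\<close>)

lemma mat_diff_eq: "mat_diff X Y = mat_add X (mat_scale (-1) Y)"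
  by (simp add: mat_diff_def mat_add_def mat_scale_def cscale_minus_left)

lemma cmat_bounded_diff:
  assumes "cmat_bounded c F" "cmat_bounded d G"
  shows "cmat_bounded (c + d) (\<lambda>k. mat_diff (F k) (G k))"
  using cmat_bounded_add[OF assms(1) cmat_bounded_scale[OF assms(2), of "-1"]] by (simp add: mat_diff_eq)

lemma cmat_bounded_mult:
  assumes "cmat_bounded c F" "cmat_bounded d G"
  shows "cmat_bounded (c * d) (\<lambda>k. mat_mult k (F k) (G k))"
  unfolding cmat_bounded_def
proof (intro conjI allI)
  fix k v
  have "vnorm k (act k (mat_mult k (F k) (G k)) v) \<le> c * vnorm k (act k (G k) v)"
    unfolding act_mat_mult using assms by (intro cmat_boundedD)
  also have "\<dots> \<le> c * (d * vnorm k v)"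
    using assms by (intro mult_left_mono cmat_boundedD) (auto simp: cmat_bounded_def)
  finally show "vnorm k (act k (mat_mult k (F k) (G k)) v) \<le> c * d * vnorm k v" by (simp add: mult.assoc)
qed (use assms in \<open>simp add: cmat_bounded_def\<close>)

lemma mat_adj_adj: "mat_adj (mat_adj X) = X"
  by (simp add: mat_adj_def adj_adj)

text \<open>As for Hilbert spaces: with \<open>u\<close> the image of \<open>v\<close> under the
  adjoint, the inner product of \<open>u\<close> with itself is that of \<open>v\<close> with
  \<open>F u\<close>, and Cauchy-Schwarz allows one factor \<open>vnorm k u\<close> to be
  cancelled.\<close>

lemma cmat_bounded_adj:
  assumes "cmat_bounded c F"
  shows "cmat_bounded c (\<lambda>k. mat_adj (F k))"
  unfolding cmat_bounded_def
proof (intro conjI allI)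
  show c: "c \<ge> 0" using assms by (simp add: cmat_bounded_def)
  fix k v
  define u where "u = act k (mat_adj (F k)) v"
  have "(vnorm k u)\<^sup>2 = norm (vip k v (act k (F k) u))"
    unfolding vnorm_square by (subst u_def, subst vip_act_left) (simp add: mat_adj_adj u_def)
  also have "\<dots> \<le> vnorm k v * vnorm k (act k (F k) u)" by (rule vip_cauchy_schwarz)
  also have "\<dots> \<le> vnorm k v * (c * vnorm k u)" using assms by (intro mult_left_mono cmat_boundedD) auto
  finally have "vnorm k u * vnorm k u \<le> (c * vnorm k v) * vnorm k u" by (simp add: power2_eq_square mult_ac)
  then have "vnorm k u \<le> c * vnorm k v"
    using c by (cases "vnorm k u = 0") (auto simp: mult_le_cancel_right order.strict_iff_order)
  then show "vnorm k (act k (mat_adj (F k)) v) \<le> c * vnorm k v" by (simp add: u_def)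
qed

lemma cmat_bounded_one: "cmat_bounded 1 mat_one"
  unfolding cmat_bounded_def
proof (intro conjI allI)
  fix k and v :: "nat \<Rightarrow> 'a"
  have "act k (mat_one k) v i = v i" if "i < k" for i
    using that by (simp add: act_def mat_one_def if_distrib[of "\<lambda>x. x * _"] sum.delta cong: if_cong)
  then have "vnorm k (act k (mat_one k) v) = vnorm k v" by (rule vnorm_cong)
  then show "vnorm k (act k (mat_one k) v) \<le> 1 * vnorm k v" by simp
qed simp

lemma is_mat_ops:
  "is_mat k X \<Longrightarrow> is_mat k Y \<Longrightarrow> is_mat k (mat_add X Y)"
  "is_mat k X \<Longrightarrow> is_mat k Y \<Longrightarrow> is_mat k (mat_diff X Y)"
  "is_mat k X \<Longrightarrow> is_mat k (mat_scale c X)"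
  "is_mat k X \<Longrightarrow> is_mat k (mat_adj X)"
  "is_mat k X \<Longrightarrow> is_mat k Y \<Longrightarrow> is_mat k (mat_mult k X Y)"
  "is_mat k (mat_one k)" "is_mat k (mat_diag k s)"
  by (auto simp: is_mat_def mat_add_def mat_diff_def mat_scale_def mat_adj_def mat_mult_def mat_one_def mat_diag_def)

lemma is_mat_eqI:
  "is_mat k X \<Longrightarrow> is_mat k Y \<Longrightarrow> (\<And>i j. i < k \<Longrightarrow> j < k \<Longrightarrow> X i j = Y i j) \<Longrightarrow> X = Y"
  by (intro ext) (metis is_mat_def not_le_imp_less)

lemma mat_mult_assoc: "mat_mult k (mat_mult k X Y) Z = mat_mult k X (mat_mult k Y Z)"
proof (intro ext)
  fix i j
  have "mat_mult k (mat_mult k X Y) Z i j = (\<Sum>l<k. \<Sum>m<k. X i m * Y m l * Z l j)"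
    by (simp add: mat_mult_def sum_distrib_right)
  also have "\<dots> = (\<Sum>m<k. \<Sum>l<k. X i m * Y m l * Z l j)" by (rule sum.swap)
  also have "\<dots> = mat_mult k X (mat_mult k Y Z) i j" by (simp add: mat_mult_def sum_distrib_left mult.assoc)
  finally show "mat_mult k (mat_mult k X Y) Z i j = mat_mult k X (mat_mult k Y Z) i j" .
qed

lemma mat_mult_one:
  assumes "is_mat k X" shows "mat_mult k (mat_one k) X = X" "mat_mult k X (mat_one k) = X"
proof -
  show "mat_mult k (mat_one k) X = X"
    by (rule is_mat_eqI[of k]) (use assms in \<open>auto simp: is_mat_ops\<close>,
      simp add: mat_mult_def mat_one_def if_distrib[of "\<lambda>x. x * _"] sum.delta cong: if_cong)
  show "mat_mult k X (mat_one k) = X"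
    by (rule is_mat_eqI[of k]) (use assms in \<open>auto simp: is_mat_ops\<close>,
      simp add: mat_mult_def mat_one_def if_distrib[of "\<lambda>x. _ * x"] sum.delta' cong: if_cong)
qed

section \<open>The direct sum of all matrix algebras\<close>

text \<open>All matrix algebras \<open>M\<^sub>k(A)\<close> are corners of a single unital C*-algebra, their
\<open>\<ell>\<^sup>\<infinity>\<close>-direct sum over \<open>k\<close>, so that the theory above applies to matrices of any size \<open>k\<close>.\<close>

typedef (overloaded) 'a cmat =
  "{F :: nat \<Rightarrow> nat \<Rightarrow> nat \<Rightarrow> 'a::cstar_algebra. (\<forall>k. is_mat k (F k)) \<and> (\<exists>c. cmat_bounded c F)}"
  morphisms blk Abs_cmat
  using cmat_bounded_zero by (auto simp: is_mat_def intro!: exI[of _ "\<lambda>k i j. 0"])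

setup_lifting type_definition_cmat

lemma is_mat_blk [simp]: "is_mat k (blk F k)"
  using blk[of F] by simp

lemma cmat_eqI: "(\<And>k. blk F k = blk G k) \<Longrightarrow> F = G"
  by (simp add: blk_inject[symmetric] fun_eq_iff)

instantiation cmat :: (cstar_algebra) ring_1
begin

lift_definition zero_cmat :: "'a cmat" is "\<lambda>k i j. 0"
  using cmat_bounded_zero by (auto simp: is_mat_def)

lift_definition one_cmat :: "'a cmat" is mat_one
  using cmat_bounded_one by (auto simp: is_mat_ops)

lift_definition plus_cmat :: "'a cmat \<Rightarrow> 'a cmat \<Rightarrow> 'a cmat" is "\<lambda>F G k. mat_add (F k) (G k)"
  using cmat_bounded_add by (fastforce simp: is_mat_ops)

lift_definition minus_cmat :: "'a cmat \<Rightarrow> 'a cmat \<Rightarrow> 'a cmat" is "\<lambda>F G k. mat_diff (F k) (G k)"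
  using cmat_bounded_diff by (fastforce simp: is_mat_ops)

lift_definition uminus_cmat :: "'a cmat \<Rightarrow> 'a cmat" is "\<lambda>F k. mat_scale (-1) (F k)"
  using cmat_bounded_scale[where z="-1"] by (fastforce simp: is_mat_ops)

lift_definition times_cmat :: "'a cmat \<Rightarrow> 'a cmat \<Rightarrow> 'a cmat" is "\<lambda>F G k. mat_mult k (F k) (G k)"
  using cmat_bounded_mult by (fastforce simp: is_mat_ops)

instance
proof
  fix F G H :: "'a cmat"
  show "F * G * H = F * (G * H)" by transfer (simp add: mat_mult_assoc)
  show "1 * F = F" "F * 1 = F" by (transfer, auto simp: mat_mult_one)+
  show "F + G + H = F + (G + H)" "F + G = G + F" "0 + F = F"
    by (transfer, simp add: mat_add_def add_ac)+
  show "- F + F = 0" "F - G = F + - G"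
    by (transfer, simp add: mat_add_def mat_diff_def mat_scale_def cscale_minus_left)+
  show "(F + G) * H = F * H + G * H" "F * (G + H) = F * G + F * H"
    by (transfer, simp add: mat_add_def mat_mult_def distrib_right distrib_left sum.distrib)+
  \<comment> \<open>The block of size 0 is trivial, so 0 and 1 are separated in the block of size
    1.\<close>
  have "mat_one 1 0 0 \<noteq> (0::'a)" by (simp add: mat_one_def)
  then show "(0::'a cmat) \<noteq> 1" by transfer metis
qed

end

instantiation cmat :: (cstar_algebra) real_algebra_1
begin

lift_definition scaleR_cmat :: "real \<Rightarrow> 'a cmat \<Rightarrow> 'a cmat" is "\<lambda>r F k. mat_scale (of_real r) (F k)"
  using cmat_bounded_scale by (fastforce simp: is_mat_ops)

instance
proof
  fix F G :: "'a cmat" and r s :: real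
  show "r *\<^sub>R (F + G) = r *\<^sub>R F + r *\<^sub>R G"
    by transfer (simp add: mat_scale_def mat_add_def cscale_add_right)
  show "(r + s) *\<^sub>R F = r *\<^sub>R F + s *\<^sub>R F"
    by transfer (simp add: mat_scale_def mat_add_def cscale_add_left)
  show "r *\<^sub>R s *\<^sub>R F = (r * s) *\<^sub>R F" "1 *\<^sub>R F = F"
    by (transfer, simp add: mat_scale_def cscale_cscale)+
  show "r *\<^sub>R F * G = r *\<^sub>R (F * G)" "F * r *\<^sub>R G = r *\<^sub>R (F * G)"
    by (transfer, simp add: mat_scale_def mat_mult_def cscale_left_mult cscale_right_mult cscale_sum_right)+
qed

end

lemma blk_simps:
  "blk 0 k = (\<lambda>i j. 0)" "blk 1 k = mat_one k" "blk (F + G) k = mat_add (blk F k) (blk G k)"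
  "blk (F - G) k = mat_diff (blk F k) (blk G k)" "blk (- F) k = mat_scale (-1) (blk F k)"
  "blk (F * G) k = mat_mult k (blk F k) (blk G k)" "blk (r *\<^sub>R F) k = mat_scale (of_real r) (blk F k)"
  by (transfer, simp)+

definition cmat_norm :: "'a::cstar_algebra cmat \<Rightarrow> real" where
  "cmat_norm F = Inf {c. cmat_bounded c (blk F)}"

lemma cmat_norm_le: "cmat_bounded c (blk F) \<Longrightarrow> cmat_norm F \<le> c"
  unfolding cmat_norm_def by (intro cInf_lower bdd_belowI[of _ 0]) (auto simp: cmat_bounded_def)

text \<open>The infimum is a minimum: for \<open>vnorm k v > 0\<close> the quotient of the two norms
  lies below every admissible bound, and for \<open>vnorm k v = 0\<close> any admissible bound
  forces the image to have norm 0.\<close>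

lemma cmat_bounded_norm: "cmat_bounded (cmat_norm F) (blk F)"
proof -
  let ?S = "{c. cmat_bounded c (blk F)}"
  have ne: "?S \<noteq> {}" using blk[of F] by auto
  have "0 \<le> cmat_norm F" unfolding cmat_norm_def
    using ne by (intro cInf_greatest) (auto simp: cmat_bounded_def)
  moreover have "vnorm k (act k (blk F k) v) \<le> cmat_norm F * vnorm k v" for k v
  proof (cases "vnorm k v = 0")
    case True
    obtain c where "cmat_bounded c (blk F)" using ne by blast
    from cmat_boundedD[OF this, of k v] True show ?thesis by simp
  next
    case False
    then have pos: "vnorm k v > 0" by (simp add: order.strict_iff_order)
    have "vnorm k (act k (blk F k) v) / vnorm k v \<le> cmat_norm F"
      unfolding cmat_norm_def using ne pos
      by (intro cInf_greatest) (auto simp: pos_divide_le_eq dest: cmat_boundedD)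
    then show ?thesis using pos by (simp add: pos_divide_le_eq)
  qed
  ultimately show ?thesis by (simp add: cmat_bounded_def)
qed

text \<open>Applied to the \<open>j\<close>-th unit column, which has norm 1, the matrix shows its
  entry as a coordinate of the image.\<close>

lemma norm_blk_le: "norm (blk F k i j) \<le> cmat_norm F"
proof (cases "i < k \<and> j < k")
  case True
  define \<delta> where "\<delta> l = (if l = j then 1 else 0 :: 'a)" for l
  have "vip k \<delta> \<delta> = 1"
    using True by (simp add: vip_def \<delta>_def if_distrib[of "\<lambda>x. _ * x"] if_distrib[of adj] sum.delta cong: if_cong)
  then have \<delta>: "vnorm k \<delta> = 1" by (simp add: vnorm_def)
  have "act k (blk F k) \<delta> i = blk F k i j"
    using True by (simp add: act_def \<delta>_def if_distrib[of "\<lambda>x. _ * x"] sum.delta cong: if_cong)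
  then have "norm (blk F k i j) \<le> vnorm k (act k (blk F k) \<delta>)"
    using norm_le_vnorm[of i k "act k (blk F k) \<delta>"] True by simp
  also have "\<dots> \<le> cmat_norm F" using cmat_boundedD[OF cmat_bounded_norm, of k F \<delta>] \<delta> by simp
  finally show ?thesis .
next
  case False
  then have "blk F k i j = 0" using is_mat_blk[of k F] by (auto simp: is_mat_def not_less)
  then show ?thesis using cmat_bounded_norm[of F] by (simp add: cmat_bounded_def)
qed

instantiation cmat :: (cstar_algebra) real_normed_algebra_1
begin

definition norm_cmat :: "'a cmat \<Rightarrow> real" where "norm_cmat = cmat_norm"
definition sgn_cmat :: "'a cmat \<Rightarrow> 'a cmat" where "sgn_cmat F = F /\<^sub>R norm F"
definition dist_cmat :: "'a cmat \<Rightarrow> 'a cmat \<Rightarrow> real" where "dist_cmat F G = norm (F - G)"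
definition uniformity_cmat :: "('a cmat \<times> 'a cmat) filter" where
  "uniformity_cmat = (INF e\<in>{0<..}. principal {(x, y). dist x y < e})"
definition open_cmat :: "'a cmat set \<Rightarrow> bool" where
  "open_cmat U \<longleftrightarrow> (\<forall>x\<in>U. eventually (\<lambda>(x', y). x' = x \<longrightarrow> y \<in> U) uniformity)"

instance
proof
  fix F G :: "'a cmat" and r :: real and U :: "'a cmat set"
  show "sgn F = F /\<^sub>R norm F" by (rule sgn_cmat_def)
  show "dist F G = norm (F - G)" by (rule dist_cmat_def)
  show "uniformity = (INF e\<in>{0<..}. principal {(x, y :: 'a cmat). dist x y < e})" by (rule uniformity_cmat_def)
  show "open U \<longleftrightarrow> (\<forall>x\<in>U. eventually (\<lambda>(x', y). x' = x \<longrightarrow> y \<in> U) uniformity)" by (rule open_cmat_def)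
  show "norm F = 0 \<longleftrightarrow> F = 0"
  proof
    assume "norm F = 0"
    then have "norm (blk F k i j) \<le> 0" for k i j using norm_blk_le[of F k i j] by (simp add: norm_cmat_def)
    then show "F = 0" by (intro cmat_eqI) (auto simp: blk_simps fun_eq_iff)
  next
    assume "F = 0"
    moreover have "blk (0::'a cmat) = (\<lambda>k i j. 0)" by (simp add: blk_simps fun_eq_iff)
    ultimately have "cmat_norm F \<le> 0" using cmat_norm_le[of 0 F] cmat_bounded_zero by simp
    then show "norm F = 0" using cmat_bounded_norm[of F] by (simp add: norm_cmat_def cmat_bounded_def)
  qed
  have blk_plus: "blk (F + G) = (\<lambda>k. mat_add (blk F k) (blk G k))" by (simp add: blk_simps fun_eq_iff)
  show "norm (F + G) \<le> norm F + norm G"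
    unfolding norm_cmat_def by (intro cmat_norm_le, unfold blk_plus) (intro cmat_bounded_add cmat_bounded_norm)
  have blk_times: "blk (F * G) = (\<lambda>k. mat_mult k (blk F k) (blk G k))" by (simp add: blk_simps fun_eq_iff)
  show "norm (F * G) \<le> norm F * norm G"
    unfolding norm_cmat_def by (intro cmat_norm_le, unfold blk_times) (intro cmat_bounded_mult cmat_bounded_norm)
  have le: "norm (s *\<^sub>R H) \<le> \<bar>s\<bar> * norm H" for s and H :: "'a cmat"
  proof -
    have blk_scale: "blk (s *\<^sub>R H) = (\<lambda>k. mat_scale (of_real s) (blk H k))" by (simp add: blk_simps fun_eq_iff)
    show ?thesis unfolding norm_cmat_def
      by (intro cmat_norm_le, unfold blk_scale)
         (use cmat_bounded_scale[OF cmat_bounded_norm[of H], of "of_real s"] in simp)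
  qed
  show "norm (r *\<^sub>R F) = \<bar>r\<bar> * norm F"
  proof (cases "r = 0")
    case True
    have "norm (0 *\<^sub>R F) \<le> 0" using le[of 0 F] by simp
    then show ?thesis using True cmat_bounded_norm[of "0 *\<^sub>R F"] by (simp add: norm_cmat_def cmat_bounded_def)
  next
    case False
    have "norm F \<le> \<bar>1/r\<bar> * norm (r *\<^sub>R F)" using le[of "1/r" "r *\<^sub>R F"] False by simp
    then have "\<bar>r\<bar> * norm F \<le> norm (r *\<^sub>R F)" using False by (simp add: field_simps)
    then show ?thesis using le[of r F] by simp
  qed
  have "blk (1::'a cmat) = mat_one" by (simp add: blk_simps fun_eq_iff)
  then have "norm (1::'a cmat) \<le> 1" unfolding norm_cmat_def by (intro cmat_norm_le) (simp add: cmat_bounded_one)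
  moreover have "norm (blk (1::'a cmat) 1 0 0) \<le> norm (1::'a cmat)" unfolding norm_cmat_def by (rule norm_blk_le)
  ultimately show "norm (1::'a cmat) = 1" by (simp add: blk_simps mat_one_def)
qed

end

lemma norm_blk: "norm (blk F k i j) \<le> norm F"
  using norm_blk_le by (simp add: norm_cmat_def)

lemma vnorm_act_blk: "vnorm k (act k (blk F k) v) \<le> norm F * vnorm k v"
  using cmat_boundedD[OF cmat_bounded_norm] by (simp add: norm_cmat_def)

lemma bounded_linear_blk: "bounded_linear (\<lambda>F. blk F k i j)"
  by (rule bounded_linear_intro[where K=1])
     (simp_all add: blk_simps mat_add_def mat_scale_def cscale_of_real norm_blk)

instance cmat :: (cstar_algebra) banach
proof
  fix X :: "nat \<Rightarrow> 'a cmat" assume X: "Cauchy X"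
  have "Cauchy (\<lambda>n. blk (X n) k i j)" for k i j
    using bounded_linear.Cauchy[OF bounded_linear_blk X] .
  then have "convergent (\<lambda>n. blk (X n) k i j)" for k i j by (rule Cauchy_convergent)
  then obtain L where L: "\<And>k i j. (\<lambda>n. blk (X n) k i j) \<longlonglongrightarrow> L k i j"
    unfolding convergent_def by metis
  have "blk (X n) k i j = 0" if "k \<le> i \<or> k \<le> j" for n k i j
    using is_mat_blk[of k "X n"] that by (auto simp: is_mat_def)
  then have "L k i j = 0" if "k \<le> i \<or> k \<le> j" for k i j
    using L[of k i j] that by (simp add: LIMSEQ_const_iff)
  then have matL: "is_mat k (L k)" for k by (auto simp: is_mat_def)
  \<comment> \<open>Entrywise limits carry no uniformity in \<open>k\<close>. The Cauchy estimate is
    therefore passed to the limit for each \<open>k\<close> and \<open>v\<close> separately, with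
    \<open>e\<close> fixed beforehand.\<close>
  have bnd: "\<exists>N. \<forall>n\<ge>N. cmat_bounded e (\<lambda>k. mat_diff (blk (X n) k) (L k))" if e: "e > 0" for e
  proof -
    obtain N where N: "\<And>m n. m \<ge> N \<Longrightarrow> n \<ge> N \<Longrightarrow> norm (X n - X m) < e"
      using CauchyD[OF X e] by blast
    have "cmat_bounded e (\<lambda>k. mat_diff (blk (X n) k) (L k))" if n: "n \<ge> N" for n
      unfolding cmat_bounded_def
    proof (intro conjI allI)
      fix k v
      have "(\<lambda>m. act k (blk (X n - X m) k) v i) \<longlonglongrightarrow> act k (mat_diff (blk (X n) k) (L k)) v i" for i
        unfolding act_def blk_simps mat_diff_def by (intro tendsto_intros L)
      then have "(\<lambda>m. vnorm k (act k (blk (X n - X m) k) v)) \<longlonglongrightarrow> vnorm k (act k (mat_diff (blk (X n) k) (L k)) v)"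
        unfolding vnorm_def vip_def
        by (intro tendsto_intros bounded_linear.tendsto[OF bounded_linear_adj])
      moreover have "vnorm k (act k (blk (X n - X m) k) v) \<le> e * vnorm k v" if "m \<ge> N" for m
        using vnorm_act_blk[of k "X n - X m" v] N[OF that n] by (meson less_imp_le mult_right_mono order_trans vnorm_nonneg)
      ultimately show "vnorm k (act k (mat_diff (blk (X n) k) (L k)) v) \<le> e * vnorm k v"
        by (intro LIMSEQ_le_const2) auto
    qed (use e in simp)
    then show ?thesis by blast
  qed
  obtain N where N: "cmat_bounded 1 (\<lambda>k. mat_diff (blk (X N) k) (L k))" using bnd[of 1] by auto
  have "(\<lambda>k. mat_diff (blk (X N) k) (mat_diff (blk (X N) k) (L k))) = L"
    by (simp add: mat_diff_def fun_eq_iff)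
  with cmat_bounded_diff[OF cmat_bounded_norm[of "X N"] N] have "cmat_bounded (cmat_norm (X N) + 1) L" by simp
  then have bL: "blk (Abs_cmat L) = L" using matL by (intro Abs_cmat_inverse) auto
  have "X \<longlonglongrightarrow> Abs_cmat L"
  proof (rule LIMSEQ_I)
    fix e :: real assume "e > 0"
    then obtain N where N: "\<And>n. n \<ge> N \<Longrightarrow> cmat_bounded (e/2) (\<lambda>k. mat_diff (blk (X n) k) (L k))"
      using bnd[of "e/2"] by auto
    have "norm (X n - Abs_cmat L) < e" if "n \<ge> N" for n
    proof -
      have "blk (X n - Abs_cmat L) = (\<lambda>k. mat_diff (blk (X n) k) (L k))"
        by (simp add: blk_simps bL fun_eq_iff)
      then have "norm (X n - Abs_cmat L) \<le> e/2"
        unfolding norm_cmat_def using N[OF that] by (intro cmat_norm_le) simp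
      then show ?thesis using \<open>e > 0\<close> by simp
    qed
    then show "\<exists>N. \<forall>n\<ge>N. norm (X n - Abs_cmat L) < e" by blast
  qed
  then show "convergent X" by (rule convergentI)
qed

instantiation cmat :: (cstar_algebra) cstar_algebra
begin

lift_definition adj_cmat :: "'a cmat \<Rightarrow> 'a cmat" is "\<lambda>F k. mat_adj (F k)"
  using cmat_bounded_adj by (fastforce simp: is_mat_ops)

lift_definition cscale_cmat :: "complex \<Rightarrow> 'a cmat \<Rightarrow> 'a cmat" is "\<lambda>c F k. mat_scale c (F k)"
  using cmat_bounded_scale by (fastforce simp: is_mat_ops)

lemma blk_adj: "blk (adj F) k = mat_adj (blk F k)"
  by transfer simp

lemma blk_cscale: "blk (cscale c F) k = mat_scale c (blk F k)"
  by transfer simp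

instance
proof
  fix F G :: "'a cmat" and a b c :: complex and r :: real
  show "adj (adj F) = F" by transfer (simp add: mat_adj_def adj_adj)
  show "adj (F + G) = adj F + adj G" by transfer (simp add: mat_adj_def mat_add_def adj_add)
  show "adj (F * G) = adj G * adj F" by transfer (simp add: mat_adj_def mat_mult_def adj_sum adj_mult)
  show "adj (cscale c F) = cscale (cnj c) (adj F)" by transfer (simp add: mat_adj_def mat_scale_def adj_cscale)
  show "cscale (complex_of_real r) F = r *\<^sub>R F" by transfer simp
  show "cscale (a + b) F = cscale a F + cscale b F"
    by transfer (simp add: mat_scale_def mat_add_def cscale_add_left)
  show "cscale a (F + G) = cscale a F + cscale a G"
    by transfer (simp add: mat_scale_def mat_add_def cscale_add_right)
  show "cscale a (cscale b F) = cscale (a * b) F" by transfer (simp add: mat_scale_def cscale_cscale)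
  show "cscale a F * G = cscale a (F * G)" "F * cscale a G = cscale a (F * G)"
    by (transfer, simp add: mat_scale_def mat_mult_def cscale_left_mult cscale_right_mult cscale_sum_right)+
  have le: "norm (cscale z H) \<le> cmod z * norm H" for z and H :: "'a cmat"
  proof -
    have "blk (cscale z H) = (\<lambda>k. mat_scale z (blk H k))" by (simp add: blk_cscale fun_eq_iff)
    then show ?thesis unfolding norm_cmat_def
      using cmat_bounded_scale[OF cmat_bounded_norm[of H], of z] by (intro cmat_norm_le) simp
  qed
  show "norm (cscale a F) = cmod a * norm F"
  proof (cases "a = 0")
    case True
    then show ?thesis using le[of 0 F] by simp
  next
    case False
    have "cscale (1/a) (cscale a F) = F" using False by transfer (simp add: mat_scale_def cscale_cscale)
    then have "norm F \<le> cmod (1/a) * norm (cscale a F)" using le[of "1/a" "cscale a F"] by simp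
    then have "cmod a * norm F \<le> norm (cscale a F)" using False by (simp add: norm_divide field_simps)
    then show ?thesis using le[of a F] by simp
  qed
  have adj_le: "norm (adj H) \<le> norm H" for H :: "'a cmat"
  proof -
    have "blk (adj H) = (\<lambda>k. mat_adj (blk H k))" by (simp add: blk_adj fun_eq_iff)
    then show ?thesis unfolding norm_cmat_def
      using cmat_bounded_adj[OF cmat_bounded_norm[of H]] by (intro cmat_norm_le) simp
  qed
  have "norm (adj F * F) \<le> norm (adj F) * norm F" by (rule norm_mult_ineq)
  also have "\<dots> \<le> norm F * norm F" by (intro mult_right_mono adj_le) simp
  finally have up: "norm (adj F * F) \<le> (norm F)\<^sup>2" by (simp add: power2_eq_square)
  \<comment> \<open>The nontrivial half of the C*-identity: the squared norm of \<open>F v\<close>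
    is the norm of the inner product of \<open>v\<close> with \<open>adj F * F\<close> applied to
    \<open>v\<close>.\<close>
  have "cmat_bounded (sqrt (norm (adj F * F))) (blk F)"
    unfolding cmat_bounded_def
  proof (intro conjI allI)
    fix k v
    have "(vnorm k (act k (blk F k) v))\<^sup>2 = norm (vip k v (act k (blk (adj F * F) k) v))"
      unfolding vnorm_square vip_act_left by (simp add: blk_adj blk_simps act_mat_mult)
    also have "\<dots> \<le> vnorm k v * vnorm k (act k (blk (adj F * F) k) v)" by (rule vip_cauchy_schwarz)
    also have "\<dots> \<le> vnorm k v * (norm (adj F * F) * vnorm k v)"
      by (intro mult_left_mono vnorm_act_blk) simp
    also have "\<dots> = (sqrt (norm (adj F * F)) * vnorm k v)\<^sup>2"
      by (simp add: power_mult_distrib) (simp add: power2_eq_square)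
    finally show "vnorm k (act k (blk F k) v) \<le> sqrt (norm (adj F * F)) * vnorm k v"
      by (rule power2_le_imp_le) simp
  qed simp
  then have "norm F \<le> sqrt (norm (adj F * F))" unfolding norm_cmat_def by (rule cmat_norm_le)
  then have "(norm F)\<^sup>2 \<le> norm (adj F * F)" by (metis norm_ge_zero power_mono real_sqrt_pow2)
  with up show "norm (adj F * F) = (norm F)\<^sup>2" by simp
qed

end

section \<open>Transfer to matrices\<close>

text \<open>Truncation makes the embedding total, so that the rules \<open>emb_ops\<close> hold for
  arbitrary index functions.\<close>

definition cut :: "nat \<Rightarrow> (nat \<Rightarrow> nat \<Rightarrow> 'a::cstar_algebra) \<Rightarrow> nat \<Rightarrow> nat \<Rightarrow> 'a" where
  "cut k X = (\<lambda>i j. if i < k \<and> j < k then X i j else 0)"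

lemma cut_is_mat [simp]: "is_mat k X \<Longrightarrow> cut k X = X"
  by (auto simp: cut_def is_mat_def fun_eq_iff not_less)

lemma act_cut: "i < k \<Longrightarrow> act k (cut k X) v i = act k X v i"
  by (simp add: act_def cut_def)

lemma cmat_bounded_single:
  assumes "\<And>v. vnorm k (act k X v) \<le> c * vnorm k v" "c \<ge> 0"
  shows "cmat_bounded c (\<lambda>l. if l = k then cut k X else (\<lambda>_ _. 0))"
  unfolding cmat_bounded_def
proof (intro conjI allI)
  fix l v
  have "vnorm k (act k (cut k X) v) = vnorm k (act k X v)" by (rule vnorm_cong) (rule act_cut)
  moreover have "act l (\<lambda>_ _. 0) v = (\<lambda>_. 0)" by (simp add: act_def)
  ultimately show "vnorm l (act l (if l = k then cut k X else (\<lambda>_ _. 0)) v) \<le> c * vnorm l v"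
    using assms by simp
qed (rule assms)

lemma ex_entry_bound:
  fixes X :: "nat \<Rightarrow> nat \<Rightarrow> 'a::real_normed_vector"
  shows "\<exists>c\<ge>0. \<forall>i<k. \<forall>j<k. norm (X i j) \<le> c"
proof -
  let ?c = "\<Sum>i<k. \<Sum>j<k. norm (X i j)"
  have "norm (X i j) \<le> ?c" if "i < k" "j < k" for i j
  proof -
    have "norm (X i j) \<le> (\<Sum>j<k. norm (X i j))" using that by (intro member_le_sum) auto
    also have "\<dots> \<le> ?c" using that by (intro member_le_sum[of i]) (auto intro: sum_nonneg)
    finally show ?thesis .
  qed
  then show ?thesis by (intro exI[of _ ?c]) (auto intro!: sum_nonneg)
qed

lift_definition emb :: "nat \<Rightarrow> (nat \<Rightarrow> nat \<Rightarrow> 'a::cstar_algebra) \<Rightarrow> 'a cmat" is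
  "\<lambda>k X l. if l = k then cut k X else (\<lambda>_ _. 0)"
proof (intro conjI allI)
  fix k l :: nat and X :: "nat \<Rightarrow> nat \<Rightarrow> 'a"
  show "is_mat l (if l = k then cut k X else (\<lambda>_ _. 0))" by (auto simp: is_mat_def cut_def)
  obtain c where c: "c \<ge> 0" "\<And>i j. i < k \<Longrightarrow> j < k \<Longrightarrow> norm (X i j) \<le> c" using ex_entry_bound[of k X] by blast
  have "cmat_bounded (real k * c) (\<lambda>l. if l = k then cut k X else (\<lambda>_ _. 0))"
    by (rule cmat_bounded_single) (use c vnorm_act_le_entries[OF c(2) c(1)] in auto)
  then show "\<exists>c. cmat_bounded c (\<lambda>l. if l = k then cut k X else (\<lambda>_ _. 0))" by blast
qed

lemma blk_emb: "blk (emb k X) l = (if l = k then cut k X else (\<lambda>_ _. 0))"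
  by transfer simp

lemma norm_emb_le:
  assumes "\<And>v. vnorm k (act k X v) \<le> c * vnorm k v" "c \<ge> 0"
  shows "norm (emb k X) \<le> c"
proof -
  have "blk (emb k X) = (\<lambda>l. if l = k then cut k X else (\<lambda>_ _. 0))" by (simp add: blk_emb fun_eq_iff)
  then show ?thesis unfolding norm_cmat_def using cmat_bounded_single[OF assms] by (intro cmat_norm_le) simp
qed

lemma norm_emb_blk_le: "norm (emb k (blk F k)) \<le> norm F"
  by (rule norm_emb_le) (auto intro: vnorm_act_blk)

lemma norm_emb_entries_le:
  assumes "\<And>i j. i < k \<Longrightarrow> j < k \<Longrightarrow> norm (X i j) \<le> c" "c \<ge> 0"
  shows "norm (emb k X) \<le> real k * c"
  by (rule norm_emb_le) (use assms vnorm_act_le_entries[OF assms] in auto)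

lemma norm_entry_le_emb: "i < k \<Longrightarrow> j < k \<Longrightarrow> norm (X i j) \<le> norm (emb k X)"
  using norm_blk[of "emb k X" k i j] by (simp add: blk_emb cut_def)

text \<open>The embedding is multiplicative but not unital: \<open>emb k (mat_one k)\<close> is the
  projection onto the corner and takes the place of 1 in identities between embedded
  matrices.\<close>

lemma emb_ops:
  "emb k (mat_add X Y) = emb k X + emb k Y" "emb k (mat_diff X Y) = emb k X - emb k Y"
  "emb k (mat_scale c X) = cscale c (emb k X)" "emb k (mat_adj X) = adj (emb k X)"
  "emb k (mat_mult k X Y) = emb k X * emb k Y"
  by (rule cmat_eqI, auto simp: blk_emb blk_simps blk_adj blk_cscale cut_def mat_add_def mat_diff_def
      mat_scale_def mat_adj_def mat_mult_def fun_eq_iff intro!: sum.cong)+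

text \<open>The spectrum of \<open>ext k d X\<close> is that of \<open>X\<close> together with \<open>d\<close>, so that for suitable \<open>d\<close> invertibility
and positivity in the corner \<open>M\<^sub>k(A)\<close> can be tested in the unital direct sum.\<close>

definition ext :: "nat \<Rightarrow> complex \<Rightarrow> (nat \<Rightarrow> nat \<Rightarrow> 'a::cstar_algebra) \<Rightarrow> 'a cmat" where
  "ext k d X = emb k X + cscale d (1 - emb k (mat_one k))"

lemma blk_ext:
  "is_mat k X \<Longrightarrow> blk (ext k d X) l = (if l = k then X else mat_scale d (mat_one l))"
  by (auto simp: ext_def blk_simps blk_emb blk_cscale mat_add_def mat_scale_def mat_diff_def is_mat_ops fun_eq_iff)

lemma ext_mult:
  assumes "is_mat k X" "is_mat k Y"
  shows "ext k c X * ext k d Y = ext k (c * d) (mat_mult k X Y)"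
proof (rule cmat_eqI)
  fix l
  have "mat_mult l (mat_scale c (mat_one l)) (mat_scale d (mat_one l)) = (mat_scale (c * d) (mat_one l) :: nat \<Rightarrow> nat \<Rightarrow> 'a)"
  proof -
    have "mat_mult l (mat_scale c (mat_one l)) (mat_scale d (mat_one l))
      = (mat_scale (c * d) (mat_mult l (mat_one l) (mat_one l)) :: nat \<Rightarrow> nat \<Rightarrow> 'a)"
      by (simp add: mat_mult_def mat_scale_def cscale_left_mult cscale_right_mult cscale_cscale cscale_sum_right
          mult.commute)
    then show ?thesis by (simp add: mat_mult_one is_mat_ops)
  qed
  then show "blk (ext k c X * ext k d Y) l = blk (ext k (c * d) (mat_mult k X Y)) l"
    using assms by (simp add: blk_simps blk_ext is_mat_ops)
qed

lemma ext_one: "ext k 1 (mat_one k) = 1"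
  by (simp add: ext_def)

lemma ext_diff: "ext k c X - ext k d Y = ext k (c - d) (mat_diff X Y)"
  by (simp add: ext_def emb_ops cscale_diff_left)

lemma ext_scale: "cscale c (ext k d X) = ext k (c * d) (mat_scale c X)"
  by (simp add: ext_def emb_ops cscale_add_right cscale_cscale)

lemma ext_zero: "ext k 0 X = emb k X"
  by (simp add: ext_def)

lemma adj_emb_one: "adj (emb k (mat_one k)) = emb k (mat_one k)"
proof -
  have "mat_adj (mat_one k) = mat_one k" by (auto simp: mat_adj_def mat_one_def fun_eq_iff)
  then show ?thesis by (metis emb_ops(4))
qed

lemma ext_adj: "adj (ext k d X) = ext k (cnj d) (mat_adj X)"
  by (simp add: ext_def emb_ops adj_add adj_cscale adj_diff adj_emb_one)

lemma mat_invertible_iff_ext: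
  assumes X: "is_mat k X" and d: "d \<noteq> 0"
  shows "mat_invertible k X \<longleftrightarrow> invertible_el (ext k d X)"
proof
  assume "mat_invertible k X"
  then obtain Y where Y: "is_mat k Y" "mat_mult k X Y = mat_one k" "mat_mult k Y X = mat_one k"
    by (auto simp: mat_invertible_def)
  then have "ext k d X * ext k (1/d) Y = 1" "ext k (1/d) Y * ext k d X = 1"
    using X d by (simp_all add: ext_mult ext_one)
  then show "invertible_el (ext k d X)" by (rule inverse_elI)
next
  assume "invertible_el (ext k d X)"
  from inverse_el[OF this]
  have "blk (ext k d X * inverse_el (ext k d X)) k = mat_one k" "blk (inverse_el (ext k d X) * ext k d X) k = mat_one k"
    by (simp_all add: blk_simps)
  then show "mat_invertible k X" unfolding mat_invertible_def
    by (intro exI[of _ "blk (inverse_el (ext k d X)) k"]) (simp add: blk_simps(6) blk_ext X)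
qed

lemma mat_inverse_unique:
  assumes "is_mat k Y" "mat_mult k X Y = mat_one k" "mat_mult k Y X = mat_one k"
  shows "mat_inverse k X = Y"
  unfolding mat_inverse_def
proof (rule the_equality)
  fix Z assume "is_mat k Z \<and> mat_mult k X Z = mat_one k \<and> mat_mult k Z X = mat_one k"
  then show "Z = Y" using assms by (metis mat_mult_assoc mat_mult_one)
qed (use assms in blast)

lemma mat_inverse:
  assumes "mat_invertible k X"
  shows "is_mat k (mat_inverse k X)" "mat_mult k X (mat_inverse k X) = mat_one k"
    "mat_mult k (mat_inverse k X) X = mat_one k"
  using assms mat_inverse_unique unfolding mat_invertible_def by metis+

lemma inverse_ext:
  assumes X: "is_mat k X" and d: "d \<noteq> 0" and i: "mat_invertible k X"
  shows "inverse_el (ext k d X) = ext k (1/d) (mat_inverse k X)"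
  by (rule inverse_elI(2)) (use X d mat_inverse[OF i] in \<open>simp_all add: ext_mult ext_one\<close>)

lemma spectrum_ext:
  assumes X: "is_mat k X"
  shows "spectrum_el (ext k d X) = insert d (mat_spectrum k X)"
proof -
  have e: "ext k d X - cscale c 1 = ext k (d - c) (mat_diff X (mat_scale c (mat_one k)))" for c
    unfolding ext_one[of k, symmetric] ext_scale ext_diff by simp
  have m: "is_mat k (mat_diff X (mat_scale c (mat_one k)))" for c using X by (simp add: is_mat_ops)
  \<comment> \<open>For \<open>c = d\<close> the shifted element vanishes on every block other than
    \<open>k\<close>; the block \<open>Suc k\<close>, which has positive size, shows that it is not
    invertible.\<close>
  have n: "\<not> invertible_el (ext k 0 Y)" if "is_mat k Y" for Y :: "nat \<Rightarrow> nat \<Rightarrow> 'a"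
  proof
    assume "invertible_el (ext k 0 Y)"
    from inverse_el(1)[OF this] have "blk (ext k 0 Y * inverse_el (ext k 0 Y)) (Suc k) = mat_one (Suc k)"
      by (simp add: blk_simps)
    then have "(0::'a) = mat_one (Suc k) 0 0"
      using that by (simp add: blk_simps(6) blk_ext mat_mult_def mat_scale_def fun_eq_iff)
    then show False by (simp add: mat_one_def)
  qed
  have "c \<in> spectrum_el (ext k d X) \<longleftrightarrow> c = d \<or> c \<in> mat_spectrum k X" for c
    using n[OF m] mat_invertible_iff_ext[OF m, of "d - c" c]
    by (cases "c = d") (auto simp: spectrum_el_def e mat_spectrum_def)
  then show ?thesis by auto
qed

lemma mat_positive_iff_ext:
  assumes X: "is_mat k X" and d: "d \<ge> 0"
  shows "mat_positive k X \<longleftrightarrow> positive_el (ext k (complex_of_real d) X)"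
proof -
  have "adj (ext k (of_real d) X) = ext k (of_real d) X \<longleftrightarrow> mat_adj X = X"
  proof
    assume "adj (ext k (of_real d) X) = ext k (of_real d) X"
    then have "ext k (of_real d) (mat_adj X) = ext k (of_real d) X" by (simp add: ext_adj)
    then have "blk (ext k (of_real d) (mat_adj X)) k = blk (ext k (of_real d) X) k" by simp
    then show "mat_adj X = X" using X by (simp add: blk_ext is_mat_ops)
  qed (simp add: ext_adj)
  then show ?thesis using X d
    by (auto simp: mat_positive_def positive_el_def spectrum_ext)
qed

text \<open>For \<open>Z = mat_mult k (mat_adj X) X\<close> the norm is, up to sign, a spectral
  value and bounds all the others, so the supremum in \<open>mat_norm\<close> is the squared norm of
  \<open>emb k X\<close>. The embedding adds 0 to the spectrum, which matters only if
  \<open>Z = 0\<close>.\<close>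

lemma mat_norm_eq:
  assumes X: "is_mat k X" and k: "k \<ge> 1"
  shows "mat_norm k X = norm (emb k X)"
proof -
  define Z where "Z = mat_mult k (mat_adj X) X"
  have Z: "is_mat k Z" using X by (simp add: Z_def is_mat_ops)
  have eZ: "emb k Z = adj (emb k X) * emb k X" by (simp add: Z_def emb_ops)
  have nZ: "norm (emb k Z) = (norm (emb k X))\<^sup>2" by (simp add: eZ cstar_identity)
  have sp: "spectrum_el (emb k Z) = insert 0 (mat_spectrum k Z)" using spectrum_ext[OF Z, of 0] by (simp add: ext_zero)
  have "Sup (cmod ` mat_spectrum k Z) = norm (emb k Z)"
  proof (rule cSup_eq_maximum)
    fix r assume "r \<in> cmod ` mat_spectrum k Z"
    then show "r \<le> norm (emb k Z)" using sp spectrum_el_norm[of _ "emb k Z"] by auto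
  next
    show "norm (emb k Z) \<in> cmod ` mat_spectrum k Z"
    \<comment> \<open>For \<open>Z = 0\<close> the value 0 has to be found in the spectrum taken
      inside the corner; there \<open>k >= 1\<close> guarantees that the zero matrix is not
      invertible.\<close>
    proof (cases "emb k Z = 0")
      case True
      have "blk (emb k Z) k = blk 0 k" using True by simp
      then have "Z = (\<lambda>i j. 0)" using Z by (simp add: blk_emb blk_simps)
      then have "0 \<in> mat_spectrum k Z"
        using k by (auto simp: mat_spectrum_def mat_invertible_def mat_mult_def mat_diff_def mat_scale_def mat_one_def fun_eq_iff
            intro: exI[of _ 0])
      then show ?thesis using True by force
    next
      case False
      have sa: "adj (emb k Z) = emb k Z" by (simp add: eZ adj_mult adj_adj)
      have "complex_of_real (norm (emb k Z)) \<in> mat_spectrum k Z \<or> complex_of_real (- norm (emb k Z)) \<in> mat_spectrum k Z"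
        using norm_in_spectrum_sa[OF sa] sp False by auto
      then show ?thesis
      proof (elim disjE)
        show "norm (emb k Z) \<in> cmod ` mat_spectrum k Z"
          if "complex_of_real (norm (emb k Z)) \<in> mat_spectrum k Z" using that by (rule rev_image_eqI) simp
        show "norm (emb k Z) \<in> cmod ` mat_spectrum k Z"
          if "complex_of_real (- norm (emb k Z)) \<in> mat_spectrum k Z" using that by (rule rev_image_eqI) simp
      qed
    qed
  qed
  then show ?thesis by (simp add: mat_norm_def Z_def[symmetric] nZ)
qed

text \<open>Through this equivalence the case \<open>k = 1\<close> of complete positivity gives
  positivity of \<open>E\<close> on the algebra.\<close>

lemma positive_el_iff_mat_positive: "positive_el a \<longleftrightarrow> mat_positive 1 (mat_diag 1 a)"
proof -
  have inv: "mat_invertible 1 (mat_diag 1 x) \<longleftrightarrow> invertible_el x" for x :: 'a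
  proof
    assume "mat_invertible 1 (mat_diag 1 x)"
    then obtain Y where "mat_mult 1 (mat_diag 1 x) Y = mat_one 1" "mat_mult 1 Y (mat_diag 1 x) = mat_one 1"
      by (auto simp: mat_invertible_def)
    then have "mat_mult 1 (mat_diag 1 x) Y 0 0 = mat_one 1 0 0" "mat_mult 1 Y (mat_diag 1 x) 0 0 = mat_one 1 0 0"
      by simp_all
    then have "x * Y 0 0 = 1" "Y 0 0 * x = 1" by (simp_all add: mat_mult_def mat_diag_def mat_one_def)
    then show "invertible_el x" by (rule inverse_elI)
  next
    assume "invertible_el x"
    from inverse_el[OF this] show "mat_invertible 1 (mat_diag 1 x)"
      by (auto simp: mat_invertible_def mat_mult_def mat_diag_def mat_one_def is_mat_def fun_eq_iff
          intro!: exI[of _ "mat_diag 1 (inverse_el x)"])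
  qed
  have "mat_diff (mat_diag 1 a) (mat_scale c (mat_one 1)) = mat_diag 1 (a - cscale c 1)" for c
    by (auto simp: mat_diff_def mat_diag_def mat_scale_def mat_one_def fun_eq_iff)
  then have "mat_spectrum 1 (mat_diag 1 a) = spectrum_el a"
    by (simp only: mat_spectrum_def spectrum_el_def inv)
  moreover have "mat_adj (mat_diag 1 a) = mat_diag 1 a \<longleftrightarrow> adj a = a"
    by (auto simp: mat_adj_def mat_diag_def fun_eq_iff)
  ultimately show ?thesis by (auto simp: mat_positive_def positive_el_def is_mat_ops)
qed

section \<open>Conditional expectations\<close>

locale opval_space =
  fixes E :: "'a::cstar_algebra \<Rightarrow> 'a" and B :: "'a set"
  assumes space: "opval_cstar_prob_space E B"
begin

lemma B_one: "1 \<in> B" and B_add: "x \<in> B \<Longrightarrow> y \<in> B \<Longrightarrow> x + y \<in> B"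
  and B_mult: "x \<in> B \<Longrightarrow> y \<in> B \<Longrightarrow> x * y \<in> B" and B_cscale: "x \<in> B \<Longrightarrow> cscale c x \<in> B"
  and B_adj: "x \<in> B \<Longrightarrow> adj x \<in> B" and B_closed: "closed B"
  using space by (auto simp: opval_cstar_prob_space_def cstar_subalgebra_def)

lemma E_add: "E (x + y) = E x + E y" and E_cscale: "E (cscale c x) = cscale c (E x)"
  and E_in_B: "E x \<in> B" and E_id: "b \<in> B \<Longrightarrow> E b = b"
  and E_bimodule: "b \<in> B \<Longrightarrow> b' \<in> B \<Longrightarrow> E (b * x * b') = b * E x * b'"
  and E_cp: "mat_positive k X \<Longrightarrow> mat_positive k (mat_map E X)"
  using space by (auto simp: opval_cstar_prob_space_def clinear_def completely_positive_def)

lemma B_zero: "0 \<in> B" using B_cscale[OF B_one, of 0] by simp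

lemma B_scaleR: "x \<in> B \<Longrightarrow> r *\<^sub>R x \<in> B" using B_cscale[of x "of_real r"] by (simp add: cscale_of_real)

lemma B_subspace: "subspace B"
  by (auto simp: subspace_def intro: B_add B_zero B_scaleR)

lemma E_zero: "E 0 = 0" using E_cscale[of 0 0] by simp

lemma E_diff: "E (x - y) = E x - E y"
  using E_add[of "x - y" y] by simp

lemma E_scaleR: "E (r *\<^sub>R x) = r *\<^sub>R E x" using E_cscale[of "of_real r" x] by (simp add: cscale_of_real)

lemma E_of_real: "E (of_real r) = of_real r"
  using E_scaleR[of r 1] E_id[OF B_one] by (simp add: of_real_def)

lemma E_sum: "E (\<Sum>i\<in>I. f i) = (\<Sum>i\<in>I. E (f i))"
  by (induction I rule: infinite_finite_induct) (auto simp: E_add E_zero)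

lemma E_left: "b \<in> B \<Longrightarrow> E (b * x) = b * E x" using E_bimodule[of b 1 x] B_one by simp

lemma E_right: "b \<in> B \<Longrightarrow> E (x * b) = E x * b" using E_bimodule[of 1 b x] B_one by simp

lemma E_positive: "positive_el x \<Longrightarrow> positive_el (E x)"
proof -
  assume "positive_el x"
  then have "mat_positive 1 (mat_map E (mat_diag 1 x))" by (intro E_cp) (simp add: positive_el_iff_mat_positive)
  also have "mat_map E (mat_diag 1 x) = mat_diag 1 (E x)" by (auto simp: mat_map_def mat_diag_def E_zero fun_eq_iff)
  finally show ?thesis by (simp add: positive_el_iff_mat_positive)
qed

text \<open>Positive elements are selfadjoint, so applying \<open>E\<close> to the positive
  \<open>norm h - h\<close> shows that selfadjointness is preserved; the Cartesian decomposition
  does the rest.\<close>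

lemma E_adj: "E (adj x) = adj (E x)"
proof -
  have sa: "adj (E h) = E h" if "adj h = h" for h
  proof -
    have "positive_el (E (of_real (norm h) - h))" by (intro E_positive positive_el_norm_diff that) simp
    then have "adj (of_real (norm h) - E h) = of_real (norm h) - E h"
      by (simp add: E_diff E_of_real positive_el_sa)
    then show ?thesis by (simp add: adj_diff)
  qed
  obtain h k where "adj h = h" "adj k = k" "x = h + cscale \<i> k" by (rule cartesian_decomposition)
  then show ?thesis by (simp add: adj_add adj_cscale E_add E_cscale sa)
qed

text \<open>This is positivity of \<open>E (adj y * y)\<close> for \<open>y = x - E x\<close>: the
  bimodule property reduces each mixed term to \<open>adj (E x) * E x\<close>.\<close>

lemma E_schwarz: "positive_el (E (adj x * x) - adj (E x) * E x)"
proof -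
  define y where "y = x - E x"
  have "adj y * y = adj x * x - adj x * E x - adj (E x) * x + adj (E x) * E x"
    by (simp add: y_def adj_diff algebra_simps)
  then have "E (adj y * y) = E (adj x * x) - adj (E x) * E x"
    by (simp add: E_add E_diff E_left E_right E_in_B B_adj E_adj E_id B_mult)
  then show ?thesis using E_positive[OF positive_el_adj_mult[of y]] by simp
qed

lemma is_mat_map: "is_mat k X \<Longrightarrow> is_mat k (mat_map E X)"
  by (auto simp: is_mat_def mat_map_def E_zero)

text \<open>Kadison-Schwarz for the amplification of \<open>E\<close>, obtained from \<open>E\<^sub>k((X - E\<^sub>k X)\<^sup>* (X - E\<^sub>k X)) \<ge> 0\<close>.\<close>

lemma norm_emb_map_le:
  assumes X: "is_mat k X"
  shows "norm (emb k (mat_map E X)) \<le> norm (emb k X)"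
proof -
  define G where "G = mat_map E X"
  define N where "N = norm (emb k X)"
  have G: "is_mat k G" using X by (simp add: G_def is_mat_map)
  define Y where "Y = mat_diff X G"
  have Y: "is_mat k Y" using X G by (simp add: Y_def is_mat_ops)
  have pos0: "mat_positive k Z \<longleftrightarrow> positive_el (emb k Z)" if "is_mat k Z" for Z :: "nat \<Rightarrow> nat \<Rightarrow> 'a"
    using mat_positive_iff_ext[OF that, of 0] by (simp add: ext_zero)
  have "mat_positive k (mat_mult k (mat_adj Y) Y)"
    using Y by (subst pos0) (auto simp: is_mat_ops emb_ops positive_el_adj_mult)
  then have 1: "mat_positive k (mat_map E (mat_mult k (mat_adj Y) Y))" by (rule E_cp)
  have "mat_map E (mat_mult k (mat_adj Y) Y) = mat_diff (mat_map E (mat_mult k (mat_adj X) X)) (mat_mult k (mat_adj G) G)"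
  proof (intro ext)
    fix i j
    have "E (adj (Y l i) * Y l j) = E (adj (X l i) * X l j) - adj (G l i) * G l j" for l
    proof -
      have "adj (Y l i) * Y l j = adj (X l i) * X l j - adj (X l i) * E (X l j) - adj (E (X l i)) * X l j + adj (E (X l i)) * E (X l j)"
        by (simp add: Y_def G_def mat_diff_def mat_map_def adj_diff algebra_simps)
      then show ?thesis
        by (simp add: E_add E_diff E_left E_right E_in_B B_adj E_adj E_id B_mult G_def mat_map_def)
    qed
    then show "mat_map E (mat_mult k (mat_adj Y) Y) i j = mat_diff (mat_map E (mat_mult k (mat_adj X) X)) (mat_mult k (mat_adj G) G) i j"
      by (simp add: mat_map_def mat_mult_def mat_adj_def mat_diff_def E_sum sum_subtractf)
  qed
  with 1 have 1: "positive_el (emb k (mat_map E (mat_mult k (mat_adj X) X)) - adj (emb k G) * emb k G)"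
    using X G by (simp add: pos0 is_mat_ops is_mat_map emb_ops)
  have eP: "emb k (mat_scale (of_real (N\<^sup>2)) (mat_one k)) = N\<^sup>2 *\<^sub>R emb k (mat_one k)"
    by (simp only: emb_ops cscale_of_real)
  have "mat_positive k (mat_diff (mat_scale (of_real (N\<^sup>2)) (mat_one k)) (mat_mult k (mat_adj X) X))"
  \<comment> \<open>With the parameter \<open>N^2\<close> the complementary corner carries the same
    scalar, so the extension is \<open>N^2 - adj (emb k X) * emb k X\<close> in the unital algebra,
    where the norm criterion applies.\<close>
  proof (subst mat_positive_iff_ext[of _ _ "N\<^sup>2"])
    have "ext k (complex_of_real (N\<^sup>2)) (mat_diff (mat_scale (of_real (N\<^sup>2)) (mat_one k)) (mat_mult k (mat_adj X) X))
      = of_real (N\<^sup>2) - adj (emb k X) * emb k X"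
      by (simp add: ext_def emb_ops cscale_diff_right cscale_of_real_one flip: of_real_power)
    moreover have "positive_el (of_real (N\<^sup>2) - adj (emb k X) * emb k X)"
      by (rule positive_el_norm_diff) (auto simp: adj_mult adj_adj cstar_identity N_def)
    ultimately show "positive_el (ext k (complex_of_real (N\<^sup>2)) (mat_diff (mat_scale (of_real (N\<^sup>2)) (mat_one k)) (mat_mult k (mat_adj X) X)))"
      by (simp only:)
  qed (use X in \<open>auto simp: is_mat_ops\<close>)
  from E_cp[OF this]
  have "mat_positive k (mat_diff (mat_scale (of_real (N\<^sup>2)) (mat_one k)) (mat_map E (mat_mult k (mat_adj X) X)))"
  proof (rule back_subst[of "mat_positive k"])
    show "mat_map E (mat_diff (mat_scale (of_real (N\<^sup>2)) (mat_one k)) (mat_mult k (mat_adj X) X))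
      = mat_diff (mat_scale (of_real (N\<^sup>2)) (mat_one k)) (mat_map E (mat_mult k (mat_adj X) X))"
      by (auto simp: mat_map_def mat_diff_def mat_scale_def mat_one_def E_diff E_cscale E_id B_one E_zero fun_eq_iff)
  qed
  then have "positive_el (N\<^sup>2 *\<^sub>R emb k (mat_one k) - emb k (mat_map E (mat_mult k (mat_adj X) X)))"
    using X by (subst (asm) pos0) (auto simp: is_mat_ops is_mat_map emb_ops(2) eP[symmetric])
  from positive_el_add[OF this 1]
  have "positive_el (N\<^sup>2 *\<^sub>R emb k (mat_one k) - adj (emb k G) * emb k G)" by simp
  from norm_mono_positive[OF positive_el_adj_mult this]
  have "(norm (emb k G))\<^sup>2 \<le> N\<^sup>2 * norm (emb k (mat_one k) :: 'a cmat)" by (simp add: cstar_identity)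
  also have "\<dots> \<le> N\<^sup>2 * 1"
  proof (rule mult_left_mono)
    have "blk (1 :: 'a cmat) k = mat_one k" by (simp add: blk_simps)
    then show "norm (emb k (mat_one k) :: 'a cmat) \<le> 1" using norm_emb_blk_le[of k "1 :: 'a cmat"] by simp
  qed simp
  finally have "(norm (emb k G))\<^sup>2 \<le> N\<^sup>2" by simp
  then show ?thesis unfolding G_def N_def by (rule power2_le_imp_le) simp
qed

lemma norm_E_le: "norm (E x) \<le> norm x"
proof -
  have "norm ((adj (E x)) * E x) \<le> norm (E (adj x * x))"
    using E_schwarz by (intro norm_mono_positive positive_el_adj_mult)
  also have "\<dots> \<le> (norm x)\<^sup>2"
  proof (rule norm_le_of_positive)
    have p: "positive_el (E (adj x * x))" by (intro E_positive positive_el_adj_mult)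
    show "adj (E (adj x * x)) = E (adj x * x)" using p by (rule positive_el_sa)
    have "positive_el (E (of_real ((norm x)\<^sup>2) - adj x * x))"
      by (intro E_positive positive_el_norm_diff) (auto simp: adj_mult adj_adj cstar_identity)
    then show "positive_el (of_real ((norm x)\<^sup>2) - E (adj x * x))" by (simp only: E_diff E_of_real)
    show "positive_el (of_real ((norm x)\<^sup>2) + E (adj x * x))"
      using p by (intro positive_el_add) (simp_all only: positive_el_of_real_iff zero_le_power2)
  qed
  finally have "(norm (E x))\<^sup>2 \<le> (norm x)\<^sup>2" by (simp only: cstar_identity)
  then show ?thesis by (rule power2_le_imp_le) simp
qed

lemma bounded_linear_E: "bounded_linear E"
  by (rule bounded_linear_intro[where K=1]) (simp_all add: E_add E_scaleR norm_E_le)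

end

section \<open>Resolvents of Bernoulli elements\<close>

lemma im_el_minus_adj: "im_el (- adj T) = im_el T"
  by (simp add: im_el_def adj_minus adj_adj)

text \<open>The imaginary part of \<open>adj T\<close> is negative, but \<open>- adj T\<close> has
  the same one as \<open>T\<close>. Membership of the adjoint resolvent in the word space is what
  the mirrored resolvent equation requires.\<close>

lemma adj_inverse_in_subspace:
  fixes T :: "'a::cstar_algebra"
  assumes pos: "positive_el (im_el T - of_real c)" and c: "c > 0"
    and V: "subspace V" "\<And>z v. v \<in> V \<Longrightarrow> cscale z v \<in> V" "closed V" "1 \<in> V" "\<And>v. v \<in> V \<Longrightarrow> adj T * v \<in> V"
  shows "adj (inverse_el T) \<in> V"
proof -
  have pos': "positive_el (im_el (- adj T) - of_real c)" using pos by (simp add: im_el_minus_adj)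
  have "inverse_el (- adj T) \<in> V"
    using V by (intro invertible_of_im_el(3)[OF pos' c]) (auto intro: subspace_neg)
  moreover have "inverse_el (- adj T) = - adj (inverse_el T)"
  proof (rule inverse_elI)
    note i = inverse_el[OF invertible_of_im_el(1)[OF pos c]]
    show "- adj T * - adj (inverse_el T) = 1" "- adj (inverse_el T) * - adj T = 1"
      using i by (simp_all flip: adj_mult)
  qed
  ultimately show ?thesis using V(1) subspace_neg by fastforce
qed

text \<open>Here \<open>span\<close> is the real span; complex multiples are supplied by the
  coefficients, because \<open>B\<close> is closed under complex scaling
  (\<open>word_space_cscale\<close>).\<close>

definition word_space :: "'a::cstar_algebra set \<Rightarrow> 'a \<Rightarrow> 'a set" where
  "word_space B s = closure (span {sword s bs |bs. bs \<noteq> [] \<and> set bs \<subseteq> B})"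

lemma word_space_image:
  fixes f :: "'a::cstar_algebra \<Rightarrow> 'a"
  assumes f: "bounded_linear f"
    and W: "\<And>bs. bs \<noteq> [] \<Longrightarrow> set bs \<subseteq> B \<Longrightarrow> \<exists>cs. cs \<noteq> [] \<and> set cs \<subseteq> B \<and> f (sword s bs) = sword s cs"
    and x: "x \<in> word_space B s"
  shows "f x \<in> word_space B s"
proof -
  let ?W = "{sword s bs |bs. bs \<noteq> [] \<and> set bs \<subseteq> B}"
  have "f ` span ?W = span (f ` ?W)"
    using linear_span_image[OF bounded_linear.linear[OF f]] by simp
  also have "f ` ?W \<subseteq> ?W" using W by fastforce
  then have "span (f ` ?W) \<subseteq> span ?W" by (rule span_mono)
  finally have "f ` closure (span ?W) \<subseteq> closure (span ?W)"
    using closure_bounded_linear_image_subset[OF f, of "span ?W"] closure_mono by blast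
  then show ?thesis using x by (auto simp: word_space_def)
qed

lemma word_space_eq:
  fixes f g :: "'a::cstar_algebra \<Rightarrow> 'a"
  assumes "bounded_linear f" "bounded_linear g"
    and "\<And>bs. bs \<noteq> [] \<Longrightarrow> set bs \<subseteq> B \<Longrightarrow> f (sword s bs) = g (sword s bs)"
    and "x \<in> word_space B s"
  shows "f x = g x"
proof -
  let ?W = "{sword s bs |bs. bs \<noteq> [] \<and> set bs \<subseteq> B}"
  have "subspace {x. f x = g x}"
    using assms(1,2) by (auto simp: subspace_def linear_simps)
  then have "span ?W \<subseteq> {x. f x = g x}" using assms(3) by (intro span_minimal) auto
  moreover have "closed {x. f x = g x}"
    using assms(1,2) by (intro closed_Collect_eq linear_continuous_on)
  ultimately have "closure (span ?W) \<subseteq> {x. f x = g x}" by (rule closure_minimal)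
  then show ?thesis using assms(4) by (auto simp: word_space_def)
qed

lemma closed_word_space: "closed (word_space B s)"
  by (simp add: word_space_def)

lemma subspace_closure:
  fixes S :: "'a::real_normed_vector set"
  assumes "subspace S"
  shows "subspace (closure S)"
  unfolding subspace_def
proof (intro conjI ballI allI)
  show "0 \<in> closure S" using assms closure_subset subspace_0 by blast
  fix x assume "x \<in> closure S"
  then obtain f where f: "\<And>n. f n \<in> S" "f \<longlonglongrightarrow> x" by (auto simp: closure_sequential)
  show "c *\<^sub>R x \<in> closure S" for c
    unfolding closure_sequential using f assms
    by (intro exI[of _ "\<lambda>n. c *\<^sub>R f n"]) (auto intro: subspace_scale tendsto_intros)
  fix y assume "y \<in> closure S"
  then obtain g where g: "\<And>n. g n \<in> S" "g \<longlonglongrightarrow> y" by (auto simp: closure_sequential)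
  show "x + y \<in> closure S"
    unfolding closure_sequential using f g assms
    by (intro exI[of _ "\<lambda>n. f n + g n"]) (auto intro: subspace_add tendsto_intros)
qed

lemma subspace_word_space: "subspace (word_space B s)"
  unfolding word_space_def by (intro subspace_closure subspace_span)

lemma sword_Cons: "bs \<noteq> [] \<Longrightarrow> sword s (b # bs) = b * s * sword s bs"
  by (cases bs) auto

lemma sword_in_word_space: "bs \<noteq> [] \<Longrightarrow> set bs \<subseteq> B \<Longrightarrow> sword s bs \<in> word_space B s"
  unfolding word_space_def by (rule closure_subset[THEN subsetD], rule span_base) auto

context opval_space
begin

lemma word_space_one: "1 \<in> word_space B s"
  using sword_in_word_space[of "[1]" B s] B_one by simp

lemma word_space_mult_B:
  assumes "b \<in> B" "x \<in> word_space B s"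
  shows "b * x \<in> word_space B s"
proof (rule word_space_image[OF bounded_linear_mult_right _ assms(2)])
  fix bs :: "'a list" assume bs: "bs \<noteq> []" "set bs \<subseteq> B"
  then obtain c cs where c: "bs = c # cs" by (cases bs) auto
  have "b * sword s bs = sword s ((b * c) # cs)" by (cases cs) (simp_all add: c mult.assoc)
  then show "\<exists>cs. cs \<noteq> [] \<and> set cs \<subseteq> B \<and> b * sword s bs = sword s cs"
    using bs c assms(1) B_mult by (intro exI[of _ "(b * c) # cs"]) auto
qed

lemma word_space_mult_s:
  assumes "x \<in> word_space B s"
  shows "s * x \<in> word_space B s"
proof (rule word_space_image[OF bounded_linear_mult_right _ assms])
  fix bs :: "'a list" assume bs: "bs \<noteq> []" "set bs \<subseteq> B"
  then show "\<exists>cs. cs \<noteq> [] \<and> set cs \<subseteq> B \<and> s * sword s bs = sword s cs"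
    using B_one by (intro exI[of _ "1 # bs"]) (auto simp: sword_Cons)
qed

lemma word_space_cscale:
  assumes "x \<in> word_space B s"
  shows "cscale c x \<in> word_space B s"
  using word_space_mult_B[OF B_cscale[OF B_one] assms, of c] by (simp add: cscale_1_mult)

lemma bernoulli_sword:
  assumes "bernoulli E B s" "bs \<noteq> []" "set bs \<subseteq> B"
  shows "E (sword s bs) = (if even (length bs - 1) then alt_prod (variance E s) bs else 0)"
  using assms unfolding bernoulli_def by blast

text \<open>On words this is one step of the recursion of \<open>alt_prod\<close>; both sides are
  bounded and linear in \<open>x\<close>, which carries the relation to the closed span. Together
  with \<open>bernoulli_E_single\<close> it is all that is used of the Bernoulli moments.\<close>

lemma bernoulli_E:
  assumes "bernoulli E B s" "b \<in> B" "x \<in> word_space B s"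
  shows "E (s * b * s * x) = variance E s b * E x"
proof (rule word_space_eq[OF _ _ _ assms(3)])
  show "bounded_linear (\<lambda>x. E (s * b * s * x))"
    by (intro bounded_linear_compose[OF bounded_linear_E] bounded_linear_mult_right)
  show "bounded_linear (\<lambda>x. variance E s b * E x)"
    by (intro bounded_linear_compose[OF bounded_linear_mult_right bounded_linear_E])
  fix bs :: "'a list" assume bs: "bs \<noteq> []" "set bs \<subseteq> B"
  then obtain c cs where c: "bs = c # cs" by (cases bs) auto
  \<comment> \<open>The leading 1 supplies the coefficient before the first \<open>s\<close>; two
    additional letters leave the parity of the word unchanged.\<close>
  have "E (s * b * s * sword s bs) = E (sword s (1 # b # bs))"
    using bs by (simp add: sword_Cons mult.assoc)
  also have "\<dots> = (if even (length (1 # b # bs) - 1) then alt_prod (variance E s) (1 # b # bs) else 0)"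
    using assms(2) bs B_one by (intro bernoulli_sword[OF assms(1)]) auto
  also have "\<dots> = variance E s b * (if even (length bs - 1) then alt_prod (variance E s) bs else 0)"
    by (simp add: c)
  also have "\<dots> = variance E s b * E (sword s bs)"
    using bernoulli_sword[OF assms(1) bs] by simp
  finally show "E (s * b * s * sword s bs) = variance E s b * E (sword s bs)" .
qed

lemma bernoulli_E_single:
  assumes "bernoulli E B s" "b \<in> B" "b' \<in> B"
  shows "E (b * s * b') = 0"
proof -
  show ?thesis using bernoulli_sword[OF assms(1), of "[b, b']"] assms(2,3) by simp
qed

text \<open>\<open>R = (b - s)\<^sup>-\<^sup>1\<close> and \<open>y = b\<^sup>-\<^sup>1\<close> satisfy \<open>R = y + y s y + y s y s R\<close>; applying \<open>E\<close> gives
\<open>(b - \<eta>(b\<^sup>-\<^sup>1)) E[R] = 1\<close>.\<close>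

lemma bernoulli_resolvent:
  assumes bern: "bernoulli E B s" and b: "b \<in> B" and y: "y \<in> B" "b * y = 1" "y * b = 1"
    and R: "R \<in> word_space B s" "(b - s) * R = 1"
  shows "b * E R = 1 + variance E s y * E R"
proof -
  have "y * ((b - s) * R) = y" using R by simp
  then have "R = y + y * s * R" using y by (simp add: algebra_simps flip: mult.assoc)
  then have "R = y + y * s * (y + y * s * R)" by metis
  then have "E R = E (y + y * s * y + y * (s * y * s * R))" by (simp add: algebra_simps)
  also have "\<dots> = y + y * (variance E s y * E R)"
    using bern y R by (simp add: E_add E_id E_left bernoulli_E bernoulli_E_single)
  finally have "b * E R = b * y + b * y * (variance E s y * E R)" by (metis distrib_left mult.assoc)
  then show ?thesis using y by simp
qed

lemma variance_adj: "adj s = s \<Longrightarrow> variance E s (adj x) = adj (variance E s x)"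
  by (simp add: variance_def adj_mult mult.assoc flip: E_adj)

text \<open>The argument of \<open>bernoulli_resolvent\<close> inside the corner, with
  \<open>emb k (mat_one k)\<close> as unit. Since the expectation acts entrywise, the expansion of
  \<open>R\<close> is written out in entries before \<open>bernoulli_E\<close> is applied.\<close>

lemma bernoulli_resolvent_mat:
  assumes bern: "bernoulli E B s" and b: "is_mat k b"
    and y: "mat_in k B y" "mat_mult k b y = mat_one k" "mat_mult k y b = mat_one k"
    and R: "is_mat k R" "\<And>i j. i < k \<Longrightarrow> j < k \<Longrightarrow> R i j \<in> word_space B s"
      "mat_mult k (mat_diff b (mat_diag k s)) R = mat_one k"
  shows "emb k b * emb k (mat_map E R) = emb k (mat_one k) + emb k (mat_map (variance E s) y) * emb k (mat_map E R)"
proof -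
  let ?b = "emb k b" and ?y = "emb k y" and ?R = "emb k R" and ?S = "emb k (mat_diag k s)" and ?P = "emb k (mat_one k)"
  let ?G = "emb k (mat_map E R)" and ?H = "emb k (mat_map (variance E s) y)"
  have my: "is_mat k y" using y by (simp add: mat_in_def)
  have yB: "y i j \<in> B" if "i < k" "j < k" for i j using y that by (simp add: mat_in_def)
  have by1: "?b * ?y = ?P" "?y * ?b = ?P" using y by (metis emb_ops(5))+
  have PR: "?P * ?R = ?R" using mat_mult_one[OF R(1)] by (metis emb_ops(5))
  have yP: "?y * ?P = ?y" using mat_mult_one[OF my] by (metis emb_ops(5))
  have "(?b - ?S) * ?R = ?P" using R(3) by (metis emb_ops(2,5))
  then have "?y * ((?b - ?S) * ?R) = ?y" by (simp add: yP)
  then have "?P * ?R = ?y + ?y * ?S * ?R" using by1 by (simp add: algebra_simps flip: mult.assoc)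
  then have "?R = ?y + ?y * ?S * ?R" by (simp add: PR)
  then have "?R = ?y + ?y * ?S * (?y + ?y * ?S * ?R)" by metis
  also have "\<dots> = emb k (mat_add (mat_add y (mat_mult k y (mat_mult k (mat_diag k s) y)))
      (mat_mult k y (mat_mult k (mat_mult k (mat_diag k s) y) (mat_mult k (mat_diag k s) R))))" (is "_ = emb k ?Z")
    by (simp add: emb_ops algebra_simps)
  finally have "blk ?R k = blk (emb k ?Z) k" by simp
  then have RZ: "R = ?Z" using R(1) my by (simp add: blk_emb is_mat_ops)
  have sm: "mat_mult k (mat_diag k s) X i j = s * X i j" if "i < k" for X :: "nat \<Rightarrow> nat \<Rightarrow> 'a" and i j
    using that by (simp add: mat_mult_def mat_diag_def if_distrib[of "\<lambda>x. x * _"] sum.delta cong: if_cong)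
  have Rij: "R i j = y i j + (\<Sum>l<k. y i l * s * y l j) + (\<Sum>l<k. y i l * (\<Sum>m<k. s * y l m * s * R m j))" if "i < k" for i j
  proof -
    have "R i j = ?Z i j" using RZ by simp
    also have "\<dots> = y i j + (\<Sum>l<k. y i l * mat_mult k (mat_diag k s) y l j)
        + (\<Sum>l<k. y i l * (\<Sum>m<k. mat_mult k (mat_diag k s) y l m * mat_mult k (mat_diag k s) R m j))"
      unfolding mat_add_def mat_mult_def[of k y] mat_mult_def[of k "mat_mult k (mat_diag k s) y"] ..
    finally show ?thesis using sm by (simp add: mult.assoc)
  qed
  have "E (R i j) = y i j + (\<Sum>l<k. y i l * (\<Sum>m<k. variance E s (y l m) * E (R m j)))" if ij: "i < k" "j < k" for i j
  proof -
    have "E (R i j) = E (y i j) + (\<Sum>l<k. E (y i l * s * y l j)) + (\<Sum>l<k. E (y i l * (\<Sum>m<k. s * y l m * s * R m j)))"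
      by (subst Rij[OF ij(1)]) (simp only: E_add E_sum)
    also have "(\<Sum>l<k. E (y i l * s * y l j)) = 0"
      using bernoulli_E_single[OF bern] yB ij by simp
    also have "(\<Sum>l<k. E (y i l * (\<Sum>m<k. s * y l m * s * R m j))) = (\<Sum>l<k. y i l * (\<Sum>m<k. variance E s (y l m) * E (R m j)))"
      using yB R(2) ij by (intro sum.cong refl) (simp add: E_left E_sum bernoulli_E[OF bern])
    finally show ?thesis using yB ij by (simp add: E_id)
  qed
  then have "mat_map E R = mat_add y (mat_mult k y (mat_mult k (mat_map (variance E s) y) (mat_map E R)))"
    using R(1) my
    by (intro is_mat_eqI[of k]) (auto simp: is_mat_ops is_mat_map is_mat_def mat_map_def mat_add_def mat_mult_def E_zero variance_def)
  then have "?G = ?y + ?y * (?H * ?G)" by (metis emb_ops(1,5))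
  then have "?b * ?G = ?P + ?P * (?H * ?G)" using by1 by (metis distrib_left mult.assoc)
  moreover have "?P * ?H = ?H"
  proof -
    have "is_mat k (mat_map (variance E s) y)" using my by (auto simp: is_mat_def mat_map_def variance_def E_zero)
    then show ?thesis using mat_mult_one(1) by (metis emb_ops(5))
  qed
  ultimately show ?thesis by (metis mult.assoc)
qed

section \<open>Norms of variance maps and the matrix Cauchy transform\<close>

lemma norm_variance_le: "norm (variance E s x) \<le> (norm s)\<^sup>2 * norm x"
proof -
  have "norm (variance E s x) \<le> norm (s * x * s)" by (simp add: variance_def norm_E_le)
  also have "\<dots> \<le> norm s * norm x * norm s" by (meson norm_mult_ineq mult_right_mono norm_ge_zero order_trans)
  finally show ?thesis by (simp add: power2_eq_square mult_ac)
qed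

lemma variance_scaleR: "variance E s (r *\<^sub>R x) = r *\<^sub>R variance E s x"
  by (simp add: variance_def E_scaleR)

lemma op_norm_variance:
  fixes s s' x :: 'a
  defines "D \<equiv> op_norm_on B (\<lambda>x. variance E s x - variance E s' x)"
  shows "D \<ge> 0" and "x \<in> B \<Longrightarrow> norm (variance E s x - variance E s' x) \<le> D * norm x"
proof -
  let ?f = "\<lambda>x. variance E s x - variance E s' x"
  \<comment> \<open>The supremum in \<open>op_norm_on\<close> dominates its members once the set is
    known to be bounded.\<close>
  have bdd: "bdd_above ((\<lambda>b. norm (?f b)) ` {b \<in> B. norm b \<le> 1})"
  proof (rule bdd_aboveI2)
    fix b assume "b \<in> {b \<in> B. norm b \<le> 1}"
    then have b: "norm b \<le> 1" by simp
    have "norm (?f b) \<le> norm (variance E s b) + norm (variance E s' b)" by (rule norm_triangle_ineq4)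
    also have "\<dots> \<le> (norm s)\<^sup>2 * norm b + (norm s')\<^sup>2 * norm b" by (intro add_mono norm_variance_le)
    also have "\<dots> \<le> (norm s)\<^sup>2 * 1 + (norm s')\<^sup>2 * 1" using b by (intro add_mono mult_left_mono) auto
    finally show "norm (?f b) \<le> (norm s)\<^sup>2 * 1 + (norm s')\<^sup>2 * 1" .
  qed
  have le: "norm (?f b) \<le> D" if "b \<in> B" "norm b \<le> 1" for b
    unfolding D_def op_norm_on_def using that by (intro cSup_upper bdd) auto
  have "norm (?f 0) \<le> D" using le[of 0] B_zero by simp
  then show "D \<ge> 0" by (rule order_trans[OF norm_ge_zero])
  show "norm (?f x) \<le> D * norm x" if x: "x \<in> B"
  proof (cases "x = 0")
    case True
    then show ?thesis by (simp add: variance_def E_zero)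
  next
    case False
    have "norm (?f ((1 / norm x) *\<^sub>R x)) \<le> D" using x False by (intro le B_scaleR) auto
    also have "?f ((1 / norm x) *\<^sub>R x) = (1 / norm x) *\<^sub>R ?f x" by (simp add: variance_scaleR scaleR_diff_right)
    finally have "(1 / norm x) * norm (?f x) \<le> D" by simp
    then show ?thesis using False by (simp add: divide_le_eq)
  qed
qed

text \<open>The elements whose block of size \<open>k\<close> has its entries in \<open>C\<close>,
  with arbitrary other blocks, meet the requirements of \<open>invertible_of_im_el\<close>. Entries
  of inverse matrices can thus be located in \<open>B\<close> or in the word space.\<close>

lemma closed_blk_entries:
  fixes C :: "'a set" and k :: nat
  assumes C: "subspace C" "closed C" "\<And>z v. v \<in> C \<Longrightarrow> cscale z v \<in> C"
  defines "V \<equiv> {F :: 'a cmat. \<forall>i<k. \<forall>j<k. blk F k i j \<in> C}"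
  shows "subspace V" "closed V" "\<And>z v. v \<in> V \<Longrightarrow> cscale z v \<in> V" "1 \<in> C \<Longrightarrow> 1 \<in> V"
    and "\<And>T v. (\<And>i l x. i < k \<Longrightarrow> l < k \<Longrightarrow> x \<in> C \<Longrightarrow> blk T k i l * x \<in> C) \<Longrightarrow> v \<in> V \<Longrightarrow> T * v \<in> V"
proof -
  show "subspace V" using C
    by (auto simp: V_def subspace_def blk_simps mat_add_def mat_scale_def cscale_of_real)
  have "V = (\<Inter>i\<in>{..<k}. \<Inter>j\<in>{..<k}. (\<lambda>F. blk F k i j) -` C)" by (auto simp: V_def)
  moreover have "closed ((\<lambda>F. blk F k i j) -` C)" for i j
    using C(2) by (intro closed_vimage bounded_linear_blk linear_continuous_on)
  ultimately show "closed V" by auto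
  show "cscale z v \<in> V" if "v \<in> V" for z v using that C by (simp add: V_def blk_cscale mat_scale_def)
  show "1 \<in> V" if "1 \<in> C" using that subspace_0[OF C(1)] by (simp add: V_def blk_simps mat_one_def)
  show "T * v \<in> V" if "\<And>i l x. i < k \<Longrightarrow> l < k \<Longrightarrow> x \<in> C \<Longrightarrow> blk T k i l * x \<in> C" "v \<in> V" for T v
    using that C(1) by (auto simp: V_def blk_simps mat_mult_def intro!: subspace_sum)
qed

lemma cauchy_mat_bernoulli:
  assumes bern: "bernoulli E B s" and k: "k \<ge> 1" and b: "mat_upper_half k B b"
  defines "r \<equiv> mat_norm k (mat_inverse k (mat_Im b))" and "G \<equiv> cauchy_mat E k s b" and "y \<equiv> mat_inverse k b"
  shows "mat_in k B y" "norm (emb k y) \<le> r" "is_mat k G" "norm (emb k G) \<le> r" "r > 0"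
    "emb k b * emb k G = emb k (mat_one k) + emb k (mat_map (variance E s) y) * emb k G"
    "emb k G * emb k b = emb k (mat_one k) + emb k G * emb k (mat_map (variance E s) y)"
    "emb k (mat_one k) * emb k G = emb k G" "emb k G * emb k (mat_one k) = emb k G"
proof -
  have sa: "adj s = s" using bern by (simp add: bernoulli_def)
  have mb: "is_mat k b" and bB: "\<And>i j. i < k \<Longrightarrow> j < k \<Longrightarrow> b i j \<in> B"
    using b by (auto simp: mat_upper_half_def mat_in_def)
  define H where "H = mat_Im b"
  have H: "is_mat k H" "mat_positive k H" "mat_invertible k H"
    using b by (auto simp: H_def mat_upper_half_def mat_positive_def)
  note iH = mat_inverse[OF H(3)]
  have r: "r = norm (emb k (mat_inverse k H))"
    unfolding r_def H_def[symmetric] using iH(1) k by (rule mat_norm_eq)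
  show rpos: "r > 0"
  proof (rule ccontr)
    assume "\<not> r > 0"
    then have "emb k (mat_inverse k H) = 0" by (simp add: r)
    then have "blk (emb k (mat_inverse k H)) k = blk 0 k" by simp
    then have "mat_inverse k H = (\<lambda>i j. 0)" using iH(1) by (simp add: blk_emb blk_simps)
    then have "mat_one k = mat_mult k H (\<lambda>i j. 0)" using iH(2) by simp
    then have "mat_one k 0 0 = (0::'a)" by (simp add: mat_mult_def)
    then show False using k by (simp add: mat_one_def)
  qed
  \<comment> \<open>The complement receives \<open>1 / r\<close>, whose inverse has norm exactly
    \<open>r\<close>, so extending \<open>H\<close> preserves the bound on the inverse.\<close>
  have pH: "positive_el (ext k (of_real (1/r)) H)" 
    using mat_positive_iff_ext[OF H(1), of "1/r"] H(2) rpos by simp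
  have invH: "inverse_el (ext k (of_real (1/r)) H) = ext k (of_real r) (mat_inverse k H)"
    using inverse_ext[OF H(1) _ H(3), of "of_real (1/r)"] rpos by simp
  have nb: "norm (inverse_el (ext k (of_real (1/r)) H)) \<le> r"
    unfolding invH norm_cmat_def
  proof (rule cmat_norm_le, unfold cmat_bounded_def, intro conjI allI)
    fix l v
    show "vnorm l (act l (blk (ext k (complex_of_real r) (mat_inverse k H)) l) v) \<le> r * vnorm l v"
    proof (cases "l = k")
      case True
      have "act k (mat_inverse k H) v = act k (blk (emb k (mat_inverse k H)) k) v" using iH(1) by (simp add: blk_emb)
      then show ?thesis using True iH(1) vnorm_act_blk[of k "emb k (mat_inverse k H)" v] by (simp add: blk_ext r)
    next
      case False
      then show ?thesis
        using cmat_boundedD[OF cmat_bounded_scale[OF cmat_bounded_one, of "of_real r"], of l v] iH(1) rpos by (simp add: blk_ext)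
    qed
  qed (use rpos in simp)
  have iE: "invertible_el (ext k (of_real (1/r)) H)" 
    using mat_invertible_iff_ext[OF H(1), of "complex_of_real (1/r)"] H(3) rpos by simp
  have lower: "positive_el (ext k (of_real (1/r)) H - of_real (1/r))"
  proof -
    let ?n = "norm (inverse_el (ext k (of_real (1/r)) H))"
    have n0: "?n > 0" using inverse_el[OF iE] by auto
    then have "1 / r \<le> 1 / ?n" using nb rpos by (intro divide_left_mono mult_pos_pos) auto
    then have "positive_el (of_real (1 / ?n - 1 / r) :: 'a cmat)" by (simp only: positive_el_of_real_iff)
    from positive_el_add[OF inverse_el_lower_bound[OF pH iE] this] show ?thesis by (simp add: algebra_simps)
  qed
  \<comment> \<open>Correspondingly a matrix with imaginary part \<open>H\<close> is extended by
    \<open>i / r\<close>, whose imaginary part is \<open>1 / r\<close>.\<close>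
  have im_ext: "im_el (ext k (\<i> * of_real (1/r)) X) = ext k (of_real (1/r)) (mat_Im X)" for X :: "nat \<Rightarrow> nat \<Rightarrow> 'a"
    by (simp add: im_el_def mat_Im_def ext_adj ext_diff ext_scale field_simps)
  \<comment> \<open>Subtracting the selfadjoint \<open>s\<close> does not change the imaginary part,
    so one statement covers both \<open>b\<close>, with \<open>C = B\<close>, and
    \<open>b - s\<close>, with \<open>C\<close> the word space.\<close>
  have main: "mat_invertible k X \<and> norm (emb k (mat_inverse k X)) \<le> r \<and>
      (\<forall>C. subspace C \<longrightarrow> closed C \<longrightarrow> (\<forall>z v. v \<in> C \<longrightarrow> cscale z v \<in> C) \<longrightarrow> 1 \<in> C \<longrightarrow>
        ((\<forall>i<k. \<forall>l<k. \<forall>x\<in>C. X i l * x \<in> C) \<longrightarrow> (\<forall>i<k. \<forall>j<k. mat_inverse k X i j \<in> C)) \<and>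
        ((\<forall>i<k. \<forall>l<k. \<forall>x\<in>C. adj (X l i) * x \<in> C) \<longrightarrow> (\<forall>i<k. \<forall>j<k. adj (mat_inverse k X j i) \<in> C)))"
    if X: "is_mat k X" and Im: "mat_Im X = H" for X
  proof -
    define T where "T = ext k (\<i> * of_real (1/r)) X"
    have pos: "positive_el (im_el T - of_real (1/r))" 
      using lower by (simp only: T_def im_ext Im)
    have c: "1 / r > 0" using rpos by simp
    note inv = invertible_of_im_el[OF pos c]
    have iX: "mat_invertible k X" using inv(1) X rpos unfolding T_def by (subst mat_invertible_iff_ext) auto
    have "inverse_el T = ext k (1 / (\<i> * of_real (1/r))) (mat_inverse k X)"
      unfolding T_def using X rpos iX by (intro inverse_ext) auto
    then have bT: "blk (inverse_el T) k = mat_inverse k X" using mat_inverse(1)[OF iX] by (simp only: blk_ext refl if_True)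
    have "norm (emb k (mat_inverse k X)) \<le> r"
      using norm_emb_blk_le[of k "inverse_el T"] inv(2) by (simp add: bT)
    moreover have "\<forall>i<k. \<forall>j<k. mat_inverse k X i j \<in> C"
      if C: "subspace C" "closed C" "\<And>z v. v \<in> C \<Longrightarrow> cscale z v \<in> C" "1 \<in> C"
        and XC: "\<forall>i<k. \<forall>l<k. \<forall>x\<in>C. X i l * x \<in> C" for C
    proof -
      note V = closed_blk_entries[OF C(1-3), where k = k]
      have "inverse_el T \<in> {F. \<forall>i<k. \<forall>j<k. blk F k i j \<in> C}"
      proof (rule inv(3))
        show "T * v \<in> {F. \<forall>i<k. \<forall>j<k. blk F k i j \<in> C}" if "v \<in> {F. \<forall>i<k. \<forall>j<k. blk F k i j \<in> C}" for v
          using that XC by (intro V(5)) (auto simp: T_def blk_ext X)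
      qed (use V C in auto)
      then show ?thesis by (simp add: bT)
    qed
    moreover have "\<forall>i<k. \<forall>j<k. adj (mat_inverse k X j i) \<in> C"
      if C: "subspace C" "closed C" "\<And>z v. v \<in> C \<Longrightarrow> cscale z v \<in> C" "1 \<in> C"
        and XC: "\<forall>i<k. \<forall>l<k. \<forall>x\<in>C. adj (X l i) * x \<in> C" for C
    proof -
      note V = closed_blk_entries[OF C(1-3), where k = k]
      have "adj (inverse_el T) \<in> {F. \<forall>i<k. \<forall>j<k. blk F k i j \<in> C}"
      proof (rule adj_inverse_in_subspace[OF pos c])
        show "adj T * v \<in> {F. \<forall>i<k. \<forall>j<k. blk F k i j \<in> C}" if "v \<in> {F. \<forall>i<k. \<forall>j<k. blk F k i j \<in> C}" for v
          using that XC by (intro V(5)) (auto simp: T_def blk_adj blk_ext X mat_adj_def)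
      qed (use V C in auto)
      then show ?thesis by (simp add: bT blk_adj mat_adj_def)
    qed
    ultimately show ?thesis using iX by blast
  qed
  have Bsub: "subspace B" "closed B" "\<forall>z v. v \<in> B \<longrightarrow> cscale z v \<in> B" "1 \<in> B"
    using B_subspace B_closed B_cscale B_one by auto
  have mb_main: "mat_invertible k b" "norm (emb k y) \<le> r" "\<forall>i<k. \<forall>j<k. y i j \<in> B"
    using main[OF mb H_def[symmetric]] Bsub bB B_mult by (auto simp: y_def)
  show "norm (emb k y) \<le> r" by (rule mb_main)
  note y = mat_inverse[OF mb_main(1), folded y_def]
  show yB: "mat_in k B y" using y(1) mb_main(3) by (simp add: mat_in_def)
  define X where "X = mat_diff b (mat_diag k s)"
  have X: "is_mat k X" using mb by (simp add: X_def is_mat_ops)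
  have ImX: "mat_Im X = H"
    by (auto simp: X_def H_def mat_Im_def mat_diff_def mat_adj_def mat_diag_def mat_scale_def adj_diff sa fun_eq_iff)
  define W where "W = word_space B s"
  have W: "subspace W" "closed W" "\<forall>z v. v \<in> W \<longrightarrow> cscale z v \<in> W" "1 \<in> W"
    using subspace_word_space closed_word_space word_space_cscale word_space_one by (auto simp: W_def)
  have X1: "X i l * x \<in> W" if "i < k" "l < k" "x \<in> W" for i l x
    using that bB W(1) word_space_mult_B word_space_mult_s
    by (auto simp: X_def mat_diff_def mat_diag_def left_diff_distrib W_def intro!: subspace_diff)
  have X2: "adj (X l i) * x \<in> W" if "i < k" "l < k" "x \<in> W" for i l x
    using that bB B_adj W(1) word_space_mult_B word_space_mult_s
    by (auto simp: X_def mat_diff_def mat_diag_def left_diff_distrib W_def adj_diff sa intro!: subspace_diff)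
  define R where "R = mat_inverse k X"
  have Rm: "mat_invertible k X" "norm (emb k R) \<le> r" using main[OF X ImX] by (auto simp: R_def)
  have R1: "R i j \<in> W" if "i < k" "j < k" for i j
    using main[OF X ImX] W X1 that unfolding R_def by blast
  have R2: "adj (R j i) \<in> W" if "i < k" "j < k" for i j
    using main[OF X ImX] W X2 that unfolding R_def by blast
  note R = mat_inverse[OF Rm(1), folded R_def]
  have G: "G = mat_map E R" by (simp add: G_def cauchy_mat_def R_def X_def)
  show mG: "is_mat k G" using R(1) by (simp add: G is_mat_map)
  show "norm (emb k G) \<le> r" unfolding G using norm_emb_map_le[OF R(1)] Rm(2) by linarith
  show "emb k (mat_one k) * emb k G = emb k G" "emb k G * emb k (mat_one k) = emb k G"
    using mat_mult_one[OF mG] by (metis emb_ops(5))+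
  show "emb k b * emb k G = emb k (mat_one k) + emb k (mat_map (variance E s) y) * emb k G"
    unfolding G by (rule bernoulli_resolvent_mat[OF bern mb yB y(2,3) R(1)]) (use R1 R(2) in \<open>auto simp: W_def X_def\<close>)
  have one: "mat_adj (mat_one k) = (mat_one k :: nat \<Rightarrow> nat \<Rightarrow> 'a)" by (auto simp: mat_adj_def mat_one_def fun_eq_iff)
  have am: "mat_adj (mat_mult k U V) = mat_mult k (mat_adj V) (mat_adj U)" for U V :: "nat \<Rightarrow> nat \<Rightarrow> 'a"
    by (simp add: mat_adj_def mat_mult_def adj_sum adj_mult)
  \<comment> \<open>The resolvent equation for the adjoint data; taking adjoints afterwards moves
    \<open>G\<close> to the left of the other factors.\<close>
  have "emb k (mat_adj b) * emb k (mat_map E (mat_adj R)) = emb k (mat_one k) + emb k (mat_map (variance E s) (mat_adj y)) * emb k (mat_map E (mat_adj R))"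
  proof (rule bernoulli_resolvent_mat[OF bern])
    show "is_mat k (mat_adj b)" "is_mat k (mat_adj R)" using mb R(1) by (simp_all add: is_mat_ops)
    show "mat_in k B (mat_adj y)" using yB B_adj by (auto simp: mat_in_def is_mat_ops) (simp add: mat_adj_def)
    show "mat_mult k (mat_adj b) (mat_adj y) = mat_one k" "mat_mult k (mat_adj y) (mat_adj b) = mat_one k"
      by (simp_all add: y one flip: am)
    have "mat_diff (mat_adj b) (mat_diag k s) = mat_adj X"
      by (auto simp: X_def mat_diff_def mat_adj_def mat_diag_def adj_diff sa fun_eq_iff)
    then show "mat_mult k (mat_diff (mat_adj b) (mat_diag k s)) (mat_adj R) = mat_one k" by (simp add: R one flip: am)
    show "mat_adj R i j \<in> word_space B s" if "i < k" "j < k" for i j using R2 that by (simp add: mat_adj_def W_def)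
  qed
  moreover have "mat_map E (mat_adj R) = mat_adj G" "mat_map (variance E s) (mat_adj y) = mat_adj (mat_map (variance E s) y)"
    by (simp_all add: G mat_map_def mat_adj_def E_adj variance_adj[OF sa])
  ultimately have "adj (emb k G * emb k b) = adj (emb k (mat_one k) + emb k G * emb k (mat_map (variance E s) y))"
    by (simp add: emb_ops adj_mult adj_add adj_emb_one)
  then show "emb k G * emb k b = emb k (mat_one k) + emb k G * emb k (mat_map (variance E s) y)"
    by (simp only: adj_eq_iff)
qed

lemma cauchy_mat_diff_bound:
  assumes bern: "bernoulli E B B0" "bernoulli E B B1" and k: "k \<ge> 1" and b: "mat_upper_half k B b"
  shows "mat_norm k (mat_diff (cauchy_mat E k B1 b) (cauchy_mat E k B0 b))
    \<le> real k * (mat_norm k (mat_inverse k (mat_Im b))) ^ 3 * op_norm_on B (\<lambda>x. variance E B1 x - variance E B0 x)"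
proof -
  define r where "r = mat_norm k (mat_inverse k (mat_Im b))"
  define D where "D = op_norm_on B (\<lambda>x. variance E B1 x - variance E B0 x)"
  define y where "y = mat_inverse k b"
  note c0 = cauchy_mat_bernoulli[OF bern(1) k b, folded r_def y_def]
  note c1 = cauchy_mat_bernoulli[OF bern(2) k b, folded r_def y_def]
  let ?g0 = "emb k (cauchy_mat E k B0 b)" and ?g1 = "emb k (cauchy_mat E k B1 b)"
  let ?h0 = "emb k (mat_map (variance E B0) y)" and ?h1 = "emb k (mat_map (variance E B1) y)"
  define \<Delta> where "\<Delta> = mat_diff (mat_map (variance E B1) y) (mat_map (variance E B0) y)"
  \<comment> \<open>The product \<open>G1 b G0\<close> is evaluated in two ways, once with each
    resolvent equation.\<close>
  have "?g1 * (emb k b * ?g0) = ?g1 + ?g1 * ?h0 * ?g0" by (simp add: c0(6) distrib_left c1(9) mult.assoc)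
  moreover have "?g1 * emb k b * ?g0 = ?g0 + ?g1 * ?h1 * ?g0" by (simp add: c1(7) distrib_right c0(8))
  ultimately have "?g1 - ?g0 = ?g1 * (?h1 - ?h0) * ?g0" by (simp add: algebra_simps)
  also have "?h1 - ?h0 = emb k \<Delta>" by (simp add: \<Delta>_def emb_ops)
  finally have eq: "?g1 - ?g0 = ?g1 * emb k \<Delta> * ?g0" .
  \<comment> \<open>The operator norm on \<open>B\<close> controls single entries of \<Delta>;
    passing from the entries to the matrix costs the factor \<open>k\<close>.\<close>
  have "norm (emb k \<Delta>) \<le> real k * (D * r)"
  proof (rule norm_emb_entries_le)
    show "D * r \<ge> 0" using c0(5) op_norm_variance(1) by (simp add: D_def)
    fix i j assume ij: "i < k" "j < k"
    have "norm (\<Delta> i j) \<le> D * norm (y i j)"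
      using op_norm_variance(2) c0(1) ij by (simp add: \<Delta>_def mat_diff_def mat_map_def D_def mat_in_def)
    also have "\<dots> \<le> D * r"
      using norm_entry_le_emb[OF ij, of y] c0(2) op_norm_variance(1) by (intro mult_left_mono) (auto simp: D_def)
    finally show "norm (\<Delta> i j) \<le> D * r" .
  qed
  then have "norm (?g1 * emb k \<Delta> * ?g0) \<le> r * (real k * (D * r)) * r"
    using c0(4,5) c1(4) op_norm_variance(1)[of B1 B0]
    by (intro order_trans[OF norm_mult_ineq] mult_mono) (auto simp: D_def)
  also have "\<dots> = real k * r ^ 3 * D" by (simp add: power3_eq_cube)
  finally have "norm (?g1 - ?g0) \<le> real k * r ^ 3 * D" by (simp add: eq)
  moreover have "mat_norm k (mat_diff (cauchy_mat E k B1 b) (cauchy_mat E k B0 b)) = norm (?g1 - ?g0)"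
    using c0(3) c1(3) k by (subst mat_norm_eq) (auto simp: is_mat_ops emb_ops)
  ultimately show ?thesis by (simp add: r_def D_def)
qed

end

section \<open>States and spectral distributions\<close>

locale state_space =
  fixes \<phi> :: "'a::cstar_algebra \<Rightarrow> complex"
  assumes state: "state \<phi>"
begin

lemma phi_add: "\<phi> (x + y) = \<phi> x + \<phi> y" and phi_cscale: "\<phi> (cscale c x) = c * \<phi> x" and phi_one: "\<phi> 1 = 1"
  and phi_positive: "positive_el a \<Longrightarrow> \<phi> a \<in> complex_of_real ` {0..}"
  using state by (auto simp: state_def cfunctional_def)

lemma phi_zero: "\<phi> 0 = 0" using phi_cscale[of 0 0] by simp

lemma phi_diff: "\<phi> (x - y) = \<phi> x - \<phi> y" using phi_add[of "x - y" y] by simp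

lemma phi_scaleR: "\<phi> (r *\<^sub>R x) = of_real r * \<phi> x" using phi_cscale[of "of_real r" x] by (simp add: cscale_of_real)

lemma phi_of_real: "\<phi> (of_real r) = of_real r" using phi_scaleR[of r 1] by (simp add: phi_one scaleR_conv_of_real)

lemma phi_sum: "\<phi> (\<Sum>i\<in>I. f i) = (\<Sum>i\<in>I. \<phi> (f i))"
  by (induction I rule: infinite_finite_induct) (auto simp: phi_add phi_zero)

lemma phi_positive_Re: "positive_el a \<Longrightarrow> Re (\<phi> a) \<ge> 0" and phi_positive_Im: "positive_el a \<Longrightarrow> Im (\<phi> a) = 0"
  using phi_positive by fastforce+

lemma phi_mono: "positive_el (b - a) \<Longrightarrow> Re (\<phi> a) \<le> Re (\<phi> b)"
  using phi_positive_Re[of "b - a"] by (simp add: phi_diff)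

lemma phi_sa:
  assumes sa: "adj h = h" shows "Im (\<phi> h) = 0" "cmod (\<phi> h) \<le> norm h"
proof -
  have p: "positive_el (of_real (norm h) - h)" "positive_el (of_real (norm h) + h)"
    using positive_el_norm_diff[OF sa] positive_el_norm_add[OF sa] by auto
  show im: "Im (\<phi> h) = 0" using phi_positive_Im[OF p(1)] by (simp add: phi_diff phi_of_real)
  have "\<bar>Re (\<phi> h)\<bar> \<le> norm h"
    using phi_positive_Re[OF p(1)] phi_positive_Re[OF p(2)] by (simp add: phi_diff phi_add phi_of_real)
  then show "cmod (\<phi> h) \<le> norm h" using im by (simp add: cmod_def)
qed

lemma phi_adj: "\<phi> (adj x) = cnj (\<phi> x)"
proof -
  obtain h k where hk: "adj h = h" "adj k = k" "x = h + cscale \<i> k" by (rule cartesian_decomposition)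
  have "cnj (\<phi> h) = \<phi> h" "cnj (\<phi> k) = \<phi> k" using phi_sa hk by (simp_all add: complex_eq_iff)
  then show ?thesis by (simp add: hk adj_add adj_cscale phi_add phi_cscale)
qed

text \<open>The constant 2 comes from the Cartesian decomposition; the resulting continuity allows
  the state to be applied to a Neumann series term by term.\<close>

lemma bounded_linear_phi: "bounded_linear \<phi>"
proof (rule bounded_linear_intro[where K=2])
  fix x :: 'a
  obtain h k where hk: "adj h = h" "adj k = k" "x = h + cscale \<i> k" "norm h \<le> norm x" "norm k \<le> norm x"
    by (rule cartesian_decomposition)
  have "\<phi> x = \<phi> h + \<i> * \<phi> k" by (subst hk(3)) (simp add: phi_add phi_cscale)
  then have "cmod (\<phi> x) \<le> cmod (\<phi> h) + cmod (\<phi> k)" using norm_triangle_ineq[of "\<phi> h" "\<i> * \<phi> k"] by (simp add: norm_mult)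
  then show "cmod (\<phi> x) \<le> norm x * 2" using phi_sa(2)[OF hk(1)] phi_sa(2)[OF hk(2)] hk(4,5) by linarith
qed (simp_all only: phi_add phi_scaleR scaleR_conv_of_real[where 'a=complex])

text \<open>The state is applied to the square of \<open>D a - c\<close>, where \<open>c\<close> is
  \<open>d b\<close> rotated by a phase. The additive form, with a sum in place of a product of
  square roots, can be integrated term by term.\<close>

lemma phi_cauchy_schwarz:
  assumes "norm d \<le> D"
  shows "2 * cmod (\<phi> (adj a * d * b)) \<le> D * (Re (\<phi> (adj a * a)) + Re (\<phi> (adj b * b)))"
proof (cases "D = 0")
  case True
  then have "d = 0" using assms by simp
  then show ?thesis using True by (simp add: phi_zero)
next
  case False
  then have D: "D > 0" using assms norm_ge_zero[of d] by linarith
  define w where "w = \<phi> (adj a * d * b)"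
  \<comment> \<open>This phase makes both mixed terms real and equal to the modulus of
    \<open>w\<close>.\<close>
  obtain u where u: "cmod u = 1" "u * w = of_real (cmod w)"
  proof (cases "w = 0")
    case False
    have "cnj w / of_real (cmod w) * w = of_real (cmod w)"
      using False complex_norm_square[of w] by (simp add: field_simps power2_eq_square)
    then show ?thesis using False by (intro that[of "cnj w / of_real (cmod w)"]) (simp_all add: norm_divide)
  qed (use that[of 1] in auto)
  define c where "c = cscale u (d * b)"
  have ac: "\<phi> (adj a * c) = of_real (cmod w)"
    using u(2) by (simp add: c_def cscale_right_mult phi_cscale w_def mult.assoc)
  have "adj (adj a * c) = adj c * a" by (simp add: adj_mult adj_adj)
  then have ca: "\<phi> (adj c * a) = of_real (cmod w)" using phi_adj[of "adj a * c"] ac by simp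
  have "u * cnj u = 1" using u(1) complex_norm_square[of u] by simp
  then have cc: "adj c * c = adj b * (adj d * d) * b"
    by (simp add: c_def adj_cscale adj_mult cscale_left_mult cscale_right_mult cscale_cscale mult.assoc mult.commute[of "cnj u"])
  have "Re (\<phi> (adj c * c)) \<le> Re (\<phi> ((norm d)\<^sup>2 *\<^sub>R (adj b * b)))"
    unfolding cc by (rule phi_mono) (rule adj_mult_le)
  also have "\<dots> = (norm d)\<^sup>2 * Re (\<phi> (adj b * b))" by (simp add: phi_scaleR del: of_real_power)
  also have "\<dots> \<le> D\<^sup>2 * Re (\<phi> (adj b * b))"
    using assms by (intro mult_right_mono power_mono phi_positive_Re positive_el_adj_mult) auto
  finally have ccle: "Re (\<phi> (adj c * c)) \<le> D\<^sup>2 * Re (\<phi> (adj b * b))" .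
  have "adj (D *\<^sub>R a - c) * (D *\<^sub>R a - c) = (D * D) *\<^sub>R (adj a * a) - D *\<^sub>R (adj a * c) - D *\<^sub>R (adj c * a) + adj c * c"
    by (simp add: adj_diff adj_scaleR algebra_simps)
  then have "Re (\<phi> (adj (D *\<^sub>R a - c) * (D *\<^sub>R a - c))) = D * D * Re (\<phi> (adj a * a)) - 2 * D * cmod w + Re (\<phi> (adj c * c))"
    by (simp add: phi_add phi_diff phi_scaleR ac ca)
  moreover have "0 \<le> Re (\<phi> (adj (D *\<^sub>R a - c) * (D *\<^sub>R a - c)))"
    by (intro phi_positive_Re positive_el_adj_mult)
  ultimately have "D * (2 * cmod w) \<le> D * (D * (Re (\<phi> (adj a * a)) + Re (\<phi> (adj b * b))))"
    using ccle by (simp add: power2_eq_square algebra_simps)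
  then show ?thesis using D by (simp add: w_def)
qed

end

section \<open>Bernstein polynomials and the Hausdorff moment problem\<close>

definition bernstein_el :: "nat \<Rightarrow> nat \<Rightarrow> 'a::cstar_algebra \<Rightarrow> 'a" where
  "bernstein_el n k x = real (n choose k) *\<^sub>R (x ^ k * (1 - x) ^ (n - k))"

text \<open>Pascal's rule summed against arbitrary weights: one sum keeps \<open>g\<close>, the
  other shifts it, as the induction on moments requires.\<close>

lemma bernstein_el_Suc:
  "(\<Sum>k\<le>Suc n. g k *\<^sub>R bernstein_el (Suc n) k x)
    = x * (\<Sum>k\<le>n. g (Suc k) *\<^sub>R bernstein_el n k x) + (1 - x) * (\<Sum>k\<le>n. g k *\<^sub>R bernstein_el n k x)"
proof -
  have comm: "x ^ k * (1 - x) = (1 - x) * x ^ k" for k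
    by (simp add: algebra_simps power_commutes)
  have S: "bernstein_el (Suc n) (Suc k) x = x * bernstein_el n k x + (1 - x) * bernstein_el n (Suc k) x" for k
  proof (cases "k < n")
    case True
    then have "n - k = Suc (n - Suc k)" by simp
    then have "x ^ Suc k * (1 - x) ^ (n - k) = (1 - x) * (x ^ Suc k * (1 - x) ^ (n - Suc k))"
      by (simp only: power_Suc[of "1 - x"]) (metis comm mult.assoc)
    then show ?thesis
      by (simp add: bernstein_el_def scaleR_left_distrib mult.assoc del: power_Suc) (simp add: mult.assoc)
  next
    case False
    then show ?thesis by (cases "k = n") (simp_all add: bernstein_el_def binomial_eq_0)
  qed
  have z: "bernstein_el (Suc n) 0 x = (1 - x) * bernstein_el n 0 x" by (simp add: bernstein_el_def)
  have "(\<Sum>k\<le>Suc n. g k *\<^sub>R bernstein_el (Suc n) k x)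
      = g 0 *\<^sub>R bernstein_el (Suc n) 0 x + (\<Sum>k\<le>n. g (Suc k) *\<^sub>R bernstein_el (Suc n) (Suc k) x)"
    by (rule sum.atMost_Suc_shift)
  also have "\<dots> = x * (\<Sum>k\<le>n. g (Suc k) *\<^sub>R bernstein_el n k x)
      + (1 - x) * (g 0 *\<^sub>R bernstein_el n 0 x + (\<Sum>k\<le>n. g (Suc k) *\<^sub>R bernstein_el n (Suc k) x))"
    unfolding S z by (simp only: scaleR_add_right sum.distrib sum_distrib_left distrib_left mult_scaleR_right) (simp add: add_ac)
  also have "g 0 *\<^sub>R bernstein_el n 0 x + (\<Sum>k\<le>n. g (Suc k) *\<^sub>R bernstein_el n (Suc k) x) = (\<Sum>k\<le>Suc n. g k *\<^sub>R bernstein_el n k x)"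
    by (rule sum.atMost_Suc_shift[symmetric])
  also have "\<dots> = (\<Sum>k\<le>n. g k *\<^sub>R bernstein_el n k x)" by (simp add: bernstein_el_def)
  finally show ?thesis .
qed

text \<open>With binomial weights, Pascal's rule for \<open>Suc k choose j\<close> closes the
  induction; powers of \<open>k\<close> would produce lower-order terms.\<close>

lemma bernstein_el_moment:
  "(\<Sum>k\<le>n. real (k choose j) *\<^sub>R bernstein_el n k x) = real (n choose j) *\<^sub>R x ^ j"
proof (induction n arbitrary: j)
  case 0
  then show ?case by (cases j) (simp_all add: bernstein_el_def)
next
  case (Suc n)
  show ?case
  proof (cases j)
    case 0
    have "(\<Sum>k\<le>Suc n. real (k choose 0) *\<^sub>R bernstein_el (Suc n) k x) = x * 1 + (1 - x) * 1"
      using Suc.IH[of 0] by (subst bernstein_el_Suc) simp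
    then show ?thesis using 0 by simp
  next
    case (Suc i)
    have "(\<Sum>k\<le>Suc n. real (k choose j) *\<^sub>R bernstein_el (Suc n) k x)
      = x * (\<Sum>k\<le>n. real (Suc k choose j) *\<^sub>R bernstein_el n k x) + (1 - x) * (real (n choose j) *\<^sub>R x ^ j)"
      by (subst bernstein_el_Suc) (simp only: Suc.IH)
    also have "(\<Sum>k\<le>n. real (Suc k choose j) *\<^sub>R bernstein_el n k x) = real (n choose i) *\<^sub>R x ^ i + real (n choose j) *\<^sub>R x ^ j"
      by (simp add: Suc scaleR_left_distrib sum.distrib Suc.IH del: power_Suc)
    finally show ?thesis by (simp add: Suc algebra_simps)
  qed
qed

text \<open>Both ratios are products of \<open>m\<close> factors of modulus at most 1, so their
  distance is at most the sum of the distances between factors. This links the binomial moments of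
  the Bernstein weights to powers of \<open>k / n\<close>.\<close>

lemma binomial_ratio_approx:
  assumes k: "k \<le> n" and n: "n > 2 * m"
  shows "\<bar>(real k / real n) ^ m - real (k choose m) / real (n choose m)\<bar> \<le> real m * real m / (real n - real m)"
proof -
  define z where "z i = (real k - real i) / (real n - real i)" for i
  have ch: "real (l choose m) = (\<Prod>i<m. real l - real i) / fact m" for l
    by (simp add: binomial_gbinomial gbinomial_prod_rev atLeast0LessThan)
  have "real (k choose m) / real (n choose m) = (\<Prod>i<m. z i)"
    by (simp add: ch z_def prod_dividef)
  moreover have "(real k / real n) ^ m = (\<Prod>i<m. real k / real n)" by simp
  moreover have "norm ((\<Prod>i<m. real k / real n) - (\<Prod>i<m. z i)) \<le> (\<Sum>i<m. norm (real k / real n - z i))"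
  proof (rule norm_prod_diff)
    fix i assume "i \<in> {..<m}"
    then have i: "i < m" by simp
    show "norm (real k / real n) \<le> 1" using k n by (simp add: divide_le_eq)
    \<comment> \<open>For \<open>k < i\<close> the factor is negative; \<open>n > 2 * m\<close> then
      keeps \<open>i - k\<close> below \<open>n - i\<close>.\<close>
    have "\<bar>real k - real i\<bar> \<le> real n - real i" using k n i by (auto simp: abs_if)
    then show "norm (z i) \<le> 1" using n i by (simp add: z_def divide_le_eq)
  qed
  moreover have "(\<Sum>i<m. norm (real k / real n - z i)) \<le> (\<Sum>i<m. real m / (real n - real m))"
  proof (rule sum_mono)
    fix i assume "i \<in> {..<m}"
    then have i: "i < m" by simp
    have pos: "real n > 0" "real n - real i > 0" "real n - real m > 0" using n i by auto
    define U where "U = real i / (real n - real i)"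
    define V where "V = (real n - real k) / real n"
    have eq: "real k / real n - z i = U * V" using pos by (simp add: z_def U_def V_def field_simps)
    have V: "V \<le> 1" "V \<ge> 0" using k pos by (simp_all add: V_def)
    have U: "U \<le> real m / (real n - real m)" "U \<ge> 0" unfolding U_def using pos i by (auto intro!: frac_le)
    have "U * V \<le> real m / (real n - real m) * 1" using U V pos by (intro mult_mono) auto
    then have "real k / real n - z i \<ge> 0" "real k / real n - z i \<le> real m / (real n - real m)"
      unfolding eq using U V by simp_all
    then show "norm (real k / real n - z i) \<le> real m / (real n - real m)" by simp
  qed
  ultimately show ?thesis by simp
qed

text \<open>Commuting square roots of \<open>x\<close> and \<open>1 - x\<close> make every Bernstein
  element a multiple of a square, so the state assigns them nonnegative weights of total 1. Placed
  at the points \<open>k / n\<close>, these weights form measures on the unit interval, and a weak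
  limit has the moments of \<open>x\<close>.\<close>

lemma (in state_space) hausdorff_moments:
  assumes x: "positive_el (x - of_real e)" "positive_el (1 - x - of_real e)" and e: "e > 0"
  shows "\<exists>M. real_distribution M \<and> (AE t in M. 0 \<le> t \<and> t \<le> 1) \<and> (\<forall>m. complex_of_real (\<integral>t. t ^ m \<partial>M) = \<phi> (x ^ m))"
proof -
  obtain p where p: "adj p = p" "p * p = x" "\<And>z. z * x = x * z \<Longrightarrow> z * p = p * z"
    using square_root_strictly_positive[OF x(1) e] by blast
  obtain q where q: "adj q = q" "q * q = 1 - x" "\<And>z. z * (1 - x) = (1 - x) * z \<Longrightarrow> z * q = q * z"
    using square_root_strictly_positive[OF x(2) e] by blast
  have "(1 - x) * p = p * (1 - x)" by (rule p(3)) (simp add: algebra_simps)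
  then have pq: "p * q = q * p" using q(3)[of p] by simp
  have pos: "positive_el (bernstein_el n k x)" for n k
  proof -
    define h where "h = p ^ k * q ^ (n - k)"
    have pqk: "p ^ i * q ^ j = q ^ j * p ^ i" for i j
      using pq by (metis power_commuting_commutes)
    have "adj h = h" by (simp add: h_def adj_mult adj_power p q pqk)
    then have "positive_el (real (n choose k) *\<^sub>R (h * h))" by (intro positive_el_scaleR positive_el_square) auto
    moreover have "h * h = x ^ k * (1 - x) ^ (n - k)"
    proof -
      have "h * h = (p ^ k * p ^ k) * (q ^ (n - k) * q ^ (n - k))"
        unfolding h_def by (metis pqk mult.assoc)
      also have "\<dots> = (p * p) ^ k * (q * q) ^ (n - k)" by (simp add: power_mult_distrib[symmetric] power_add[symmetric] power2_eq_square[symmetric] power_mult[symmetric] mult_2_right mult.commute[of 2])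
      finally show ?thesis by (simp add: p q)
    qed
    ultimately show ?thesis by (simp add: bernstein_el_def)
  qed
  define w where "w n k = Re (\<phi> (bernstein_el n k x))" for n k
  have w0: "w n k \<ge> 0" for n k unfolding w_def by (intro phi_positive_Re pos)
  have sax: "adj x = x"
    using positive_el_sa[OF x(1)] by (simp add: adj_diff)
  have Imx: "Im (\<phi> (x ^ m)) = 0" for m by (rule phi_sa) (simp add: adj_power sax)
  have wm: "(\<Sum>k\<le>n. w n k * real (k choose j)) = real (n choose j) * Re (\<phi> (x ^ j))" for n j
  proof -
    have "(\<Sum>k\<le>n. w n k * real (k choose j)) = Re (\<phi> (\<Sum>k\<le>n. real (k choose j) *\<^sub>R bernstein_el n k x))"
      by (simp add: phi_sum phi_scaleR w_def mult.commute)
    then show ?thesis unfolding bernstein_el_moment by (simp add: phi_scaleR)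
  qed
  have w1: "(\<Sum>k\<le>n. w n k) = 1" for n using wm[of n 0] by (simp add: phi_one)
  define P where "P n = point_measure {..n} (\<lambda>k. ennreal (w n k))" for n
  have prP: "prob_space (P n)" for n
  proof
    have "emeasure (P n) (space (P n)) = (\<Sum>k\<le>n. ennreal (w n k))"
      by (simp add: P_def space_point_measure emeasure_point_measure_finite)
    also have "\<dots> = ennreal (\<Sum>k\<le>n. w n k)" using w0 by (simp add: sum_ennreal)
    finally show "emeasure (P n) (space (P n)) = 1" by (simp add: w1)
  qed
  define X where "X n k = real k / real n" for n k :: nat
  have mX: "X n \<in> borel_measurable (P n)" for n by (simp add: P_def)
  \<comment> \<open>The shift to \<open>Suc n\<close> keeps the denominator in \<open>X\<close>
    nonzero.\<close>
  define \<mu> where "\<mu> n = distr (P (Suc n)) borel (X (Suc n))" for n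
  have rd: "real_distribution (\<mu> n)" for n
  proof -
    interpret P: prob_space "P (Suc n)" by (rule prP)
    show ?thesis unfolding \<mu>_def by (rule P.real_distribution_distr) (use mX in simp)
  qed
  have int\<mu>: "(\<integral>t. f t \<partial>\<mu> n) = (\<Sum>k\<le>Suc n. w (Suc n) k * f (X (Suc n) k))" if "f \<in> borel_measurable borel" for f :: "real \<Rightarrow> real" and n
    unfolding \<mu>_def using that mX[of "Suc n"] w0
    by (subst integral_distr) (auto simp: P_def lebesgue_integral_point_measure_finite)
  have X01: "0 \<le> X (Suc n) k" "X (Suc n) k \<le> 1" if "k \<le> Suc n" for n k
    using that by (simp_all add: X_def divide_le_eq)
  have "tight \<mu>" unfolding tight_def
  proof (intro conjI allI impI rd)
    fix \<epsilon> :: real assume "\<epsilon> > 0"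
    \<comment> \<open>The half-open interval starts at -1 so that a possible atom at 0 is
      counted.\<close>
    have "measure (\<mu> n) {-1<..1} = 1" for n
    proof -
      have "measure (\<mu> n) {-1<..1} = (\<integral>t. indicator {-1<..1} t \<partial>\<mu> n)"
        using real_distribution.events_eq_borel[OF rd] by simp
      also have "\<dots> = (\<Sum>k\<le>Suc n. w (Suc n) k * indicator {-1<..1} (X (Suc n) k))" by (rule int\<mu>) simp
      also have "\<dots> = (\<Sum>k\<le>Suc n. w (Suc n) k)"
        using X01 by (intro sum.cong refl) (auto simp: indicator_def intro: less_le_trans[of _ 0])
      finally show ?thesis by (simp only: w1)
    qed
    then show "\<exists>a b. a < b \<and> (\<forall>n. 1 - \<epsilon> < measure (\<mu> n) {a<..b})"
      using \<open>\<epsilon> > 0\<close> by (intro exI[of _ "-1"] exI[of _ 1]) simp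
  qed
  then obtain r M where r: "strict_mono r" and M: "real_distribution M" and wc: "weak_conv_m (\<mu> \<circ> r) M"
    using tight_imp_convergent_subsubsequence[of \<mu> id] by (auto simp: strict_mono_id)
  interpret M: real_distribution M by (rule M)
  have conv: "(\<lambda>n. \<integral>t. f t \<partial>\<mu> (r n)) \<longlonglongrightarrow> (\<integral>t. f t \<partial>M)"
    if "\<And>t. isCont f t" "\<And>t. norm (f t) \<le> b" for f :: "real \<Rightarrow> real" and b
    using weak_conv_imp_integral_bdd_continuous_conv[of "\<mu> \<circ> r" M f b] that rd M wc by simp
  \<comment> \<open>Weak convergence tests bounded continuous functions. Clamping to the unit
    interval makes the powers bounded and changes nothing at the points
    \<open>k / n\<close>.\<close>
  define cl where "cl t = max 0 (min 1 t)" for t :: real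
  have contcl: "isCont cl t" for t unfolding cl_def by (intro continuous_intros)
  have measf: "f \<in> borel_measurable borel" if "\<And>t. isCont f t" for f :: "real \<Rightarrow> real"
    using that by (intro borel_measurable_continuous_onI continuous_at_imp_continuous_on) auto
  have clX: "cl (X (Suc n) k) = X (Suc n) k" if "k \<le> Suc n" for n k using X01[OF that] by (simp add: cl_def)
  have AE01: "AE t in M. cl t = t"
  proof -
    \<comment> \<open>A bounded continuous function vanishing exactly on the unit interval; its
      integrals are 0 along the sequence, so the limit is concentrated there.\<close>
    define g where "g t = min 1 \<bar>cl t - t\<bar>" for t
    have contg: "isCont g t" for t unfolding g_def using contcl by (intro continuous_intros)
    have g: "0 \<le> g t" "g t \<le> 1" for t by (auto simp: g_def)
    have "(\<integral>t. g t \<partial>\<mu> n) = 0" for n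
      unfolding int\<mu>[OF measf[OF contg]] by (intro sum.neutral ballI) (simp add: g_def clX)
    then have "(\<lambda>n. 0) \<longlonglongrightarrow> (\<integral>t. g t \<partial>M)" using conv[OF contg, of 1] g by simp
    then have "(\<integral>t. g t \<partial>M) = 0" by (simp add: LIMSEQ_const_iff)
    moreover have "integrable M g"
      using g measf[OF contg] by (intro M.integrable_const_bound[of _ 1]) auto
    ultimately have "AE t in M. g t = 0" using g by (subst (asm) integral_nonneg_eq_0_iff_AE) auto
    then show ?thesis by eventually_elim (auto simp: g_def min_def split: if_splits)
  qed
  have mom: "(\<integral>t. t ^ m \<partial>M) = Re (\<phi> (x ^ m))" for m
  proof -
    have contm: "isCont (\<lambda>t. cl t ^ m) t" for t using contcl by (intro continuous_intros)
    have "0 \<le> cl t" "cl t \<le> 1" for t by (auto simp: cl_def)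
    then have bm: "norm (cl t ^ m) \<le> 1" for t by (simp add: power_le_one)
    have lim1: "(\<lambda>n. \<integral>t. cl t ^ m \<partial>\<mu> (r n)) \<longlonglongrightarrow> (\<integral>t. cl t ^ m \<partial>M)" by (rule conv[OF contm bm])
    have diff: "\<bar>(\<integral>t. cl t ^ m \<partial>\<mu> n) - Re (\<phi> (x ^ m))\<bar> \<le> real m * real m / (real (Suc n) - real m)"
      if n: "n > 2 * m" for n
    proof -
      define N where "N = Suc n"
      have N: "N > 2 * m" "N choose m > 0" using n by (auto simp: N_def)
      have "(\<integral>t. cl t ^ m \<partial>\<mu> n) = (\<Sum>k\<le>N. w N k * (real k / real N) ^ m)"
        unfolding int\<mu>[OF measf[OF contm]] N_def 
        using clX by (intro sum.cong refl) (simp add: X_def del: of_nat_Suc)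
      moreover have "Re (\<phi> (x ^ m)) = (\<Sum>k\<le>N. w N k * (real (k choose m) / real (N choose m)))"
        using wm[of N m] N(2) by (simp add: sum_divide_distrib[symmetric] field_simps)
      ultimately have "(\<integral>t. cl t ^ m \<partial>\<mu> n) - Re (\<phi> (x ^ m)) = (\<Sum>k\<le>N. w N k * ((real k / real N) ^ m - real (k choose m) / real (N choose m)))"
        by (simp add: sum_subtractf right_diff_distrib)
      also have "\<bar>\<dots>\<bar> \<le> (\<Sum>k\<le>N. \<bar>w N k * ((real k / real N) ^ m - real (k choose m) / real (N choose m))\<bar>)" by (rule sum_abs)
      also have "\<dots> \<le> (\<Sum>k\<le>N. w N k * (real m * real m / (real N - real m)))"
      proof (rule sum_mono)
        fix k assume "k \<in> {..N}"
        then have "\<bar>(real k / real N) ^ m - real (k choose m) / real (N choose m)\<bar> \<le> real m * real m / (real N - real m)"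
          using N by (intro binomial_ratio_approx) auto
        from mult_left_mono[OF this w0[of N k]]
        show "\<bar>w N k * ((real k / real N) ^ m - real (k choose m) / real (N choose m))\<bar> \<le> w N k * (real m * real m / (real N - real m))"
          by (simp only: abs_mult abs_of_nonneg[OF w0])
      qed
      also have "\<dots> = real m * real m / (real N - real m)" by (simp only: sum_distrib_right[symmetric] w1)
      finally show ?thesis by (simp add: N_def)
    qed
    have "(\<lambda>n. real m * real m / (real (Suc n) - real m)) \<longlonglongrightarrow> 0" by real_asymp
    then have "(\<lambda>n. (\<integral>t. cl t ^ m \<partial>\<mu> n) - Re (\<phi> (x ^ m))) \<longlonglongrightarrow> 0"
      by (rule Lim_null_comparison[rotated]) (use diff in \<open>auto intro!: eventually_sequentiallyI[of "Suc (2 * m)"]\<close>)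
    then have "(\<lambda>n. \<integral>t. cl t ^ m \<partial>\<mu> n) \<longlonglongrightarrow> Re (\<phi> (x ^ m))" by (simp add: LIM_zero_iff)
    from LIMSEQ_subseq_LIMSEQ[OF this r] have "(\<lambda>n. \<integral>t. cl t ^ m \<partial>\<mu> (r n)) \<longlonglongrightarrow> Re (\<phi> (x ^ m))" by (simp add: o_def)
    with lim1 have "(\<integral>t. cl t ^ m \<partial>M) = Re (\<phi> (x ^ m))" by (rule LIMSEQ_unique)
    moreover have "(\<integral>t. cl t ^ m \<partial>M) = (\<integral>t. t ^ m \<partial>M)"
      using AE01 measf[OF contm] by (intro integral_cong_AE) (auto simp del: M.events_eq_borel)
    ultimately show ?thesis by simp
  qed
  have "AE t in M. 0 \<le> t \<and> t \<le> 1" using AE01 by eventually_elim (auto simp: cl_def max_def min_def split: if_splits)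
  moreover have "complex_of_real (\<integral>t. t ^ m \<partial>M) = \<phi> (x ^ m)" for m
    using mom[of m] Imx[of m] by (simp add: complex_eq_iff)
  ultimately show ?thesis using M by blast
qed

text \<open>Bounded support makes the Taylor error of the characteristic function at most
  \<open>2 |t C|^n / n!\<close>, so equal moments force equal characteristic functions.\<close>

lemma real_distribution_eqI_moments:
  assumes M: "real_distribution M" "AE x in M. \<bar>x\<bar> \<le> C" and N: "real_distribution N" "AE x in N. \<bar>x\<bar> \<le> C"
    and mom: "\<And>n. (\<integral>x. x ^ n \<partial>M) = (\<integral>x. x ^ n \<partial>N)"
  shows "M = N"
proof (rule Levy_uniqueness[OF M(1) N(1)], rule ext)
  fix t :: real
  define S where "S n = (\<Sum>k\<le>n. ((\<i> * t) ^ k / fact k) * (\<integral>x. x ^ k \<partial>M))" for n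
  have approx: "cmod (char L t - (\<Sum>k\<le>n. ((\<i> * t) ^ k / fact k) * (\<integral>x. x ^ k \<partial>L))) \<le> 2 * \<bar>t * C\<bar> ^ n / fact n"
    if L: "real_distribution L" "AE x in L. \<bar>x\<bar> \<le> C" for L and n :: nat
  proof -
    interpret real_distribution L by (rule L)
    have C: "AE x in L. \<bar>x\<bar> \<le> \<bar>C\<bar>" using L(2) by eventually_elim auto
    have AE: "AE x in L. \<bar>x\<bar> ^ k \<le> \<bar>C\<bar> ^ k" for k
      using C by eventually_elim (auto intro: power_mono)
    have int: "integrable L (\<lambda>x. x ^ k)" for k
      by (rule integrable_const_bound[of _ "\<bar>C\<bar> ^ k"]) (use AE[of k] in \<open>auto simp: power_abs\<close>)
    have "expectation (\<lambda>x. \<bar>x\<bar> ^ n) \<le> expectation (\<lambda>x. \<bar>C\<bar> ^ n)"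
      using AE[of n] int[of n] by (intro integral_mono_AE) (auto simp: power_abs[symmetric] intro: integrable_abs)
    then have "expectation (\<lambda>x. \<bar>x\<bar> ^ n) \<le> \<bar>C\<bar> ^ n" using prob_space by simp
    then have "(2 * \<bar>t\<bar> ^ n / fact n) * expectation (\<lambda>x. \<bar>x\<bar> ^ n) \<le> (2 * \<bar>t\<bar> ^ n / fact n) * \<bar>C\<bar> ^ n"
      by (intro mult_left_mono) auto
    also have "\<dots> = 2 * \<bar>t * C\<bar> ^ n / fact n" by (simp add: abs_mult power_mult_distrib)
    finally have e: "(2 * \<bar>t\<bar> ^ n / fact n) * expectation (\<lambda>x. \<bar>x\<bar> ^ n) \<le> 2 * \<bar>t * C\<bar> ^ n / fact n" .
    show ?thesis by (rule order_trans[OF char_approx1 e]) (rule int)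
  qed
  have "(\<lambda>n. inverse (fact n) * \<bar>t * C\<bar> ^ n) \<longlonglongrightarrow> 0"
    by (rule summable_LIMSEQ_zero[OF summable_exp])
  then have "(\<lambda>n. 4 * (inverse (fact n) * \<bar>t * C\<bar> ^ n)) \<longlonglongrightarrow> 0" by (rule tendsto_mult_right_zero)
  then have "(\<lambda>n. 2 * (2 * \<bar>t * C\<bar> ^ n / fact n)) \<longlonglongrightarrow> 0" by (simp add: divide_inverse mult_ac)
  moreover have "cmod (char M t - char N t) \<le> 2 * (2 * \<bar>t * C\<bar> ^ n / fact n)" for n
    using approx[OF M, of n] approx[OF N, of n] norm_triangle_ineq4[of "char M t - S n" "char N t - S n"]
    by (simp add: S_def mom)
  ultimately have "cmod (char M t - char N t) \<le> 0" by (intro LIMSEQ_le_const) auto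
  then show "char M t = char N t" by simp
qed

text \<open>The additional power \<open>x ^ m\<close> strengthens the induction: an affine factor is
  split off, and its second summand raises \<open>m\<close>. The identity serves both the affine
  change of variables and the terms of the Neumann series.\<close>

lemma integral_affine_moments:
  fixes \<phi> :: "'a::cstar_algebra \<Rightarrow> complex"
  assumes st: "state_space \<phi>" and M: "real_distribution M" and C: "AE x in M. \<bar>x\<bar> \<le> C"
    and mom: "\<And>n. complex_of_real (\<integral>x. x ^ n \<partial>M) = \<phi> (s ^ n)"
  shows "(\<integral>x. (\<alpha> + \<beta> * complex_of_real x) ^ n * of_real x ^ m \<partial>M) = \<phi> ((cscale \<alpha> 1 + cscale \<beta> s) ^ n * s ^ m)"
    and "integrable M (\<lambda>x. (\<alpha> + \<beta> * complex_of_real x) ^ n * of_real x ^ m)"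
proof -
  interpret state_space \<phi> by (rule st)
  interpret real_distribution M by (rule M)
  have AEC: "AE x in M. \<bar>x\<bar> \<le> \<bar>C\<bar>" using C by eventually_elim auto
  have int: "integrable M (\<lambda>x. (\<alpha> + \<beta> * complex_of_real x) ^ n * of_real x ^ m)" for n m
  proof (rule integrable_const_bound)
    show "AE x in M. norm ((\<alpha> + \<beta> * complex_of_real x) ^ n * of_real x ^ m) \<le> (cmod \<alpha> + cmod \<beta> * \<bar>C\<bar>) ^ n * \<bar>C\<bar> ^ m"
      using AEC
    proof eventually_elim
      fix x assume x: "\<bar>x\<bar> \<le> \<bar>C\<bar>"
      have "cmod (\<alpha> + \<beta> * complex_of_real x) \<le> cmod \<alpha> + cmod \<beta> * \<bar>x\<bar>"
        using norm_triangle_ineq[of \<alpha> "\<beta> * of_real x"] by (simp add: norm_mult)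
      also have "\<dots> \<le> cmod \<alpha> + cmod \<beta> * \<bar>C\<bar>" using x by (simp add: mult_left_mono)
      finally show "norm ((\<alpha> + \<beta> * complex_of_real x) ^ n * of_real x ^ m) \<le> (cmod \<alpha> + cmod \<beta> * \<bar>C\<bar>) ^ n * \<bar>C\<bar> ^ m"
        using x unfolding norm_mult norm_power norm_of_real by (intro mult_mono power_mono) auto
    qed
  qed simp
  show "integrable M (\<lambda>x. (\<alpha> + \<beta> * complex_of_real x) ^ n * of_real x ^ m)" by (rule int)
  show "(\<integral>x. (\<alpha> + \<beta> * complex_of_real x) ^ n * of_real x ^ m \<partial>M) = \<phi> ((cscale \<alpha> 1 + cscale \<beta> s) ^ n * s ^ m)"
  proof (induction n arbitrary: m)
    case 0
    have "(\<integral>x. complex_of_real (x ^ m) \<partial>M) = of_real (\<integral>x. x ^ m \<partial>M)" by (rule integral_complex_of_real)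
    then show ?case using mom[of m] by simp
  next
    case (Suc n)
    have "(\<integral>x. (\<alpha> + \<beta> * complex_of_real x) ^ Suc n * of_real x ^ m \<partial>M)
      = (\<integral>x. \<alpha> * ((\<alpha> + \<beta> * complex_of_real x) ^ n * of_real x ^ m) + \<beta> * ((\<alpha> + \<beta> * complex_of_real x) ^ n * of_real x ^ Suc m) \<partial>M)"
      by (intro Bochner_Integration.integral_cong refl) (simp add: algebra_simps)
    also have "\<dots> = \<alpha> * \<phi> ((cscale \<alpha> 1 + cscale \<beta> s) ^ n * s ^ m) + \<beta> * \<phi> ((cscale \<alpha> 1 + cscale \<beta> s) ^ n * s ^ Suc m)"
      using int[of n m] int[of n "Suc m"] Suc.IH[of m] Suc.IH[of "Suc m"]
      by (simp del: power_Suc)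
    also have "\<dots> = \<phi> ((cscale \<alpha> 1 + cscale \<beta> s) ^ n * (cscale \<alpha> 1 + cscale \<beta> s) * s ^ m)"
      by (simp add: distrib_left distrib_right phi_add cscale_left_mult cscale_right_mult phi_cscale mult.assoc)
    finally show ?case by (simp only: power_Suc2)
  qed
qed

context state_space
begin

lemma ex_spectral_distribution:
  assumes sa: "adj s = s"
  shows "\<exists>M C. real_distribution M \<and> (AE x in M. \<bar>x\<bar> \<le> C) \<and> (\<forall>n. complex_of_real (\<integral>x. x ^ n \<partial>M) = \<phi> (s ^ n))"
proof -
  \<comment> \<open>The summand 1 leaves a margin: \<open>x\<close> lies between \<open>e\<close>
    and \<open>1 - e\<close> for \<open>e = 1 / (2 * C)\<close>, as \<open>hausdorff_moments\<close>
    demands.\<close>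
  define C where "C = norm s + 1"
  have C: "C \<ge> 1" by (simp add: C_def)
  define x where "x = (1 / (2 * C)) *\<^sub>R (of_real C + s)"
  have half: "(1 / (2 * C)) *\<^sub>R (of_real C + of_real C :: 'a) = 1"
    using C by (simp add: of_real_def flip: scaleR_left_distrib)
  have "1 - x = (1 / (2 * C)) *\<^sub>R (of_real C + of_real C) - x" by (simp only: half)
  also have "\<dots> = (1 / (2 * C)) *\<^sub>R (of_real C - s)" by (simp only: x_def scaleR_diff_right[symmetric]) simp
  finally have x1: "1 - x = (1 / (2 * C)) *\<^sub>R (of_real C - s)" .
  define e where "e = 1 / (2 * C)"
  have eo: "of_real e = (1 / (2 * C)) *\<^sub>R (1 :: 'a)" by (simp add: e_def of_real_def)
  have C1: "of_real C = of_real (norm s) + (1 :: 'a)" by (simp add: C_def)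
  have "x - of_real e = (1 / (2 * C)) *\<^sub>R (of_real (norm s) + s)" "1 - x - of_real e = (1 / (2 * C)) *\<^sub>R (of_real (norm s) - s)"
    unfolding x1 eo C1 by (simp_all add: x_def C1 flip: scaleR_diff_right)
  then have "positive_el (x - of_real e)" "positive_el (1 - x - of_real e)"
    using C positive_el_norm_add[OF sa order_refl] positive_el_norm_diff[OF sa order_refl]
    by (simp_all add: positive_el_scaleR)
  moreover have "e > 0" using C by (simp add: e_def)
  ultimately obtain N where N: "real_distribution N" "AE t in N. 0 \<le> t \<and> t \<le> 1" "\<And>m. complex_of_real (\<integral>t. t ^ m \<partial>N) = \<phi> (x ^ m)"
    using hausdorff_moments by blast
  interpret N: real_distribution N by (rule N)
  define f where "f t = - C + 2 * C * t" for t :: real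
  define M where "M = distr N borel f"
  have f[measurable]: "f \<in> borel_measurable borel" unfolding f_def by measurable
  have rM: "real_distribution M" unfolding M_def by (rule N.real_distribution_distr) simp
  have "AE t in N. \<bar>f t\<bar> \<le> C"
    using N(2)
  proof eventually_elim
    fix t assume "0 \<le> t \<and> t \<le> (1::real)"
    then have "0 \<le> C * t" "C * t \<le> C * 1" using C by (auto intro: mult_left_mono)
    then show "\<bar>f t\<bar> \<le> C" by (auto simp: f_def abs_le_iff)
  qed
  then have AEM: "AE x in M. \<bar>x\<bar> \<le> C" unfolding M_def by (subst AE_distr_iff) auto
  have "s = cscale (of_real (- C)) 1 + cscale (of_real (2 * C)) x"
    using C by (simp only: cscale_of_real) (simp add: x_def of_real_def)
  moreover have "complex_of_real (\<integral>x. x ^ n \<partial>M) = \<phi> ((cscale (of_real (- C)) 1 + cscale (of_real (2 * C)) x) ^ n)" for n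
  proof -
    have N1: "AE t in N. \<bar>t\<bar> \<le> 1" using N(2) by eventually_elim auto
    have "(\<integral>x. x ^ n \<partial>M) = (\<integral>t. f t ^ n \<partial>N)"
      unfolding M_def by (subst integral_distr) auto
    then have "complex_of_real (\<integral>x. x ^ n \<partial>M) = (\<integral>t. complex_of_real (f t ^ n) \<partial>N)"
      by (simp only: integral_complex_of_real)
    also have "\<dots> = (\<integral>t. (of_real (- C) + of_real (2 * C) * complex_of_real t) ^ n * of_real t ^ 0 \<partial>N)"
      by (simp add: f_def)
    also have "\<dots> = \<phi> ((cscale (of_real (- C)) 1 + cscale (of_real (2 * C)) x) ^ n * x ^ 0)"
      by (rule integral_affine_moments(1)[OF state_space_axioms N(1) N1 N(3)])
    finally show ?thesis by simp
  qed
  ultimately have "\<forall>n. complex_of_real (\<integral>x. x ^ n \<partial>M) = \<phi> (s ^ n)" by simp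
  then show ?thesis using rM AEM by blast
qed

text \<open>Existence and uniqueness justify the definite description in
  \<open>distribution\<close>; for uniqueness two candidates are placed on a common bounded
  interval.\<close>

lemma distribution_props:
  assumes sa: "adj s = s"
  shows "real_distribution (distribution \<phi> s)" "\<exists>C. AE x in distribution \<phi> s. \<bar>x\<bar> \<le> C"
    "complex_of_real (\<integral>x. x ^ n \<partial>distribution \<phi> s) = \<phi> (s ^ n)"
proof -
  let ?P = "\<lambda>M. prob_space M \<and> sets M = sets borel \<and> (\<exists>C. emeasure M (- {-C..C}) = 0)
      \<and> (\<forall>n. complex_of_real (\<integral>x. x ^ n \<partial>M) = \<phi> (s ^ n))"
  have P: "?P M \<longleftrightarrow> real_distribution M \<and> (\<exists>C. AE x in M. \<bar>x\<bar> \<le> C) \<and> (\<forall>n. complex_of_real (\<integral>x. x ^ n \<partial>M) = \<phi> (s ^ n))" for M :: "real measure"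
  proof -
    have "(emeasure M (- {-C..C}) = 0) \<longleftrightarrow> (AE x in M. \<bar>x\<bar> \<le> C)" if "sets M = sets borel" for C
    proof -
      have "space M = UNIV" using that sets_eq_imp_space_eq by fastforce
      then have "{x \<in> space M. \<not> \<bar>x\<bar> \<le> C} = - {-C..C}" by (auto simp: abs_le_iff)
      moreover have "- {-C..C} \<in> sets M" using that by simp
      ultimately show ?thesis by (subst AE_iff_measurable[of "- {-C..C}"]) auto
    qed
    then show ?thesis unfolding real_distribution_def real_distribution_axioms_def by blast
  qed
  obtain M C where M: "real_distribution M" "AE x in M. \<bar>x\<bar> \<le> C" "\<And>n. complex_of_real (\<integral>x. x ^ n \<partial>M) = \<phi> (s ^ n)"
    using ex_spectral_distribution[OF sa] by blast
  have "?P (distribution \<phi> s)" unfolding distribution_def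
  proof (rule theI[of ?P M])
    show "?P M" unfolding P using M by blast
    fix N assume "?P N"
    then obtain C' where N: "real_distribution N" "AE x in N. \<bar>x\<bar> \<le> C'" "\<And>n. complex_of_real (\<integral>x. x ^ n \<partial>N) = \<phi> (s ^ n)"
      unfolding P by blast
    have "AE x in M. \<bar>x\<bar> \<le> max C C'" using M(2) by eventually_elim auto
    moreover have "AE x in N. \<bar>x\<bar> \<le> max C C'" using N(2) by eventually_elim auto
    moreover have "(\<integral>x. x ^ n \<partial>N) = (\<integral>x. x ^ n \<partial>M)" for n using M(3)[of n] N(3)[of n] by (metis of_real_eq_iff)
    ultimately show "N = M" using M(1) N(1) by (intro real_distribution_eqI_moments) auto
  qed
  then show "real_distribution (distribution \<phi> s)" "\<exists>C. AE x in distribution \<phi> s. \<bar>x\<bar> \<le> C"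
    "complex_of_real (\<integral>x. x ^ n \<partial>distribution \<phi> s) = \<phi> (s ^ n)" unfolding P by blast+
qed

lemma im_el_resolvent:
  assumes "adj s = s"
  shows "im_el (cscale z 1 - s) = of_real (Im z)"
proof -
  have "z - cnj z = 2 * \<i> * of_real (Im z)" by (simp add: complex_eq_iff)
  then have "(z - cnj z) / (2 * \<i>) = of_real (Im z)" by simp
  then show ?thesis
    by (simp add: im_el_def adj_diff adj_cscale assms cscale_cscale flip: cscale_diff_left cscale_of_real_one)
qed

lemma resolvent_invertible:
  assumes "adj s = s" "Im z > 0"
  shows "invertible_el (cscale z 1 - s)"
  by (rule invertible_of_im_el(1)[of _ "Im z"]) (use assms in \<open>simp_all add: im_el_resolvent\<close>)

text \<open>Both sides are the sums of the same Neumann series, that of \<open>1 - (1 + it(z - x))\<close> for small \<open>t > 0\<close>.\<close>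

lemma cauchy_scalar_eq_integral:
  assumes sa: "adj s = s" and z: "Im z > 0"
  shows "cauchy_scalar \<phi> s z = (\<integral>x. 1 / (z - complex_of_real x) \<partial>distribution \<phi> s)"
    and "integrable (distribution \<phi> s) (\<lambda>x. 1 / (z - complex_of_real x))"
proof -
  let ?M = "distribution \<phi> s"
  interpret M: real_distribution ?M using distribution_props(1)[OF sa] .
  note mom = distribution_props(3)[OF sa]
  obtain C where C: "AE x in ?M. \<bar>x\<bar> \<le> C" using distribution_props(2)[OF sa] by blast
  define T where "T = cscale z 1 - s"
  define v where "v = Im z"
  have v: "v > 0" using z by (simp add: v_def)
  have pos: "positive_el (im_el T - of_real v)" by (simp add: T_def im_el_resolvent sa v_def)
  note invT = invertible_of_im_el(1)[OF pos v]
  obtain t0 where t0: "t0 > 0" "\<And>t. 0 < t \<Longrightarrow> t \<le> t0 \<Longrightarrow> norm (1 - cscale (- \<i> * of_real t) T) \<le> 1 - t * v / 2"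
    using invertible_of_im_el(4)[OF pos v] by blast
  define K where "K = v\<^sup>2 + (\<bar>Re z\<bar> + \<bar>C\<bar>)\<^sup>2"
  have K: "K > 0" using v by (simp add: K_def add_pos_nonneg)
  define t where "t = min (min t0 (v / K)) (1 / v)"
  have t: "t > 0" "t \<le> t0" "t * K \<le> v" "t * v \<le> 1"
  proof -
    show "t > 0" using t0 v K by (simp add: t_def)
    show "t \<le> t0" by (simp add: t_def)
    have "t \<le> v / K" "t \<le> 1 / v" by (simp_all add: t_def)
    then show "t * K \<le> v" "t * v \<le> 1" using K v by (simp_all add: field_simps)
  qed
  define g where "g = - \<i> * complex_of_real t"
  have g0: "g \<noteq> 0" using t by (simp add: g_def)
  define q where "q = sqrt (1 - t * v)"
  have q: "0 \<le> q" "q < 1" using t v by (auto simp: q_def)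
  define h where "h x = (1 - g * z) + g * complex_of_real x" for x
  have hx: "h x = 1 - g * (z - of_real x)" for x by (simp add: h_def algebra_simps)
  have hq: "cmod (h x) \<le> q" if "\<bar>x\<bar> \<le> C" for x
  proof -
    have "h x = Complex (1 - t * v) (t * (Re z - x))" by (simp add: hx g_def complex_eq_iff v_def)
    then have "(cmod (h x))\<^sup>2 = (1 - t * v)\<^sup>2 + (t * (Re z - x))\<^sup>2" by (simp add: cmod_power2)
    also have "\<dots> = 1 - 2 * (t * v) + t * (t * (v\<^sup>2 + (Re z - x)\<^sup>2))" by (simp add: power2_eq_square algebra_simps)
    also have "\<dots> \<le> 1 - 2 * (t * v) + t * (t * K)"
    proof -
      have "(Re z - x)\<^sup>2 \<le> (\<bar>Re z\<bar> + \<bar>C\<bar>)\<^sup>2" using that by (intro abs_le_square_iff[THEN iffD1]) auto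
      then show ?thesis using t by (simp add: K_def mult_left_mono)
    qed
    also have "\<dots> \<le> 1 - 2 * (t * v) + t * v" using t by (simp add: mult_left_mono)
    also have "\<dots> = q\<^sup>2" using t by (simp add: q_def)
    finally show ?thesis using q(1) by (rule power2_le_imp_le)
  qed
  have AEh: "AE x in ?M. cmod (h x) \<le> q" using C by eventually_elim (rule hq)
  have gT: "norm (1 - cscale g T) < 1"
  proof -
    have "norm (1 - cscale g T) \<le> 1 - t * v / 2" using t0(2) t by (simp add: g_def)
    then show ?thesis using t v by (smt (verit) divide_pos_pos mult_pos_pos)
  qed
  have e: "1 - cscale g T = cscale (1 - g * z) 1 + cscale g s"
    by (simp add: T_def cscale_diff_left cscale_diff_right cscale_cscale)
  have ih: "integrable ?M (\<lambda>x. h x ^ n)" "(\<integral>x. h x ^ n \<partial>?M) = \<phi> ((1 - cscale g T) ^ n)" for n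
    using integral_affine_moments[OF state_space_axioms M.real_distribution_axioms C mom, of "1 - g * z" g n 0]
    by (simp_all add: h_def e)
  have AEs: "AE x in ?M. summable (\<lambda>n. norm (h x ^ n))"
    using AEh by eventually_elim (use q in \<open>auto simp: norm_power intro!: summable_geometric\<close>)
  have sumn: "summable (\<lambda>n. \<integral>x. norm (h x ^ n) \<partial>?M)"
  proof (rule summable_comparison_test[OF _ summable_geometric[of q]])
    have "norm (\<integral>x. norm (h x ^ n) \<partial>?M) \<le> q ^ n" for n
    proof -
      have "(\<integral>x. norm (h x ^ n) \<partial>?M) \<le> (\<integral>x. q ^ n \<partial>?M)"
        using AEh by (intro integral_mono_AE integrable_norm ih(1)) (auto simp: norm_power elim!: eventually_mono intro: power_mono)
      then show ?thesis using M.prob_space by simp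
    qed
    then show "\<exists>N. \<forall>n\<ge>N. norm (\<integral>x. norm (h x ^ n) \<partial>?M) \<le> q ^ n" by blast
  qed (use q in simp)
  have sumh: "(\<Sum>n. h x ^ n) = 1 / (g * (z - of_real x))" if "cmod (h x) \<le> q" for x
  proof -
    have "(\<Sum>n. h x ^ n) = 1 / (1 - h x)" using that q by (intro suminf_geometric) simp
    then show ?thesis by (simp add: hx)
  qed
  have S1: "(\<lambda>n. \<integral>x. h x ^ n \<partial>?M) sums (\<integral>x. (\<Sum>n. h x ^ n) \<partial>?M)"
    by (rule sums_integral[OF ih(1) AEs sumn])
  have int1: "integrable ?M (\<lambda>x. \<Sum>n. h x ^ n)" by (rule integrable_suminf[OF ih(1) AEs sumn])
  have AEeq: "AE x in ?M. g * (\<Sum>n. h x ^ n) = 1 / (z - of_real x)"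
    using AEh by eventually_elim (use g0 in \<open>simp add: sumh\<close>)
  have meas: "(\<lambda>x. 1 / (z - complex_of_real x)) \<in> borel_measurable ?M" by measurable
  have meas': "(\<lambda>x. g * (\<Sum>n. h x ^ n)) \<in> borel_measurable ?M"
    by (rule borel_measurable_times[OF borel_measurable_const borel_measurable_integrable[OF int1]])
  have "integrable ?M (\<lambda>x. g * (\<Sum>n. h x ^ n))" using int1 by (rule integrable_mult_right)
  then show "integrable ?M (\<lambda>x. 1 / (z - complex_of_real x))"
    by (rule integrable_cong_AE[THEN iffD1, OF meas' meas AEeq])
  have "(\<lambda>n. (1 - cscale g T) ^ n) sums inverse_el (cscale g T)" by (rule neumann_series(3)[OF gT])
  from bounded_linear.sums[OF bounded_linear_phi this]
  have "(\<lambda>n. \<integral>x. h x ^ n \<partial>?M) sums \<phi> (inverse_el (cscale g T))" by (simp add: ih(2))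
  with S1 have "\<phi> (inverse_el (cscale g T)) = (\<integral>x. (\<Sum>n. h x ^ n) \<partial>?M)" by (rule sums_unique2[symmetric])
  moreover have "inverse_el T = cscale g (inverse_el (cscale g T))"
  proof -
    have i: "invertible_el (cscale g T)" using invT g0 by (simp add: invertible_el_cscale_iff)
    show ?thesis by (rule inverse_elI) (use inverse_el[OF i] in \<open>simp_all add: cscale_left_mult cscale_right_mult\<close>)
  qed
  ultimately have "\<phi> (inverse_el T) = (\<integral>x. g * (\<Sum>n. h x ^ n) \<partial>?M)" by (simp add: phi_cscale)
  also have "\<dots> = (\<integral>x. 1 / (z - of_real x) \<partial>?M)"
    by (rule integral_cong_AE[OF meas' meas AEeq])
  finally show "cauchy_scalar \<phi> s z = (\<integral>x. 1 / (z - complex_of_real x) \<partial>?M)" by (simp add: cauchy_scalar_def T_def)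
qed

text \<open>\<open>(z - s)\<^sup>-\<^sup>1\<close> is normal, and \<open>R - R\<^sup>* = -2i Im z R\<^sup>* R\<close>.\<close>

lemma phi_resolvent_square:
  fixes t \<epsilon> :: real
  assumes sa: "adj s = s" and \<epsilon>: "\<epsilon> > 0"
  defines "R \<equiv> inverse_el (cscale (Complex t \<epsilon>) 1 - s)"
  shows "ennreal (Re (\<phi> (adj R * R))) = (\<integral>\<^sup>+x. ennreal (1 / ((t - x)\<^sup>2 + \<epsilon>\<^sup>2)) \<partial>distribution \<phi> s)"
    and "Re (\<phi> (R * adj R)) = Re (\<phi> (adj R * R))"
    and "Im (cauchy_scalar \<phi> s (Complex t \<epsilon>)) = - \<epsilon> * Re (\<phi> (adj R * R))"
proof -
  let ?z = "Complex t \<epsilon>" and ?M = "distribution \<phi> s"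
  define T where "T = cscale ?z 1 - s"
  have iT: "invertible_el T" using resolvent_invertible[OF sa, of ?z] \<epsilon> by (simp add: T_def)
  have RT: "R = inverse_el T" by (simp add: R_def T_def)
  have R: "T * R = 1" "R * T = 1" using inverse_el[OF iT] by (simp_all add: RT)
  have aR: "adj R * adj T = 1" "adj T * adj R = 1" using R by (simp_all flip: adj_mult)
  have TT: "adj T - T = cscale (- 2 * \<i> * of_real \<epsilon>) 1"
  proof -
    have "cnj ?z - ?z = - 2 * \<i> * of_real \<epsilon>" by (simp add: complex_eq_iff)
    then show ?thesis by (simp add: T_def adj_diff adj_cscale sa flip: cscale_diff_left)
  qed
  have "R - adj R = adj R * (adj T - T) * R"
    using R aR by (simp add: right_diff_distrib left_diff_distrib mult.assoc)
  then have e1: "R - adj R = cscale (- 2 * \<i> * of_real \<epsilon>) (adj R * R)"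
    by (simp add: TT cscale_left_mult cscale_right_mult)
  have "R - adj R = R * (adj T - T) * adj R"
    using R aR by (simp add: right_diff_distrib left_diff_distrib mult.assoc)
  then have e2: "R - adj R = cscale (- 2 * \<i> * of_real \<epsilon>) (R * adj R)"
    by (simp add: TT cscale_left_mult cscale_right_mult)
  have "(- 2 * \<i> * of_real \<epsilon>) * \<phi> (adj R * R) = (- 2 * \<i> * of_real \<epsilon>) * \<phi> (R * adj R)"
    using e1 e2 by (simp flip: phi_cscale)
  then have eq: "\<phi> (adj R * R) = \<phi> (R * adj R)" using \<epsilon> by simp
  then show "Re (\<phi> (R * adj R)) = Re (\<phi> (adj R * R))" by simp
  have "\<phi> R - cnj (\<phi> R) = (- 2 * \<i> * of_real \<epsilon>) * \<phi> (adj R * R)"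
    using e1 by (metis phi_cscale phi_diff phi_adj)
  then have "Im (\<phi> R - cnj (\<phi> R)) = Im ((- 2 * \<i> * of_real \<epsilon>) * \<phi> (adj R * R))" by simp
  then have Im: "Im (\<phi> R) = - \<epsilon> * Re (\<phi> (adj R * R))" by simp
  then show "Im (cauchy_scalar \<phi> s ?z) = - \<epsilon> * Re (\<phi> (adj R * R))" by (simp add: cauchy_scalar_def R_def)
  interpret M: real_distribution ?M using distribution_props(1)[OF sa] .
  have z: "Im ?z > 0" using \<epsilon> by simp
  note int = cauchy_scalar_eq_integral[OF sa z]
  have im: "Im (1 / (?z - complex_of_real x)) = - \<epsilon> * (1 / ((t - x)\<^sup>2 + \<epsilon>\<^sup>2))" for x
    by (simp add: Im_divide power2_eq_square)
  have "\<phi> R = (\<integral>x. 1 / (?z - complex_of_real x) \<partial>?M)" using int(1) by (simp add: cauchy_scalar_def R_def)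
  then have "Im (\<phi> R) = (\<integral>x. Im (1 / (?z - complex_of_real x)) \<partial>?M)" using int(2) by simp
  also have "\<dots> = - \<epsilon> * (\<integral>x. 1 / ((t - x)\<^sup>2 + \<epsilon>\<^sup>2) \<partial>?M)" unfolding im by (rule integral_mult_right_zero)
  finally have val: "Re (\<phi> (adj R * R)) = (\<integral>x. 1 / ((t - x)\<^sup>2 + \<epsilon>\<^sup>2) \<partial>?M)" using Im \<epsilon> by simp
  have "integrable ?M (\<lambda>x. Im (1 / (?z - complex_of_real x)))" using int(2) by (rule integrable_Im)
  then have "integrable ?M (\<lambda>x. (- 1 / \<epsilon>) * (- \<epsilon> * (1 / ((t - x)\<^sup>2 + \<epsilon>\<^sup>2))))"
    unfolding im by (rule integrable_mult_right)
  then have "integrable ?M (\<lambda>x. 1 / ((t - x)\<^sup>2 + \<epsilon>\<^sup>2))" using \<epsilon> by simp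
  then show "ennreal (Re (\<phi> (adj R * R))) = (\<integral>\<^sup>+x. ennreal (1 / ((t - x)\<^sup>2 + \<epsilon>\<^sup>2)) \<partial>?M)"
    unfolding val by (intro nn_integral_eq_integral[symmetric]) auto
qed

end

section \<open>Poisson smoothing and the Levy distance\<close>

lemma poisson_kernel_atLeast:
  assumes \<epsilon>: "\<epsilon> > 0"
  shows "(\<integral>\<^sup>+u. ennreal (\<epsilon> / ((u - x)\<^sup>2 + \<epsilon>\<^sup>2)) * indicator {a..} u \<partial>lborel) = ennreal (pi / 2 - arctan ((a - x) / \<epsilon>))"
proof (rule nn_integral_FTC_atLeast[where F = "\<lambda>u. arctan ((u - x) / \<epsilon>)"])
  fix u
  have "((\<lambda>u. arctan ((u - x) / \<epsilon>)) has_real_derivative inverse (1 + ((u - x) / \<epsilon>)\<^sup>2) * (1 / \<epsilon>)) (at u)"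
    using \<epsilon> by (auto intro!: derivative_eq_intros simp: divide_inverse)
  moreover have "inverse (1 + ((u - x) / \<epsilon>)\<^sup>2) * (1 / \<epsilon>) = \<epsilon> / ((u - x)\<^sup>2 + \<epsilon>\<^sup>2)"
    using \<epsilon> by (simp add: power_divide add_divide_eq_iff divide_add_eq_iff add.commute power2_eq_square)
  ultimately show "((\<lambda>u. arctan ((u - x) / \<epsilon>)) has_real_derivative \<epsilon> / ((u - x)\<^sup>2 + \<epsilon>\<^sup>2)) (at u)" by simp
  show "0 \<le> \<epsilon> / ((u - x)\<^sup>2 + \<epsilon>\<^sup>2)" using \<epsilon> by simp
next
  have "filterlim (\<lambda>u. (u - x) / \<epsilon>) at_top at_top" using \<epsilon> by real_asymp
  then show "((\<lambda>u. arctan ((u - x) / \<epsilon>)) \<longlongrightarrow> pi / 2) at_top"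
    by (rule filterlim_compose[OF tendsto_arctan_at_top])
qed measurable

lemma poisson_kernel_atMost:
  assumes \<epsilon>: "\<epsilon> > 0"
  shows "(\<integral>\<^sup>+u. ennreal (\<epsilon> / ((u - x)\<^sup>2 + \<epsilon>\<^sup>2)) * indicator {..a} u \<partial>lborel) = ennreal (arctan ((a - x) / \<epsilon>) + pi / 2)"
proof -
  have "(\<integral>\<^sup>+u. ennreal (\<epsilon> / ((u - x)\<^sup>2 + \<epsilon>\<^sup>2)) * indicator {..a} u \<partial>lborel)
      = (\<integral>\<^sup>+u. ennreal (\<epsilon> / ((- u - x)\<^sup>2 + \<epsilon>\<^sup>2)) * indicator {..a} (- u) \<partial>lborel)"
    by (subst nn_integral_real_affine[where c="-1" and t=0]) auto
  also have "\<dots> = (\<integral>\<^sup>+u. ennreal (\<epsilon> / ((u - (- x))\<^sup>2 + \<epsilon>\<^sup>2)) * indicator {- a..} u \<partial>lborel)"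
  proof (intro nn_integral_cong)
    fix u
    have "(- u - x)\<^sup>2 = (u - (- x))\<^sup>2" by (simp add: power2_eq_square algebra_simps)
    moreover have "indicator {..a} (- u) = (indicator {- a..} u :: ennreal)" by (auto simp: indicator_def)
    ultimately show "ennreal (\<epsilon> / ((- u - x)\<^sup>2 + \<epsilon>\<^sup>2)) * indicator {..a} (- u)
      = ennreal (\<epsilon> / ((u - (- x))\<^sup>2 + \<epsilon>\<^sup>2)) * indicator {- a..} u" by simp
  qed
  also have "\<dots> = ennreal (pi / 2 - arctan ((- a - (- x)) / \<epsilon>))" by (rule poisson_kernel_atLeast[OF \<epsilon>])
  also have "(- a - (- x)) / \<epsilon> = - ((a - x) / \<epsilon>)" by (simp add: minus_divide_left)
  finally show ?thesis by (simp add: arctan_minus add.commute)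
qed

lemma poisson_kernel_total:
  assumes \<epsilon>: "\<epsilon> > 0"
  shows "(\<integral>\<^sup>+u. ennreal (\<epsilon> / ((u - x)\<^sup>2 + \<epsilon>\<^sup>2)) \<partial>lborel) \<le> ennreal pi"
proof -
  let ?f = "\<lambda>u. ennreal (\<epsilon> / ((u - x)\<^sup>2 + \<epsilon>\<^sup>2))"
  have "(\<integral>\<^sup>+u. ?f u \<partial>lborel) \<le> (\<integral>\<^sup>+u. ?f u * indicator {x..} u + ?f u * indicator {..x} u \<partial>lborel)"
    by (intro nn_integral_mono) (auto simp: indicator_def)
  also have "\<dots> = (\<integral>\<^sup>+u. ?f u * indicator {x..} u \<partial>lborel) + (\<integral>\<^sup>+u. ?f u * indicator {..x} u \<partial>lborel)"
    by (intro nn_integral_add) auto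
  also have "\<dots> = ennreal (pi / 2) + ennreal (pi / 2)"
    by (simp only: poisson_kernel_atLeast[OF \<epsilon>] poisson_kernel_atMost[OF \<epsilon>]) simp
  also have "\<dots> = ennreal pi" by (subst ennreal_plus[symmetric]) auto
  finally show ?thesis .
qed

text \<open>This is \<open>pi\<close> times the density of \<open>M\<close> convolved with the
  Cauchy law of scale \<epsilon>. For a spectral distribution it is minus the imaginary part of the
  Cauchy transform at height \<epsilon>, by \<open>poisson_density_resolvent\<close>.\<close>

definition poisson_density :: "real \<Rightarrow> real measure \<Rightarrow> real \<Rightarrow> ennreal" where
  "poisson_density \<epsilon> M u = (\<integral>\<^sup>+x. ennreal (\<epsilon> / ((u - x)\<^sup>2 + \<epsilon>\<^sup>2)) \<partial>M)"

lemma measurable_poisson_density [measurable]: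
  assumes "real_distribution M"
  shows "poisson_density \<epsilon> M \<in> borel_measurable lborel"
proof -
  interpret real_distribution M by fact
  show ?thesis unfolding poisson_density_def by measurable
qed

lemma poisson_density_Fubini:
  assumes "real_distribution M" and [measurable]: "A \<in> sets borel"
  shows "(\<integral>\<^sup>+u. poisson_density \<epsilon> M u * indicator A u \<partial>lborel)
    = (\<integral>\<^sup>+x. \<integral>\<^sup>+u. ennreal (\<epsilon> / ((u - x)\<^sup>2 + \<epsilon>\<^sup>2)) * indicator A u \<partial>lborel \<partial>M)"
proof -
  interpret real_distribution M by fact
  interpret pair_sigma_finite M lborel ..
  have "(\<integral>\<^sup>+u. poisson_density \<epsilon> M u * indicator A u \<partial>lborel)
    = (\<integral>\<^sup>+u. \<integral>\<^sup>+x. ennreal (\<epsilon> / ((u - x)\<^sup>2 + \<epsilon>\<^sup>2)) * indicator A u \<partial>M \<partial>lborel)"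
    unfolding poisson_density_def by (intro nn_integral_cong nn_integral_multc[symmetric]) measurable
  also have "\<dots> = (\<integral>\<^sup>+x. \<integral>\<^sup>+u. ennreal (\<epsilon> / ((u - x)\<^sup>2 + \<epsilon>\<^sup>2)) * indicator A u \<partial>lborel \<partial>M)"
    by (rule Fubini') measurable
  finally show ?thesis .
qed

lemma poisson_density_total:
  assumes M: "real_distribution M" and \<epsilon>: "\<epsilon> > 0"
  shows "(\<integral>\<^sup>+u. poisson_density \<epsilon> M u \<partial>lborel) \<le> ennreal pi"
proof -
  interpret real_distribution M by fact
  have "(\<integral>\<^sup>+u. poisson_density \<epsilon> M u \<partial>lborel) = (\<integral>\<^sup>+x. \<integral>\<^sup>+u. ennreal (\<epsilon> / ((u - x)\<^sup>2 + \<epsilon>\<^sup>2)) \<partial>lborel \<partial>M)"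
    using poisson_density_Fubini[OF M, of UNIV \<epsilon>] by simp
  also have "\<dots> \<le> (\<integral>\<^sup>+x. ennreal pi \<partial>M)" by (intro nn_integral_mono poisson_kernel_total[OF \<epsilon>])
  also have "\<dots> = ennreal pi" using emeasure_space_1 by simp
  finally show ?thesis .
qed

text \<open>The distribution function of that convolution, the kernel being already integrated;
  \<open>poisson_cdf_eq\<close> gives the link to the density.\<close>

definition poisson_cdf :: "real \<Rightarrow> real measure \<Rightarrow> real \<Rightarrow> real" where
  "poisson_cdf \<epsilon> M t = (\<integral>x. arctan ((t - x) / \<epsilon>) / pi + 1 / 2 \<partial>M)"

lemma arctan_bounds01: "0 \<le> arctan y / pi + 1 / 2" "arctan y / pi + 1 / 2 \<le> 1"
  using arctan_bounded[of y] by (auto simp: field_simps)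

lemma integrable_arctan:
  assumes "real_distribution M"
  shows "integrable M (\<lambda>x. arctan ((t - x) / \<epsilon>) / pi + 1 / 2)"
proof -
  interpret real_distribution M by fact
  show ?thesis
    by (rule integrable_const_bound[of _ 1]) (use arctan_bounds01 in \<open>auto simp: abs_of_nonneg\<close>)
qed

lemma poisson_cdf_eq:
  assumes M: "real_distribution M" and \<epsilon>: "\<epsilon> > 0"
  shows "(\<integral>\<^sup>+u. poisson_density \<epsilon> M u * indicator {..t} u \<partial>lborel) = ennreal (pi * poisson_cdf \<epsilon> M t)"
proof -
  have "(\<integral>\<^sup>+u. poisson_density \<epsilon> M u * indicator {..t} u \<partial>lborel) = (\<integral>\<^sup>+x. ennreal (pi * (arctan ((t - x) / \<epsilon>) / pi + 1 / 2)) \<partial>M)"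
    using poisson_density_Fubini[OF M, of "{..t}" \<epsilon>] by (simp add: poisson_kernel_atMost[OF \<epsilon>] distrib_left)
  also have "\<dots> = ennreal (\<integral>x. pi * (arctan ((t - x) / \<epsilon>) / pi + 1 / 2) \<partial>M)"
    using arctan_bounds01(1) by (intro nn_integral_eq_integral integrable_mult_right integrable_arctan[OF M]) (auto intro!: mult_nonneg_nonneg)
  also have "(\<integral>x. pi * (arctan ((t - x) / \<epsilon>) / pi + 1 / 2) \<partial>M) = pi * poisson_cdf \<epsilon> M t"
    unfolding poisson_cdf_def by (rule integral_mult_right_zero)
  finally show ?thesis .
qed

lemma poisson_cdf_nonneg: "real_distribution M \<Longrightarrow> poisson_cdf \<epsilon> M t \<ge> 0"
  unfolding poisson_cdf_def using arctan_bounds01 by (intro Bochner_Integration.integral_nonneg) auto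

text \<open>The densities take values in \<open>ennreal\<close>, so their closeness is expressed by
  adding a dominating \<open>b\<close> instead of by a difference.\<close>

lemma poisson_cdf_le:
  assumes M: "real_distribution M" and N: "real_distribution N" and \<epsilon>: "\<epsilon> > 0" and \<kappa>: "\<kappa> \<ge> 0"
    and [measurable]: "b \<in> borel_measurable lborel" and b: "(\<integral>\<^sup>+u. b u \<partial>lborel) \<le> ennreal (pi * \<kappa>)"
    and le: "\<And>u. poisson_density \<epsilon> M u \<le> poisson_density \<epsilon> N u + b u"
  shows "poisson_cdf \<epsilon> M t \<le> poisson_cdf \<epsilon> N t + \<kappa>"
proof -
  note [measurable] = measurable_poisson_density[OF M] measurable_poisson_density[OF N]
  have "ennreal (pi * poisson_cdf \<epsilon> M t) \<le> (\<integral>\<^sup>+u. poisson_density \<epsilon> N u * indicator {..t} u + b u \<partial>lborel)"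
    unfolding poisson_cdf_eq[OF M \<epsilon>, symmetric] using le by (intro nn_integral_mono) (auto simp: indicator_def)
  also have "\<dots> = (\<integral>\<^sup>+u. poisson_density \<epsilon> N u * indicator {..t} u \<partial>lborel) + (\<integral>\<^sup>+u. b u \<partial>lborel)"
    by (rule nn_integral_add) measurable
  also have "\<dots> \<le> ennreal (pi * poisson_cdf \<epsilon> N t) + ennreal (pi * \<kappa>)"
    unfolding poisson_cdf_eq[OF N \<epsilon>] using b by (intro add_mono) auto
  also have "\<dots> = ennreal (pi * (poisson_cdf \<epsilon> N t + \<kappa>))"
    using \<kappa> poisson_cdf_nonneg[OF N] by (simp add: distrib_left ennreal_plus)
  finally have "pi * poisson_cdf \<epsilon> M t \<le> pi * (poisson_cdf \<epsilon> N t + \<kappa>)"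
    using \<kappa> poisson_cdf_nonneg[OF N] by (subst (asm) ennreal_le_iff) auto
  then show ?thesis by simp
qed

text \<open>The Cauchy law of scale \<epsilon> has mass
  \<open>arctan (\<epsilon> / \<eta>) / pi\<close>, hence at most
  \<open>\<epsilon> / (pi * \<eta>)\<close>, to the right of \<eta>. The choice of \<eta> makes this
  bound equal to \<eta>, since the Levy distance weighs horizontal and vertical shifts
  alike.\<close>

lemma arctan_tail:
  assumes "\<epsilon> > 0" "\<eta> > 0" "\<eta>\<^sup>2 = \<epsilon> / pi"
  shows "arctan (\<eta> / \<epsilon>) / pi + 1 / 2 \<ge> 1 - \<eta>"
proof -
  have "arctan (\<epsilon> / \<eta>) = pi / 2 - arctan (\<eta> / \<epsilon>)"
    using arctan_inverse[of "\<eta> / \<epsilon>"] assms by (simp add: sgn_if)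
  moreover have "arctan (\<epsilon> / \<eta>) \<le> \<epsilon> / \<eta>" using assms by (intro arctan_le_self) auto
  moreover have "\<epsilon> / \<eta> = pi * \<eta>" using assms by (simp add: field_simps power2_eq_square)
  ultimately have "pi / 2 - arctan (\<eta> / \<epsilon>) \<le> pi * \<eta>" by simp
  then have "(pi / 2 - arctan (\<eta> / \<epsilon>)) / pi \<le> \<eta>" by (simp add: divide_le_eq mult.commute)
  then show ?thesis by (simp add: diff_divide_distrib)
qed

text \<open>The inequalities hold already between the integrands: the smoothed step is compared with
  the step moved by \<eta>, and \<open>arctan_tail\<close> controls it beyond the jump.\<close>

lemma cdf_poisson_cdf:
  assumes M: "real_distribution M" and \<epsilon>: "\<epsilon> > 0" and \<eta>: "\<eta> > 0" "\<eta>\<^sup>2 = \<epsilon> / pi"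
  shows "cdf_of M (t - \<eta>) - \<eta> \<le> poisson_cdf \<epsilon> M t" "poisson_cdf \<epsilon> M t \<le> cdf_of M (t + \<eta>) + \<eta>"
proof -
  interpret real_distribution M by fact
  note tail = arctan_tail[OF \<epsilon> \<eta>]
  have ind: "(\<integral>x. indicator {..a} x \<partial>M) = cdf_of M a" for a by (simp add: cdf_of_def)
  have int: "integrable M (\<lambda>x. indicator {..a} x :: real)" for a :: real
    by (intro integrable_const_bound[of _ 1]) auto
  have pu: "measure M UNIV = 1" using prob_space by simp
  have lower: "indicator {..t - \<eta>} x - \<eta> \<le> arctan ((t - x) / \<epsilon>) / pi + 1 / 2" for x
  proof (cases "x \<le> t - \<eta>")
    case True
    then have "arctan (\<eta> / \<epsilon>) \<le> arctan ((t - x) / \<epsilon>)" using \<epsilon> by (intro arctan_monotone') (auto simp: divide_right_mono)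
    then have "arctan (\<eta> / \<epsilon>) / pi \<le> arctan ((t - x) / \<epsilon>) / pi" by (simp add: divide_right_mono)
    then show ?thesis using tail True by simp
  next
    case False
    then show ?thesis using arctan_bounds01(1)[of "(t - x) / \<epsilon>"] \<eta> by simp
  qed
  have upper: "arctan ((t - x) / \<epsilon>) / pi + 1 / 2 \<le> indicator {..t + \<eta>} x + \<eta>" for x
  proof (cases "x \<le> t + \<eta>")
    case True
    then show ?thesis using arctan_bounds01(2)[of "(t - x) / \<epsilon>"] \<eta> by simp
  next
    case False
    then have "(t - x) / \<epsilon> \<le> - (\<eta> / \<epsilon>)" using \<epsilon> by (simp add: pos_divide_le_eq)
    then have "arctan ((t - x) / \<epsilon>) \<le> arctan (- (\<eta> / \<epsilon>))" by (rule arctan_monotone')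
    then have "arctan ((t - x) / \<epsilon>) \<le> - arctan (\<eta> / \<epsilon>)" by (simp only: arctan_minus)
    then have "arctan ((t - x) / \<epsilon>) / pi \<le> - arctan (\<eta> / \<epsilon>) / pi"
      by (rule divide_right_mono) simp
    then show ?thesis using tail False by simp
  qed
  have "(\<integral>x. indicator {..t - \<eta>} x - \<eta> \<partial>M) \<le> poisson_cdf \<epsilon> M t"
    unfolding poisson_cdf_def using lower int by (intro integral_mono integrable_arctan[OF M]) auto
  moreover have "(\<integral>x. indicator {..t - \<eta>} x - \<eta> \<partial>M) = cdf_of M (t - \<eta>) - \<eta>"
    using int[of "t - \<eta>"] ind[of "t - \<eta>"] pu by (subst Bochner_Integration.integral_diff) auto
  ultimately show "cdf_of M (t - \<eta>) - \<eta> \<le> poisson_cdf \<epsilon> M t" by simp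
  have "poisson_cdf \<epsilon> M t \<le> (\<integral>x. indicator {..t + \<eta>} x + \<eta> \<partial>M)"
    unfolding poisson_cdf_def using upper int by (intro integral_mono integrable_arctan[OF M]) auto
  moreover have "(\<integral>x. indicator {..t + \<eta>} x + \<eta> \<partial>M) = cdf_of M (t + \<eta>) + \<eta>"
    using int[of "t + \<eta>"] ind[of "t + \<eta>"] pu by (subst Bochner_Integration.integral_add) auto
  ultimately show "poisson_cdf \<epsilon> M t \<le> cdf_of M (t + \<eta>) + \<eta>" by simp
qed

text \<open>Passing between the distribution functions costs \<eta> for each of the two smoothings
  and \<kappa> in between. The two inequalities in \<open>levy_dist\<close> are the same step with
  the roles of the measures exchanged.\<close>

lemma levy_dist_le_poisson:
  assumes M: "real_distribution M" and N: "real_distribution N" and \<epsilon>: "\<epsilon> > 0"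
    and MN: "\<And>t. poisson_cdf \<epsilon> M t \<le> poisson_cdf \<epsilon> N t + \<kappa>" and NM: "\<And>t. poisson_cdf \<epsilon> N t \<le> poisson_cdf \<epsilon> M t + \<kappa>"
    and \<delta>: "2 * sqrt (\<epsilon> / pi) + \<kappa> \<le> \<delta>" and \<kappa>: "\<kappa> \<ge> 0"
  shows "levy_dist M N \<le> \<delta>"
proof -
  define \<eta> where "\<eta> = sqrt (\<epsilon> / pi)"
  have \<eta>: "\<eta> > 0" "\<eta>\<^sup>2 = \<epsilon> / pi" using \<epsilon> by (auto simp: \<eta>_def)
  have mono: "cdf_of L a \<le> cdf_of L b" if "real_distribution L" "a \<le> b" for L a b
  proof -
    interpret real_distribution L by fact
    show ?thesis unfolding cdf_of_def using that(2) by (intro finite_measure_mono) auto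
  qed
  have step: "cdf_of K s \<le> cdf_of L (s + \<delta>) + \<delta>"
    if K: "real_distribution K" and L: "real_distribution L" and KL: "\<And>t. poisson_cdf \<epsilon> K t \<le> poisson_cdf \<epsilon> L t + \<kappa>" for K L s
  proof -
    have "cdf_of K s - \<eta> \<le> poisson_cdf \<epsilon> K (s + \<eta>)" using cdf_poisson_cdf(1)[OF K \<epsilon> \<eta>, of "s + \<eta>"] by simp
    also have "\<dots> \<le> poisson_cdf \<epsilon> L (s + \<eta>) + \<kappa>" by (rule KL)
    also have "poisson_cdf \<epsilon> L (s + \<eta>) \<le> cdf_of L (s + \<eta> + \<eta>) + \<eta>" by (rule cdf_poisson_cdf(2)[OF L \<epsilon> \<eta>])
    also have "cdf_of L (s + \<eta> + \<eta>) \<le> cdf_of L (s + \<delta>)" using \<delta> \<kappa> by (intro mono[OF L]) (simp add: \<eta>_def)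
    finally show ?thesis using \<delta> by (simp add: \<eta>_def)
  qed
  have "\<delta> \<in> {\<epsilon>. \<epsilon> > 0 \<and> (\<forall>t. cdf_of M (t - \<epsilon>) - \<epsilon> \<le> cdf_of N t \<and> cdf_of N t \<le> cdf_of M (t + \<epsilon>) + \<epsilon>)}"
  proof (intro CollectI conjI allI)
    show "\<delta> > 0" using \<delta>[folded \<eta>_def] \<eta>(1) \<kappa> by linarith
    fix t
    show "cdf_of M (t - \<delta>) - \<delta> \<le> cdf_of N t" using step[OF M N MN, of "t - \<delta>"] by simp
    show "cdf_of N t \<le> cdf_of M (t + \<delta>) + \<delta>" by (rule step[OF N M NM])
  qed
  then show ?thesis unfolding levy_dist_def by (intro cInf_lower bdd_belowI[of _ 0]) auto
qed

section \<open>Comparison of two Bernoulli elements\<close>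

locale bernoulli_pair = opval_space E B + state_space \<phi>
  for E :: "'a::cstar_algebra \<Rightarrow> 'a" and B \<phi> +
  fixes B0 B1 :: 'a
  assumes bern0: "bernoulli E B B0" and bern1: "bernoulli E B B1" and phi_E: "\<phi> (E x) = \<phi> x"
begin

definition "var_dist = op_norm_on B (\<lambda>x. variance E B1 x - variance E B0 x)"

lemma var_dist_nonneg: "var_dist \<ge> 0"
  unfolding var_dist_def by (rule op_norm_variance)

text \<open>For \<open>b = z 1\<close> the variance map is evaluated only at multiples of 1. Both
  the left and the right form are recorded because the comparison puts one transform on each
  side.\<close>

lemma cauchy_transform_bernoulli:
  assumes bern: "bernoulli E B s" and z: "Im z > 0"
  defines "R \<equiv> inverse_el (cscale z 1 - s)"
  shows "cscale z (E R) = 1 + cscale (1 / z) (variance E s 1 * E R)" "cscale z (E R) = 1 + cscale (1 / z) (E R * variance E s 1)"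
proof -
  have sa: "adj s = s" using bern by (simp add: bernoulli_def)
  define T where "T = cscale z 1 - s"
  have pos: "positive_el (im_el T - of_real (Im z))" by (simp add: T_def im_el_resolvent sa)
  have z0: "z \<noteq> 0" using z by auto
  have RT: "R = inverse_el T" by (simp add: R_def T_def)
  have R: "T * R = 1" "R * T = 1" using inverse_el[OF invertible_of_im_el(1)[OF pos z]] by (simp_all add: RT)
  have Tw: "(cscale c 1 - s) * v \<in> word_space B s" if "v \<in> word_space B s" for c v
    using that by (simp add: left_diff_distrib cscale_1_mult subspace_diff[OF subspace_word_space] word_space_cscale word_space_mult_s)
  have aT: "adj T = cscale (cnj z) 1 - s" by (simp add: T_def adj_diff adj_cscale sa)
  have RW: "R \<in> word_space B s" unfolding RT
    by (rule invertible_of_im_el(3)[OF pos z subspace_word_space word_space_cscale closed_word_space word_space_one])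
       (auto simp: T_def intro: Tw)
  have aRW: "adj R \<in> word_space B s" unfolding RT
    by (rule adj_inverse_in_subspace[OF pos z subspace_word_space word_space_cscale closed_word_space word_space_one])
       (auto simp: aT intro: Tw)
  have var: "variance E s (cscale c 1) = cscale c (variance E s 1)" for c
    by (simp add: variance_def cscale_left_mult cscale_right_mult E_cscale)
  \<comment> \<open>Used for \<open>z\<close> with \<open>R\<close> and for \<open>cnj z\<close>
    with \<open>adj R\<close>; the latter gives the second equation after taking adjoints.\<close>
  have main: "cscale c (E Q) = 1 + cscale (1 / c) (variance E s 1 * E Q)"
    if "c \<noteq> 0" "Q \<in> word_space B s" "(cscale c 1 - s) * Q = 1" for c Q
    using bernoulli_resolvent[OF bern, of "cscale c 1" "cscale (1 / c) 1" Q] that B_cscale[OF B_one]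
    by (simp add: var cscale_left_mult cscale_right_mult cscale_cscale)
  show "cscale z (E R) = 1 + cscale (1 / z) (variance E s 1 * E R)"
    using main[OF z0 RW] R by (simp add: T_def)
  have "adj T * adj R = 1" using R by (simp flip: adj_mult)
  then have "cscale (cnj z) (E (adj R)) = 1 + cscale (1 / cnj z) (variance E s 1 * E (adj R))"
    using z0 aRW by (intro main) (simp_all add: aT)
  then have "adj (cscale (cnj z) (E (adj R))) = adj (1 + cscale (1 / cnj z) (variance E s 1 * E (adj R)))" by (simp only:)
  then show "cscale z (E R) = 1 + cscale (1 / z) (E R * variance E s 1)"
    using variance_adj[OF sa, of 1] by (simp add: adj_cscale adj_add adj_mult E_adj adj_adj)
qed

lemma cauchy_scalar_diff_bound:
  fixes t \<epsilon> :: real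
  assumes \<epsilon>: "\<epsilon> > 0"
  defines "R0 \<equiv> inverse_el (cscale (Complex t \<epsilon>) 1 - B0)" and "R1 \<equiv> inverse_el (cscale (Complex t \<epsilon>) 1 - B1)"
  shows "cmod (cauchy_scalar \<phi> B1 (Complex t \<epsilon>) - cauchy_scalar \<phi> B0 (Complex t \<epsilon>))
    \<le> var_dist / (2 * \<epsilon>) * (Re (\<phi> (adj R1 * R1)) + Re (\<phi> (adj R0 * R0)))"
proof -
  define z where "z = Complex t \<epsilon>"
  have z: "Im z > 0" "z \<noteq> 0" using \<epsilon> by (auto simp: z_def complex_eq_iff)
  have sa: "adj B0 = B0" "adj B1 = B1" using bern0 bern1 by (simp_all add: bernoulli_def)
  define d where "d = variance E B1 1 - variance E B0 1"
  have "norm d \<le> var_dist * norm (1 :: 'a)"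
    unfolding d_def var_dist_def by (rule op_norm_variance(2)[OF B_one])
  then have d: "norm d \<le> var_dist" by simp
  let ?G0 = "E R0" and ?G1 = "E R1"
  have g0: "cscale z ?G0 = 1 + cscale (1 / z) (variance E B0 1 * ?G0)"
    using cauchy_transform_bernoulli(1)[OF bern0 z(1)] by (simp add: R0_def z_def)
  have g1: "cscale z ?G1 = 1 + cscale (1 / z) (?G1 * variance E B1 1)"
    using cauchy_transform_bernoulli(2)[OF bern1 z(1)] by (simp add: R1_def z_def)
  have "?G1 * cscale z ?G0 = ?G1 + cscale (1 / z) (?G1 * variance E B0 1 * ?G0)"
    unfolding g0 by (simp add: distrib_left cscale_right_mult mult.assoc)
  moreover have "cscale z ?G1 * ?G0 = ?G0 + cscale (1 / z) (?G1 * variance E B1 1 * ?G0)"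
    unfolding g1 by (simp add: distrib_right cscale_left_mult)
  ultimately have "?G1 - ?G0 = cscale (1 / z) (?G1 * variance E B1 1 * ?G0) - cscale (1 / z) (?G1 * variance E B0 1 * ?G0)"
    by (simp add: cscale_left_mult cscale_right_mult algebra_simps)
  also have "\<dots> = cscale (1 / z) (?G1 * d * ?G0)"
    by (simp add: d_def algebra_simps cscale_diff_right)
  finally have "\<phi> (?G1 - ?G0) = (1 / z) * \<phi> (?G1 * d * ?G0)" by (simp only: phi_cscale)
  then have "\<phi> R1 - \<phi> R0 = (1 / z) * \<phi> (?G1 * d * ?G0)" by (simp add: phi_diff phi_E)
  then have "cmod (\<phi> R1 - \<phi> R0) = cmod (\<phi> (?G1 * d * ?G0)) / cmod z" by (simp add: norm_mult norm_divide)
  \<comment> \<open>The factor \<open>1 / z\<close> contributes one of the two powers of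
    \<open>1 / \<epsilon>\<close> in the final bound, since the modulus of \<open>z\<close> is at
    least its imaginary part.\<close>
  also have "\<dots> \<le> cmod (\<phi> (?G1 * d * ?G0)) / \<epsilon>"
    using abs_Im_le_cmod[of z] \<epsilon> by (intro divide_left_mono) (auto simp: z_def intro!: mult_pos_pos)
  also have "\<dots> \<le> (var_dist / 2 * (Re (\<phi> (adj R1 * R1)) + Re (\<phi> (adj R0 * R0)))) / \<epsilon>"
  proof (rule divide_right_mono)
    have "2 * cmod (\<phi> (adj (adj ?G1) * d * ?G0)) \<le> var_dist * (Re (\<phi> (adj (adj ?G1) * adj ?G1)) + Re (\<phi> (adj ?G0 * ?G0)))"
      by (rule phi_cauchy_schwarz[OF d])
    also have "\<dots> \<le> var_dist * (Re (\<phi> (adj R1 * R1)) + Re (\<phi> (adj R0 * R0)))"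
    proof (intro mult_left_mono add_mono var_dist_nonneg)
      \<comment> \<open>For the left factor Cauchy-Schwarz produces \<open>G1 * adj G1\<close>. The
        Schwarz inequality for \<open>E\<close> passes to \<open>R1 * adj R1\<close>, and normality
        of the resolvent exchanges the two factors under the state.\<close>
      have "Re (\<phi> (adj (E (adj R1)) * E (adj R1))) \<le> Re (\<phi> (E (adj (adj R1) * adj R1)))"
        by (rule phi_mono[OF E_schwarz])
      also have "\<dots> = Re (\<phi> (adj R1 * R1))"
        using phi_resolvent_square(2)[OF sa(2) \<epsilon>, of t] by (simp add: phi_E adj_adj R1_def)
      finally show "Re (\<phi> (adj (adj ?G1) * adj ?G1)) \<le> Re (\<phi> (adj R1 * R1))" by (simp add: E_adj)
      have "Re (\<phi> (adj ?G0 * ?G0)) \<le> Re (\<phi> (E (adj R0 * R0)))" by (rule phi_mono[OF E_schwarz])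
      then show "Re (\<phi> (adj ?G0 * ?G0)) \<le> Re (\<phi> (adj R0 * R0))" by (simp add: phi_E)
    qed
    finally show "cmod (\<phi> (?G1 * d * ?G0)) \<le> var_dist / 2 * (Re (\<phi> (adj R1 * R1)) + Re (\<phi> (adj R0 * R0)))"
      by (simp add: adj_adj)
  qed (use \<epsilon> in simp)
  finally show ?thesis by (simp add: cauchy_scalar_def R0_def R1_def)
qed

abbreviation "\<mu>0 \<equiv> distribution \<phi> B0"
abbreviation "\<mu>1 \<equiv> distribution \<phi> B1"

lemma real_distribution_mu: "real_distribution \<mu>0" "real_distribution \<mu>1"
  using bern0 bern1 distribution_props(1) by (auto simp: bernoulli_def)

text \<open>Since \<open>poisson_density\<close> is \<epsilon> times the state of
  \<open>adj R * R\<close>, the estimate with \<open>var_dist / (2 * \<epsilon>)\<close> acquires a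
  further \<open>1 / \<epsilon>\<close> when written through densities, whose integrals are at most
  \<open>pi\<close>.\<close>

definition bound :: "real \<Rightarrow> real \<Rightarrow> ennreal" where
  "bound \<epsilon> u = ennreal (var_dist / (2 * \<epsilon>\<^sup>2)) * (poisson_density \<epsilon> \<mu>1 u + poisson_density \<epsilon> \<mu>0 u)"

lemma poisson_density_resolvent:
  assumes sa: "adj s = s" and \<epsilon>: "\<epsilon> > 0"
  defines "R t \<equiv> inverse_el (cscale (Complex t \<epsilon>) 1 - s)"
  shows "poisson_density \<epsilon> (distribution \<phi> s) t = ennreal (\<epsilon> * Re (\<phi> (adj (R t) * R t)))"
    and "poisson_density \<epsilon> (distribution \<phi> s) t = ennreal (- Im (cauchy_scalar \<phi> s (Complex t \<epsilon>)))"
    and "Re (\<phi> (adj (R t) * R t)) \<ge> 0"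
proof -
  let ?M = "distribution \<phi> s"
  interpret M: real_distribution ?M by (rule distribution_props(1)[OF sa])
  have "poisson_density \<epsilon> ?M t = (\<integral>\<^sup>+x. ennreal \<epsilon> * ennreal (1 / ((t - x)\<^sup>2 + \<epsilon>\<^sup>2)) \<partial>?M)"
    unfolding poisson_density_def using \<epsilon> by (intro nn_integral_cong) (simp flip: ennreal_mult)
  also have "\<dots> = ennreal \<epsilon> * (\<integral>\<^sup>+x. ennreal (1 / ((t - x)\<^sup>2 + \<epsilon>\<^sup>2)) \<partial>?M)"
    by (rule nn_integral_cmult) measurable
  also have "\<dots> = ennreal \<epsilon> * ennreal (Re (\<phi> (adj (R t) * R t)))"
    using phi_resolvent_square(1)[OF sa \<epsilon>, of t] by (simp add: R_def)
  also have "\<dots> = ennreal (\<epsilon> * Re (\<phi> (adj (R t) * R t)))" using \<epsilon> by (simp add: ennreal_mult')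
  finally show 1: "poisson_density \<epsilon> ?M t = ennreal (\<epsilon> * Re (\<phi> (adj (R t) * R t)))" .
  then show "poisson_density \<epsilon> ?M t = ennreal (- Im (cauchy_scalar \<phi> s (Complex t \<epsilon>)))"
    using phi_resolvent_square(3)[OF sa \<epsilon>, of t] by (simp add: R_def)
  show "Re (\<phi> (adj (R t) * R t)) \<ge> 0" by (intro phi_positive_Re positive_el_adj_mult)
qed

lemma cauchy_scalar_diff_le_bound:
  assumes \<epsilon>: "\<epsilon> > 0"
  shows "ennreal (cmod (cauchy_scalar \<phi> B1 (Complex t \<epsilon>) - cauchy_scalar \<phi> B0 (Complex t \<epsilon>))) \<le> bound \<epsilon> t"
proof -
  have sa: "adj B0 = B0" "adj B1 = B1" using bern0 bern1 by (simp_all add: bernoulli_def)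
  define r0 where "r0 = (let R = inverse_el (cscale (Complex t \<epsilon>) 1 - B0) in Re (\<phi> (adj R * R)))"
  define r1 where "r1 = (let R = inverse_el (cscale (Complex t \<epsilon>) 1 - B1) in Re (\<phi> (adj R * R)))"
  note p0 = poisson_density_resolvent[OF sa(1) \<epsilon>, of t] and p1 = poisson_density_resolvent[OF sa(2) \<epsilon>, of t]
  have r: "r0 \<ge> 0" "r1 \<ge> 0" using p0(3) p1(3) by (simp_all add: r0_def r1_def Let_def)
  have "bound \<epsilon> t = ennreal (var_dist / (2 * \<epsilon>\<^sup>2)) * (ennreal (\<epsilon> * r1) + ennreal (\<epsilon> * r0))"
    using p0(1) p1(1) by (simp add: bound_def r0_def r1_def Let_def)
  also have "\<dots> = ennreal (var_dist / (2 * \<epsilon>\<^sup>2) * (\<epsilon> * r1 + \<epsilon> * r0))"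
    using r \<epsilon> var_dist_nonneg
    by (subst ennreal_plus[symmetric], simp, simp, subst ennreal_mult[symmetric]) auto
  also have "var_dist / (2 * \<epsilon>\<^sup>2) * (\<epsilon> * r1 + \<epsilon> * r0) = var_dist / (2 * \<epsilon>) * (r1 + r0)"
    using \<epsilon> by (simp add: power2_eq_square field_simps)
  finally have b: "bound \<epsilon> t = ennreal (var_dist / (2 * \<epsilon>) * (r1 + r0))" .
  show ?thesis unfolding b using cauchy_scalar_diff_bound[OF \<epsilon>, of t]
    by (intro ennreal_leI) (simp add: r0_def r1_def Let_def)
qed

lemma measurable_bound [measurable]: "bound \<epsilon> \<in> borel_measurable lborel"
proof -
  note [measurable] = measurable_poisson_density[OF real_distribution_mu(1)] measurable_poisson_density[OF real_distribution_mu(2)]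
  show ?thesis unfolding bound_def by measurable
qed

lemma nn_integral_bound:
  assumes \<epsilon>: "\<epsilon> > 0"
  shows "(\<integral>\<^sup>+u. bound \<epsilon> u \<partial>lborel) \<le> ennreal (pi / \<epsilon>\<^sup>2 * var_dist)"
proof -
  note [measurable] = measurable_poisson_density[OF real_distribution_mu(1)] measurable_poisson_density[OF real_distribution_mu(2)]
  have "(\<integral>\<^sup>+u. bound \<epsilon> u \<partial>lborel) = ennreal (var_dist / (2 * \<epsilon>\<^sup>2)) *
      ((\<integral>\<^sup>+u. poisson_density \<epsilon> \<mu>1 u \<partial>lborel) + (\<integral>\<^sup>+u. poisson_density \<epsilon> \<mu>0 u \<partial>lborel))"
    unfolding bound_def by (simp add: nn_integral_cmult nn_integral_add)
  also have "\<dots> \<le> ennreal (var_dist / (2 * \<epsilon>\<^sup>2)) * (ennreal pi + ennreal pi)"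
    by (intro mult_left_mono add_mono poisson_density_total real_distribution_mu \<epsilon>) simp
  also have "\<dots> = ennreal (var_dist / (2 * \<epsilon>\<^sup>2) * (pi + pi))"
    using var_dist_nonneg
    by (subst ennreal_plus[symmetric], simp, simp, subst ennreal_mult[symmetric]) auto
  also have "var_dist / (2 * \<epsilon>\<^sup>2) * (pi + pi) = pi / \<epsilon>\<^sup>2 * var_dist" by (simp add: field_simps)
  finally show ?thesis .
qed

lemma nn_integral_cauchy_diff:
  assumes \<epsilon>: "\<epsilon> > 0"
  shows "(\<integral>\<^sup>+t. ennreal (cmod (cauchy_scalar \<phi> B1 (Complex t \<epsilon>) - cauchy_scalar \<phi> B0 (Complex t \<epsilon>))) \<partial>lborel)
    \<le> ennreal (pi / \<epsilon>\<^sup>2 * var_dist)"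
  by (rule order_trans[OF nn_integral_mono nn_integral_bound[OF \<epsilon>]]) (rule cauchy_scalar_diff_le_bound[OF \<epsilon>])

lemma levy_dist_bernoulli:
  assumes \<epsilon>: "\<epsilon> > 0" and \<delta>: "2 * sqrt (\<epsilon> / pi) + var_dist / \<epsilon>\<^sup>2 \<le> \<delta>"
  shows "levy_dist \<mu>1 \<mu>0 \<le> \<delta>"
proof (rule levy_dist_le_poisson[OF real_distribution_mu(2,1) \<epsilon> _ _ \<delta>])
  show k0: "var_dist / \<epsilon>\<^sup>2 \<ge> 0" using var_dist_nonneg by simp
  have sa: "adj B0 = B0" "adj B1 = B1" using bern0 bern1 by (simp_all add: bernoulli_def)
  have b: "(\<integral>\<^sup>+u. bound \<epsilon> u \<partial>lborel) \<le> ennreal (pi * (var_dist / \<epsilon>\<^sup>2))"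
    using nn_integral_bound[OF \<epsilon>] by simp
  have le: "ennreal (- Im w) \<le> ennreal (- Im w') + b" if "ennreal (cmod (w - w')) \<le> b" for w w' b
  proof -
    have "- Im w \<le> - Im w' + cmod (w - w')" using abs_Im_le_cmod[of "w - w'"] by simp
    then have "ennreal (- Im w) \<le> ennreal (- Im w' + cmod (w - w'))" by (rule ennreal_leI)
    also have "\<dots> \<le> ennreal (- Im w') + ennreal (cmod (w - w'))" 
    \<comment> \<open>The conversion \<open>ennreal\<close> truncates negative numbers to 0, hence
      the case distinction.\<close>
    proof (cases "- Im w' \<ge> 0")
      case True
      then show ?thesis by (subst ennreal_plus[symmetric]) auto
    next
      case False
      then have "ennreal (- Im w' + cmod (w - w')) \<le> ennreal (cmod (w - w'))" by (intro ennreal_leI) simp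
      then show ?thesis using False by (simp add: ennreal_neg)
    qed
    finally show ?thesis using that by (meson add_left_mono order_trans)
  qed
  note p0 = poisson_density_resolvent(2)[OF sa(1) \<epsilon>] and p1 = poisson_density_resolvent(2)[OF sa(2) \<epsilon>]
  note db = cauchy_scalar_diff_le_bound[OF \<epsilon>]
  show "poisson_cdf \<epsilon> \<mu>1 t \<le> poisson_cdf \<epsilon> \<mu>0 t + var_dist / \<epsilon>\<^sup>2" for t
    by (rule poisson_cdf_le[OF real_distribution_mu(2,1) \<epsilon> k0 measurable_bound b]) (simp only: p0 p1 le db)
  show "poisson_cdf \<epsilon> \<mu>0 t \<le> poisson_cdf \<epsilon> \<mu>1 t + var_dist / \<epsilon>\<^sup>2" for t
    by (rule poisson_cdf_le[OF real_distribution_mu(1,2) \<epsilon> k0 measurable_bound b])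
       (use db in \<open>simp only: p0 p1 le norm_minus_commute\<close>)
qed

text \<open>The minimum of \<open>2 \<surd>(\<epsilon>/\<pi>) + D/\<epsilon>\<^sup>2\<close> is attained at \<open>\<epsilon> = (4 \<pi> D\<^sup>2)\<^sup>1\<^sup>/\<^sup>5\<close>; below \<open>a = (4 \<pi>)\<^sup>1\<^sup>/\<^sup>1\<^sup>0\<close>
and \<open>d = D\<^sup>1\<^sup>/\<^sup>5\<close>, so that \<open>\<epsilon> = (a d)\<^sup>2\<close>.\<close>

lemma levy_dist_bernoulli_optimal:
  "levy_dist \<mu>1 \<mu>0 \<le> 5 * (1 / (4 * pi)) powr (2 / 5) * var_dist powr (1 / 5)"
proof (cases "var_dist = 0")
  case True
  \<comment> \<open>The optimal \<epsilon> would be 0 here, so every \<delta> is reached instead,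
    with \<epsilon> solving \<open>2 * sqrt (\<epsilon> / pi) = \<delta>\<close>.\<close>
  have "levy_dist \<mu>1 \<mu>0 \<le> 0"
  proof (rule field_le_epsilon)
    fix \<delta> :: real assume \<delta>: "\<delta> > 0"
    have "2 * sqrt ((pi * \<delta>\<^sup>2 / 4) / pi) = \<delta>" using \<delta> by (simp add: real_sqrt_divide)
    then show "levy_dist \<mu>1 \<mu>0 \<le> 0 + \<delta>"
      using \<delta> True by (intro levy_dist_bernoulli[of "pi * \<delta>\<^sup>2 / 4"]) simp_all
  qed
  then show ?thesis using True by simp
next
  case False
  then have D: "var_dist > 0" using var_dist_nonneg by simp
  define d where "d = var_dist powr (1 / 5)"
  define a where "a = (4 * pi) powr (1 / 10)"
  have pos: "d > 0" "a > 0" using D by (auto simp: d_def a_def)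
  have d5: "var_dist = d ^ 5" using D by (simp add: d_def powr_powr flip: powr_realpow)
  have a10: "4 * pi = a ^ 10" by (simp add: a_def powr_powr flip: powr_realpow)
  have c: "(1 / (4 * pi)) powr (2 / 5) = 1 / a ^ 4"
  proof -
    have "(1 / (4 * pi)) powr (2 / 5) = 1 / (4 * pi) powr (2 / 5)" by (simp add: powr_divide)
    also have "(4 * pi) powr (2 / 5) = a ^ 4" by (simp add: a_def powr_powr flip: powr_realpow)
    finally show ?thesis .
  qed
  define \<epsilon> where "\<epsilon> = (a * d)\<^sup>2"
  have "\<epsilon> > 0" using pos by (simp add: \<epsilon>_def)
  moreover have "2 * sqrt (\<epsilon> / pi) + var_dist / \<epsilon>\<^sup>2 = 5 * (1 / a ^ 4) * d"
  proof -
    have pi: "pi = (a ^ 5 / 2)\<^sup>2" using a10 by (simp add: power_divide flip: power_mult)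
    have "sqrt (\<epsilon> / pi) = (a * d) / (a ^ 5 / 2)"
      by (subst pi) (use pos in \<open>simp add: \<epsilon>_def real_sqrt_divide\<close>)
    also have "\<dots> = 2 * d / a ^ 4" using pos by (simp add: field_simps eval_nat_numeral)
    finally have s: "sqrt (\<epsilon> / pi) = 2 * d / a ^ 4" .
    have "var_dist / \<epsilon>\<^sup>2 = d / a ^ 4" using pos by (simp add: d5 \<epsilon>_def field_simps eval_nat_numeral)
    then show ?thesis using s by (simp add: field_simps)
  qed
  ultimately show ?thesis unfolding c d_def[symmetric] by (intro levy_dist_bernoulli[of \<epsilon>]) simp_all
qed

end

theorem theorem4p2:
  fixes E :: "'a::cstar_algebra \<Rightarrow> 'a" and \<B> :: "'a set" and B0 B1 :: 'a
  assumes space: "opval_cstar_prob_space E \<B>"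
    and bern0: "bernoulli E \<B> B0"
    and bern1: "bernoulli E \<B> B1"
  shows "(\<forall>k b. k \<ge> 1 \<and> mat_upper_half k \<B> b \<longrightarrow>
            mat_norm k (mat_diff (cauchy_mat E k B1 b) (cauchy_mat E k B0 b))
              \<le> real k * (mat_norm k (mat_inverse k (mat_Im b))) ^ 3
                 * op_norm_on \<B> (\<lambda>x. variance E B1 x - variance E B0 x))
      \<and> (\<forall>\<phi>. von_neumann_algebra TYPE('a) \<and> normal_state \<phi> \<and> faithful \<phi> \<and>
            (\<forall>x. \<phi> (E x) = \<phi> x) \<longrightarrow>
          ((\<forall>\<epsilon>::real. \<epsilon> > 0 \<longrightarrow>
             (\<integral>\<^sup>+ t. ennreal (cmod (cauchy_scalar \<phi> B1 (Complex t \<epsilon>)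
                                    - cauchy_scalar \<phi> B0 (Complex t \<epsilon>))) \<partial>lborel)
             \<le> ennreal (pi / \<epsilon>\<^sup>2 * op_norm_on \<B> (\<lambda>x. variance E B1 x - variance E B0 x)))
          \<and> levy_dist (distribution \<phi> B1) (distribution \<phi> B0)
             \<le> 5 * (1 / (4 * pi)) powr (2 / 5)
                 * op_norm_on \<B> (\<lambda>x. variance E B1 x - variance E B0 x) powr (1 / 5)))"
proof (intro conjI allI impI)
  interpret opval_space E \<B> by standard (rule space)
  fix k b assume "k \<ge> 1 \<and> mat_upper_half k \<B> b"
  then show "mat_norm k (mat_diff (cauchy_mat E k B1 b) (cauchy_mat E k B0 b))
      \<le> real k * (mat_norm k (mat_inverse k (mat_Im b))) ^ 3
        * op_norm_on \<B> (\<lambda>x. variance E B1 x - variance E B0 x)"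
    by (intro cauchy_mat_diff_bound bern0 bern1) auto
next
  fix \<phi> :: "'a \<Rightarrow> complex" and \<epsilon> :: real
  assume \<phi>: "von_neumann_algebra TYPE('a) \<and> normal_state \<phi> \<and> faithful \<phi> \<and> (\<forall>x. \<phi> (E x) = \<phi> x)" and "\<epsilon> > 0"
  interpret bernoulli_pair E \<B> \<phi> B0 B1
    using space bern0 bern1 \<phi> by unfold_locales (auto simp: normal_state_def)
  show "(\<integral>\<^sup>+ t. ennreal (cmod (cauchy_scalar \<phi> B1 (Complex t \<epsilon>) - cauchy_scalar \<phi> B0 (Complex t \<epsilon>))) \<partial>lborel)
      \<le> ennreal (pi / \<epsilon>\<^sup>2 * op_norm_on \<B> (\<lambda>x. variance E B1 x - variance E B0 x))"
    using nn_integral_cauchy_diff[OF \<open>\<epsilon> > 0\<close>] by (simp add: var_dist_def)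
next
  fix \<phi> :: "'a \<Rightarrow> complex"
  assume \<phi>: "von_neumann_algebra TYPE('a) \<and> normal_state \<phi> \<and> faithful \<phi> \<and> (\<forall>x. \<phi> (E x) = \<phi> x)"
  interpret bernoulli_pair E \<B> \<phi> B0 B1
    using space bern0 bern1 \<phi> by unfold_locales (auto simp: normal_state_def)
  show "levy_dist (distribution \<phi> B1) (distribution \<phi> B0)
      \<le> 5 * (1 / (4 * pi)) powr (2 / 5) * op_norm_on \<B> (\<lambda>x. variance E B1 x - variance E B0 x) powr (1 / 5)"
    using levy_dist_bernoulli_optimal by (simp add: var_dist_def)
qed

end
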